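(* For $Y \nearrow Y_c$, we have $$\int_{\Omega} |\nabla \omega_Y|^2 \le |\Omega_f|\,(Y_c-Y)^2 .$$ Moreover, the sequence of rescaled profiles $$v_Y := \frac{\omega_Y}{\int_\Omega |\nabla \omega_Y|}$$ converges in $L^1$, up to possibly taking a sequence, to a solution of Problem 1, that is, of the problem: find a minimizer of $\mathrm{TV}$ over the set $\mathrm{BV}_\diamond$.
   Context: Setting: $\Omega_s\subset\Omega\subset\mathbb{R}^2$ are bounded and strongly Lipschitz, $\partial\Omega_s\cap\partial\Omega=\emptyset$, and $\Omega_s$ has finitely many connected components. Put $\Omega_f:=\Omega\setminus\Omega_s$. Let $$H_\diamond=\Big\{v\in H^1_0(\Omega)\ :\ \int_\Omega v=0,\ \nabla v=0\text{ in }\Omega_s\Big\}.$$ For $Y\ge 0$ let $\omega_Y$ be the unique minimizer over $H_\diamond$ of $$G_Y^\diamond(\omega)=\frac12\int_{\Omega_f}|\nabla\omega|^2+Y\int_{\Omega_f}|\nabla\omega|-\int_{\Omega_s}\omega .$$ The critical yield number is $$Y_c:=\sup_{\omega\in H_\diamond}\frac{\int_{\Omega_s}\omega}{\int_\Omega|\nabla\omega|}$$ (the supremum being over those $\omega$ for which the quotient is defined, i.e. $\omega\neq 0$). For $v\in L^1(\mathbb{R}^2)$, $\mathrm{TV}(v)$ denotes the total variation, i.e. the total mass of the distributional gradient $\nabla v$ on $\mathbb{R}^2$, and $$\mathrm{BV}_\diamond:=\Big\{v\in\mathrm{BV}(\mathbb{R}^2)\ :\ \int_\Omega v=0,\ \frac{1}{|\Omega_s|}\int_{\Omega_s}v=1,\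 \nabla v=0\text{ on }\Omega_s,\ v=0\text{ on }\mathbb{R}^2\setminus\Omega\Big\}.$$ Problem 1 is introduced as an equivalent form of minimizing the quotient $E(v)=\mathrm{TV}(v)/\int_{\Omega_s}v$ over the set of $v\in\mathrm{BV}(\mathbb{R}^2)$ with $\int_\Omega v=0$, $\nabla v=0$ on $\Omega_s$ and $v=0$ on $\mathbb{R}^2\setminus\Omega$: since $E$ is invariant under scalar multiplication, the constraint $\frac{1}{|\Omega_s|}\int_{\Omega_s}v=1$ can be added without changing the minimal value of $E$. Functions in $H_\diamond$ are extended by $0$ to $\mathbb{R}^2$.
   Formalization: The limit of v_Y has mean Y_c/|Ω_s| over Ω_s, in general not 1, so it need not lie in BV_⋄; the formal claim is that its integral over Ω_s is positive and its multiple with mean 1 over Ω_s minimizes TV over BV_⋄. *)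

theory Defs
  imports "HOL-Analysis.Analysis"
begin

primrec Ck :: "nat \<Rightarrow> ('a::euclidean_space \<Rightarrow> 'b::real_normed_vector) \<Rightarrow> bool" where
  "Ck 0 f \<longleftrightarrow> continuous_on UNIV f"
| "Ck (Suc k) f \<longleftrightarrow> (\<forall>x. f differentiable (at x)) \<and>
     (\<forall>b\<in>Basis. Ck k (\<lambda>x. frechet_derivative f (at x) b))"

definition test_fun :: "'a::euclidean_space set \<Rightarrow> ('a \<Rightarrow> 'b::real_normed_vector) set" where
  "test_fun U = {\<phi>. (\<forall>k. Ck k \<phi>) \<and> compact (closure {x. \<phi> x \<noteq> 0}) \<and> closure {x. \<phi> x \<noteq> 0} \<subseteq> U}"

definition divergence :: "('a::euclidean_space \<Rightarrow> 'a) \<Rightarrow> 'a \<Rightarrow> real" where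
  "divergence \<phi> x = (\<Sum>b\<in>Basis. frechet_derivative \<phi> (at x) b \<bullet> b)"

text \<open>
  Near every boundary point the set lies on one side of the graph of a Lipschitz function.
  Here \<open>n\<close> is the direction of the graph and \<open>y - (y \<bullet> n) *\<^sub>R n\<close> is the projection of \<open>y\<close>
  to the hyperplane orthogonal to it.
\<close>

definition strongly_lipschitz :: "'a::euclidean_space set \<Rightarrow> bool" where
  "strongly_lipschitz U \<longleftrightarrow> open U \<and>
     (\<forall>x\<in>frontier U. \<exists>n r L \<gamma>. norm n = 1 \<and> 0 < r \<and> L-lipschitz_on UNIV \<gamma> \<and>
        U \<inter> ball x r = {y \<in> ball x r. \<gamma> (y - (y \<bullet> n) *\<^sub>R n) < y \<bullet> n})"

definition L2 :: "'a::euclidean_space set \<Rightarrow> ('a \<Rightarrow> 'b::euclidean_space) set" where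
  "L2 U = {f. set_borel_measurable lebesgue U f \<and> set_integrable lebesgue U (\<lambda>x. (norm (f x))\<^sup>2)}"

definition is_weak_gradient :: "'a::euclidean_space set \<Rightarrow> ('a \<Rightarrow> real) \<Rightarrow> ('a \<Rightarrow> 'a) \<Rightarrow> bool" where
  "is_weak_gradient U v g \<longleftrightarrow>
     (\<forall>K. compact K \<and> K \<subseteq> U \<longrightarrow> set_integrable lebesgue K v \<and> set_integrable lebesgue K g) \<and>
     (\<forall>\<phi>\<in>test_fun U. \<forall>b\<in>Basis.
        (LINT x:U|lebesgue. v x * frechet_derivative \<phi> (at x) b)
          = - (LINT x:U|lebesgue. (g x \<bullet> b) * \<phi> x))"

text \<open>For open \<open>U\<close> the weak gradient is unique almost everywhere on \<open>U\<close>; \<open>wgrad\<close> selects a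
  representative. It is only used below for functions that have a weak gradient, and only in ways
  that do not depend on the representative.\<close>

definition wgrad :: "'a::euclidean_space set \<Rightarrow> ('a \<Rightarrow> real) \<Rightarrow> 'a \<Rightarrow> 'a" where
  "wgrad U v = (SOME g. is_weak_gradient U v g)"

definition H1 :: "'a::euclidean_space set \<Rightarrow> ('a \<Rightarrow> real) set" where
  "H1 U = {v \<in> L2 U. (\<exists>g. is_weak_gradient U v g) \<and> wgrad U v \<in> L2 U}"

definition H10 :: "'a::euclidean_space set \<Rightarrow> ('a \<Rightarrow> real) set" where
  "H10 U = {v \<in> H1 U. \<exists>\<phi>. (\<forall>n. \<phi> n \<in> test_fun U) \<and>
     (\<lambda>n::nat. (LINT x:U|lebesgue. (v x - \<phi> n x)\<^sup>2)
            + (LINT x:U|lebesgue. (norm (wgrad U v x - wgrad U (\<phi> n) x))\<^sup>2)) \<longlonglongrightarrow> 0}"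

text \<open>The distributional gradient acts on vector-valued test functions. Its total mass is the
  supremum of its values on test functions bounded by 1.\<close>

definition dist_grad :: "('a::euclidean_space \<Rightarrow> real) \<Rightarrow> ('a \<Rightarrow> 'a) \<Rightarrow> real" where
  "dist_grad v \<phi> = - (LINT x|lebesgue. v x * divergence \<phi> x)"

definition TV :: "('a::euclidean_space \<Rightarrow> real) \<Rightarrow> ereal" where
  "TV v = (SUP \<phi>\<in>{\<phi> \<in> test_fun UNIV. \<forall>x. norm (\<phi> x) \<le> 1}. ereal (dist_grad v \<phi>))"

definition BV :: "('a::euclidean_space \<Rightarrow> real) set" where
  "BV = {v. integrable lebesgue v \<and> TV v < \<infinity>}"

text \<open>\<open>S\<close> is the solid part of \<open>\<Omega>\<close>. Members of \<open>H_diamond\<close> are extended by 0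
  to the whole space.\<close>

definition H_diamond :: "'a::euclidean_space set \<Rightarrow> 'a set \<Rightarrow> ('a \<Rightarrow> real) set" where
  "H_diamond \<Omega> S = {v \<in> H10 \<Omega>. (\<forall>x. x \<notin> \<Omega> \<longrightarrow> v x = 0) \<and> (LINT x:\<Omega>|lebesgue. v x) = 0 \<and>
     (AE x\<in>S in lebesgue. wgrad \<Omega> v x = 0)}"

definition G_diamond ::
  "'a::euclidean_space set \<Rightarrow> 'a set \<Rightarrow> real \<Rightarrow> ('a \<Rightarrow> real) \<Rightarrow> real" where
  "G_diamond \<Omega> S Y w =
     1/2 * (LINT x:\<Omega> - S|lebesgue. (norm (wgrad \<Omega> w x))\<^sup>2)
     + Y * (LINT x:\<Omega> - S|lebesgue. norm (wgrad \<Omega> w x))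
     - (LINT x:S|lebesgue. w x)"

definition critical_yield :: "'a::euclidean_space set \<Rightarrow> 'a set \<Rightarrow> real" where
  "critical_yield \<Omega> S =
     (SUP w\<in>{w \<in> H_diamond \<Omega> S. (LINT x:\<Omega>|lebesgue. norm (wgrad \<Omega> w x)) \<noteq> 0}.
        (LINT x:S|lebesgue. w x) / (LINT x:\<Omega>|lebesgue. norm (wgrad \<Omega> w x)))"

definition rescaled_profile ::
  "'a::euclidean_space set \<Rightarrow> ('a \<Rightarrow> real) \<Rightarrow> 'a \<Rightarrow> real" where
  "rescaled_profile \<Omega> w x = w x / (LINT y:\<Omega>|lebesgue. norm (wgrad \<Omega> w y))"

definition BV_diamond :: "'a::euclidean_space set \<Rightarrow> 'a set \<Rightarrow> ('a \<Rightarrow> real) set" where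
  "BV_diamond \<Omega> S = {v \<in> BV. (LINT x:\<Omega>|lebesgue. v x) = 0 \<and>
     1 / measure lebesgue S * (LINT x:S|lebesgue. v x) = 1 \<and>
     (\<forall>\<phi>\<in>test_fun S. dist_grad v \<phi> = 0) \<and>
     (AE x in lebesgue. x \<notin> \<Omega> \<longrightarrow> v x = 0)}"

definition problem1_solution :: "'a::euclidean_space set \<Rightarrow> 'a set \<Rightarrow> ('a \<Rightarrow> real) \<Rightarrow> bool" where
  "problem1_solution \<Omega> S v \<longleftrightarrow> is_arg_min TV (\<lambda>u. u \<in> BV_diamond \<Omega> S) v"

text \<open>The multiple of \<open>v\<close> whose mean over \<open>S\<close> is 1. The quotient of \<open>TV v\<close> and the integral of
  \<open>v\<close> over \<open>S\<close> is invariant under positive scaling, so \<open>v\<close> minimizes this quotient iff its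
  normalization minimizes \<open>TV\<close> over \<open>BV_diamond\<close>. The rescaled profiles are normalized by their
  total variation instead, so that their limits have to be brought to mean 1 over \<open>S\<close> first.\<close>

definition unit_mean :: "'a::euclidean_space set \<Rightarrow> ('a \<Rightarrow> real) \<Rightarrow> 'a \<Rightarrow> real" where
  "unit_mean S v x = measure lebesgue S / (LINT y:S|lebesgue. v y) * v x"

end

theory Submission
  imports Defs "HOL-Library.Diagonal_Subsequence" "HOL-Complex_Analysis.Great_Picard"
begin

text \<open>
  Along the ray \<open>t * \<omega>\<close> the functional is a quadratic polynomial in \<open>t\<close> that is minimal at \<open>t = 1\<close>;
  its derivative there and the definition of the critical yield number give
  \<open>\<integral>|\<nabla>\<omega>|\<^sup>2 \<le> (Y\<^sub>c - Y) \<integral>|\<nabla>\<omega>|\<close>, and the inequality of Cauchy and Schwarz on the fluid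
  part gives the estimate. The same identity shows that the load of the rescaled profiles tends to
  \<open>Y\<^sub>c\<close>. The profiles are bounded in BV, hence converge in \<open>L\<^sup>1\<close> along a subsequence; by lower
  semicontinuity the limit has total variation at most 1 and load \<open>Y\<^sub>c\<close>.

  It is optimal because the infimum of the quotient over BV is not smaller than the infimum over
  \<open>H_diamond\<close>: a competitor in BV is approximated by test functions with almost the same total
  variation. Using a smooth partition of unity, one locally shifts it along a direction that is
  transversal to the nearby boundary, so that its support retracts from \<open>\<partial>\<Omega>\<close> and the region where it
  is locally constant grows beyond the solid, and then mollifies at a much smaller scale.
\<close>

subsection \<open>Smooth functions\<close>

text \<open>Lower semicontinuity alone compares the limit only with members of
  \<open>H_diamond\<close>; on the larger class \<open>BV_diamond\<close> the infimum of
  \<open>TV\<close> might be smaller. Plain mollification does not exclude this gap, since it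
  spreads a competitor across the boundary of \<Omega> and spoils its constancy near the boundary of
  the solid. The shifted argument therefore has to move out of \<Omega>, where the competitor is
  zero, and into the solid. A strongly Lipschitz boundary supplies not just such a direction but a
  cone around it, and the aperture of this cone is the room in which mollification is harmless.
  Gluing the local shifts produces gradients of the weights. These gradients add up to zero on
  \<Omega>, so each of them may be multiplied by the difference of a shifted function and
  \<open>u\<close> instead of the shifted function itself. The weights are fixed before the shift is
  chosen, so these terms become small however large the gradients are. The mean value is repaired by
  a multiple of a bump inside the fluid, which leaves the load unchanged. The minimal value is |S| /
  Yc, and the limit of the profiles attains it once it is scaled to mean 1 over the solid.\<close>

lemma Ck_imp_continuous: "Ck k f \<Longrightarrow> continuous_on UNIV f"
  by (cases k) (auto intro!: differentiable_imp_continuous_on simp: differentiable_on_def)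

lemma Ck_SucD: "Ck (Suc k) f \<Longrightarrow> Ck k f"
proof (induction k arbitrary: f)
  case 0
  then show ?case using Ck_imp_continuous[OF 0] by simp
next
  case (Suc k)
  then show ?case using Ck.simps(2)[of k f] Ck.simps(2)[of "Suc k" f] by blast
qed

text \<open>\<open>Ck\<close> is phrased with \<open>frechet_derivative\<close>; uniqueness of the
  derivative lets any explicitly known \<open>f'\<close> take its place. The closure properties
  below are proved by induction through this rule.\<close>

lemma Ck_SucI:
  assumes "\<And>x. (f has_derivative f' x) (at x)" "\<And>b. b \<in> Basis \<Longrightarrow> Ck k (\<lambda>x. f' x b)"
  shows "Ck (Suc k) f"
proof -
  have "frechet_derivative f (at x) = f' x" for x
    using frechet_derivative_at[OF assms(1)] by simp
  then show ?thesis using assms by (auto simp: differentiable_def)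
qed

lemma Ck_Suc_has_derivative:
  "Ck (Suc k) f \<Longrightarrow> (f has_derivative frechet_derivative f (at x)) (at x)"
  by (simp add: frechet_derivative_works)

lemma Ck_Suc_partial: "Ck (Suc k) f \<Longrightarrow> b \<in> Basis \<Longrightarrow> Ck k (\<lambda>x. frechet_derivative f (at x) b)"
  by simp

lemma Ck_const: "Ck k (\<lambda>x. c)"
proof (induction k arbitrary: c)
  case (Suc k)
  show ?case by (rule Ck_SucI[where f'="\<lambda>x h. 0"]) (use Suc in auto)
qed auto

lemma Ck_add: "Ck k f \<Longrightarrow> Ck k g \<Longrightarrow> Ck k (\<lambda>x. f x + g x)"
proof (induction k arbitrary: f g)
  case (Suc k)
  show ?case
    by (rule Ck_SucI[OF has_derivative_add[OF Suc.prems[THEN Ck_Suc_has_derivative]]])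
       (use Suc in auto)
qed (auto intro: continuous_intros)

text \<open>The product rule gives a sum of two terms of the same bilinear shape, so the induction
  runs over all pairs \<open>f\<close>, \<open>g\<close>. One proof covers scaling, products and
  inner products.\<close>

lemma Ck_bounded_bilinear:
  assumes "bounded_bilinear B"
  shows "Ck k f \<Longrightarrow> Ck k g \<Longrightarrow> Ck k (\<lambda>x. B (f x) (g x))"
proof (induction k arbitrary: f g)
  case 0
  then show ?case using bounded_bilinear.continuous_on[OF assms] by auto
next
  case (Suc k)
  show ?case
    by (rule Ck_SucI[OF bounded_bilinear.FDERIV[OF assms Suc.prems[THEN Ck_Suc_has_derivative]]])
       (intro Ck_add Suc.IH Ck_SucD[OF Suc.prems(1)] Ck_SucD[OF Suc.prems(2)] Ck_Suc_partial Suc.prems)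
qed

lemmas Ck_scaleR = Ck_bounded_bilinear[OF bounded_bilinear_scaleR]
lemmas Ck_mult = Ck_bounded_bilinear[OF bounded_bilinear_mult]
lemmas Ck_inner = Ck_bounded_bilinear[OF bounded_bilinear_inner]

lemma Ck_id: "Ck k (\<lambda>x. x)"
proof (cases k)
  case (Suc m)
  then show ?thesis by (auto intro!: Ck_SucI[where f'="\<lambda>x h. h"] Ck_const simp del: Ck.simps)
qed (auto intro: continuous_intros)

lemma Ck_cmult: "Ck k f \<Longrightarrow> Ck k (\<lambda>x. c * f x)" for f :: "_ \<Rightarrow> real"
  by (intro Ck_mult Ck_const)

lemma Ck_diff: "Ck k f \<Longrightarrow> Ck k g \<Longrightarrow> Ck k (\<lambda>x. f x - g x)"
  using Ck_add[OF _ Ck_scaleR[OF Ck_const[of k "-1::real"]], of f g] by simp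

lemma Ck_sum: "(\<And>i. i \<in> I \<Longrightarrow> Ck k (f i)) \<Longrightarrow> Ck k (\<lambda>x. \<Sum>i\<in>I. f i x)"
  by (induction I rule: infinite_finite_induct) (auto intro: Ck_const Ck_add)

lemma Ck_translation: "Ck k f \<Longrightarrow> Ck k (\<lambda>x. f (x + a))"
proof (induction k arbitrary: f)
  case 0
  then show ?case
    by (auto intro!: continuous_on_compose2[of UNIV f] continuous_intros)
next
  case (Suc k)
  have "((\<lambda>x. f (x + a)) has_derivative frechet_derivative f (at (x + a))) (at x)" for x
    by (rule has_derivative_compose[OF _ Ck_Suc_has_derivative[OF Suc.prems]])
       (auto intro!: derivative_eq_intros)
  from this show ?case
    by (rule Ck_SucI) (rule Suc.IH, simp add: Suc.prems[simplified])
qed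

subsection \<open>A smooth bump function\<close>

text \<open>The functions \<open>s \<mapsto> s\<^sup>-\<^sup>m exp (-1/s)\<close>, extended by zero, form a family that is closed under
  differentiation up to linear combinations, which makes them smooth by induction.\<close>

definition flat :: "nat \<Rightarrow> real \<Rightarrow> real" where
  "flat m s = (if s > 0 then exp (- (1 / s)) / s ^ m else 0)"

text \<open>Substituting y = 1/s turns this into the decay of y^m / exp y at infinity.\<close>

lemma flat_tendsto_0: "(flat m \<longlongrightarrow> 0) (at 0)"
proof -
  have "((\<lambda>s::real. exp (- (1 / s)) / s ^ m) \<longlongrightarrow> 0) (at_right 0)"
  proof -
    have "((\<lambda>y::real. y ^ m / exp y) \<longlongrightarrow> 0) at_top" by (rule tendsto_power_div_exp_0)
    then have "((\<lambda>s::real. (inverse s) ^ m / exp (inverse s)) \<longlongrightarrow> 0) (at_right 0)"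
      by (rule filterlim_compose[OF _ filterlim_inverse_at_top_right])
    then show ?thesis by (simp add: exp_minus field_simps)
  qed
  then have "(flat m \<longlongrightarrow> 0) (at_right 0)"
    by (rule Lim_transform_eventually) (auto simp: flat_def eventually_at_filter)
  moreover have "(flat m \<longlongrightarrow> 0) (at_left 0)"
    by (rule Lim_transform_eventually[of "\<lambda>_. 0"]) (auto simp: flat_def eventually_at_filter)
  ultimately show ?thesis by (simp add: filterlim_split_at)
qed

lemma flat_deriv:
  "(flat m has_real_derivative (flat (m + 2) s - m * flat (Suc m) s)) (at s)"
proof -
  consider "s > 0" | "s < 0" | "s = 0" by linarith
  then show ?thesis
  proof cases
    case 1
    have "((\<lambda>s. exp (- (1 / s)) * (1 / s) ^ m) has_real_derivative
       (exp (- (1 / s)) * (1/s^2)) * (1 / s) ^ m + exp (- (1/s)) * (m * (1/s)^(m - 1) * (- (1/s^2)))) (at s)"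
    proof -
      have D: "((\<lambda>s. 1 / s) has_real_derivative - (1 / s\<^sup>2)) (at s)"
        using 1 by (auto intro!: derivative_eq_intros simp: power2_eq_square)
      from DERIV_mult[OF DERIV_fun_exp[OF DERIV_minus[OF D]] DERIV_power[OF D, of m]]
      show ?thesis by (rule DERIV_cong) simp
    qed
    also have "(exp (- (1 / s)) * (1/s^2)) * (1 / s) ^ m + exp (- (1/s)) * (m * (1/s)^(m - 1) * (- (1/s^2)))
        = flat (m + 2) s - m * flat (Suc m) s"
      using 1 by (cases m) (simp_all add: flat_def power2_eq_square field_simps)
    finally show ?thesis
      by (rule has_field_derivative_transform_within_open[where S="{0<..}"])
         (use 1 in \<open>auto simp: flat_def power_divide\<close>)
  next
    case 2
    have "((\<lambda>s. 0) has_real_derivative 0) (at s)" by auto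
    then have "(flat m has_real_derivative 0) (at s)"
      by (rule has_field_derivative_transform_within_open[where S="{..<0}"])
         (use 2 in \<open>auto simp: flat_def\<close>)
    then show ?thesis using 2 by (simp add: flat_def)
  next
    case 3
    \<comment> \<open>For h different from 0 the difference quotient of \<open>flat m\<close> at 0
      is exactly \<open>flat (Suc m) h\<close>, so the limit for the next index is the
      derivative.\<close>
    have "(\<lambda>h. (flat m (0 + h) - flat m 0) / h) \<midarrow>0\<rightarrow> 0"
      by (rule Lim_transform_eventually[OF flat_tendsto_0[of "Suc m"]])
         (auto simp: flat_def eventually_at_filter)
    then show ?thesis using 3 by (simp add: DERIV_def flat_def)
  qed
qed

text \<open>Differentiation raises the index of \<open>flat\<close>, so the induction hypothesis has
  to be available for every \<open>m\<close>.\<close>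

lemma Ck_flat_comp: "(\<And>k. Ck k q) \<Longrightarrow> Ck k (\<lambda>x. flat m (q x))"
proof (induction k arbitrary: m)
  case 0
  have "continuous_on UNIV (flat m)"
    by (rule DERIV_continuous_on[OF has_field_derivative_at_within[OF flat_deriv]])
  from continuous_on_compose2[OF this, of UNIV q] 0[of 0] show ?case by simp
next
  case (Suc k)
  let ?D = "\<lambda>x h. (flat (m + 2) (q x) - real m * flat (Suc m) (q x)) * frechet_derivative q (at x) h"
  have D: "((\<lambda>x. flat m (q x)) has_derivative ?D x) (at x)" for x
    by (rule has_derivative_compose[OF Ck_Suc_has_derivative[OF Suc.prems[of "Suc 0"]]
       flat_deriv[unfolded has_field_derivative_def]])
  have IH: "Ck k (\<lambda>x. flat m (q x))" for m by (rule Suc.IH[OF Suc.prems])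
  have "Ck k (\<lambda>x. ?D x b)" if "b \<in> Basis" for b
    by (rule Ck_mult[OF Ck_diff[OF IH Ck_cmult[OF IH]] Ck_Suc_partial[OF Suc.prems that]])
  with D show ?case by (rule Ck_SucI)
qed

section \<open>Test functions and compact supports\<close>

lemma test_funI:
  assumes "\<And>k. Ck k \<phi>" "compact K" "K \<subseteq> U" "\<And>x. x \<notin> K \<Longrightarrow> \<phi> x = 0"
  shows "\<phi> \<in> test_fun U"
proof -
  have *: "closure {x. \<phi> x \<noteq> 0} \<subseteq> K"
    using assms by (intro closure_minimal) (auto intro: compact_imp_closed)
  moreover have "compact (closure {x. \<phi> x \<noteq> 0})"
    using assms(2) * by (meson closed_closure compact_imp_bounded bounded_subset compact_eq_bounded_closed)
  ultimately show ?thesis using assms unfolding test_fun_def by auto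
qed

lemma test_funE:
  assumes "\<phi> \<in> test_fun U"
  obtains K where "\<And>k. Ck k \<phi>" "compact K" "K \<subseteq> U" "\<And>x. x \<notin> K \<Longrightarrow> \<phi> x = 0"
proof (rule that[of "closure {x. \<phi> x \<noteq> 0}"])
  show "\<phi> x = 0" if "x \<notin> closure {x. \<phi> x \<noteq> 0}" for x
    using that closure_subset[of "{x. \<phi> x \<noteq> 0}"] by auto
qed (use assms in \<open>auto simp: test_fun_def simp del: Ck.simps\<close>)

lemma test_fun_mono: "U \<subseteq> V \<Longrightarrow> test_fun U \<subseteq> test_fun V"
  unfolding test_fun_def by auto

lemma test_fun_Ck: "\<phi> \<in> test_fun U \<Longrightarrow> Ck k \<phi>"
  unfolding test_fun_def by auto

lemma continuous_compact_support_integrable: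
  fixes f :: "'a::euclidean_space \<Rightarrow> 'b::euclidean_space"
  assumes "continuous_on UNIV f" "compact K" "\<And>x. x \<notin> K \<Longrightarrow> f x = 0"
  shows "integrable lborel f"
proof -
  have "integrable lborel (\<lambda>x. indicator K x *\<^sub>R f x)"
    by (rule borel_integrable_compact[OF assms(2) continuous_on_subset[OF assms(1)]]) auto
  moreover have "(\<lambda>x. indicator K x *\<^sub>R f x) = f"
    using assms(3) by (force simp: indicator_def)
  ultimately show ?thesis by simp
qed

lemma continuous_compact_support_bounded:
  fixes f :: "'a::euclidean_space \<Rightarrow> 'b::real_normed_vector"
  assumes "continuous_on UNIV f" "compact K" "\<And>x. x \<notin> K \<Longrightarrow> f x = 0"
  obtains B where "B \<ge> 0" "\<And>x. norm (f x) \<le> B"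
proof -
  have "bounded (f ` K)"
    by (intro compact_imp_bounded compact_continuous_image continuous_on_subset[OF assms(1)] assms(2)) auto
  then obtain B where "B > 0" "\<And>x. x \<in> K \<Longrightarrow> norm (f x) \<le> B"
    unfolding bounded_pos by auto
  with that[of B] assms(3) show ?thesis by (metis norm_zero less_imp_le)
qed

lemma test_fun_integrable:
  fixes \<phi> :: "'a::euclidean_space \<Rightarrow> 'b::euclidean_space"
  assumes "\<phi> \<in> test_fun U" shows "integrable lborel \<phi>"
  using assms by (elim test_funE) (blast intro: continuous_compact_support_integrable Ck_imp_continuous)

lemma frechet_derivative_zero_outside:
  assumes "closed K" "\<And>x. x \<notin> K \<Longrightarrow> f x = 0" "x \<notin> K"
  shows "frechet_derivative f (at x) = (\<lambda>h. 0)"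
proof -
  have "((\<lambda>x. 0) has_derivative (\<lambda>h. 0)) (at x)" by simp
  then have "(f has_derivative (\<lambda>h. 0)) (at x)"
    by (rule has_derivative_transform_within_open[where s="- K"]) (use assms in auto)
  then show ?thesis using frechet_derivative_at by metis
qed

lemma test_fun_partial:
  assumes "\<phi> \<in> test_fun U" "b \<in> Basis"
  shows "(\<lambda>x. frechet_derivative \<phi> (at x) b) \<in> test_fun U"
proof -
  obtain K where K: "\<And>k. Ck k \<phi>" "compact K" "K \<subseteq> U" "\<And>x. x \<notin> K \<Longrightarrow> \<phi> x = 0"
    using test_funE[OF assms(1)] by blast
  show ?thesis
    by (rule test_funI[OF _ K(2,3)])
       (use K(1)[of "Suc _"] assms(2) frechet_derivative_zero_outside[OF compact_imp_closed[OF K(2)], of \<phi>] K(4)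
         in auto)
qed

lemma test_fun_has_derivative:
  "\<phi> \<in> test_fun U \<Longrightarrow> (\<phi> has_derivative frechet_derivative \<phi> (at x)) (at x)"
  using test_fun_Ck Ck_Suc_has_derivative by blast

section \<open>Gradients of scalar functions\<close>

definition grad :: "('a::euclidean_space \<Rightarrow> real) \<Rightarrow> 'a \<Rightarrow> 'a" where
  "grad f x = (\<Sum>b\<in>Basis. frechet_derivative f (at x) b *\<^sub>R b)"

lemma grad_inner_Basis: "b \<in> Basis \<Longrightarrow> grad f x \<bullet> b = frechet_derivative f (at x) b"
  unfolding grad_def by (simp add: inner_sum_left inner_Basis if_distrib cong: if_cong)

lemma grad_inner:
  assumes "(f has_derivative frechet_derivative f (at x)) (at x)"
  shows "frechet_derivative f (at x) h = grad f x \<bullet> h"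
proof -
  interpret linear "frechet_derivative f (at x)" using assms by (rule has_derivative_linear)
  have "frechet_derivative f (at x) h = frechet_derivative f (at x) (\<Sum>b\<in>Basis. (h \<bullet> b) *\<^sub>R b)"
    by (simp add: euclidean_representation)
  also have "\<dots> = grad f x \<bullet> h"
    by (simp add: sum scale grad_def inner_sum_left, simp add: inner_commute mult.commute)
  finally show ?thesis .
qed

lemma has_derivative_grad:
  assumes "(f has_derivative D) (at x)"
  shows "D h = grad f x \<bullet> h"
  using assms grad_inner frechet_derivative_at by metis

lemma grad_eqI: "(f has_derivative (\<lambda>h. v \<bullet> h)) (at x) \<Longrightarrow> grad f x = v"
  using has_derivative_grad[of f "\<lambda>h. v \<bullet> h" x] by (metis vector_eq_rdot)

lemma has_derivative_gradI: "Ck (Suc k) f \<Longrightarrow> (f has_derivative (\<lambda>h. grad f x \<bullet> h)) (at x)"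
  using Ck_Suc_has_derivative has_derivative_grad by (metis (no_types, lifting) ext)

lemma Ck_grad: "Ck (Suc k) f \<Longrightarrow> Ck k (grad f)"
  unfolding grad_def[abs_def] by (intro Ck_sum Ck_scaleR Ck_const Ck_Suc_partial)

lemma grad_test_fun: "\<phi> \<in> test_fun U \<Longrightarrow> grad \<phi> \<in> test_fun U"
proof -
  assume \<phi>: "\<phi> \<in> test_fun U"
  obtain K where K: "\<And>k. Ck k \<phi>" "compact K" "K \<subseteq> U" "\<And>x. x \<notin> K \<Longrightarrow> \<phi> x = 0"
    using test_funE[OF \<phi>] by blast
  show ?thesis
    by (rule test_funI[OF Ck_grad[OF K(1)] K(2,3)])
       (simp add: grad_def frechet_derivative_zero_outside[OF compact_imp_closed[OF K(2)] K(4)])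
qed

lemma grad_add: "Ck (Suc 0) f \<Longrightarrow> Ck (Suc 0) g \<Longrightarrow> grad (\<lambda>x. f x + g x) x = grad f x + grad g x"
  by (rule grad_eqI) (auto intro!: derivative_eq_intros has_derivative_gradI simp: inner_add_left simp del: Ck.simps)

lemma grad_cmult: "Ck (Suc 0) f \<Longrightarrow> grad (\<lambda>x. c * f x) x = c *\<^sub>R grad f x"
  by (rule grad_eqI) (auto intro!: derivative_eq_intros has_derivative_gradI simp del: Ck.simps)

lemma grad_diff: "Ck (Suc 0) f \<Longrightarrow> Ck (Suc 0) g \<Longrightarrow> grad (\<lambda>x. f x - g x) x = grad f x - grad g x"
  by (rule grad_eqI) (auto intro!: derivative_eq_intros has_derivative_gradI simp: inner_diff_left simp del: Ck.simps)

lemma grad_mult: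
  "Ck (Suc 0) f \<Longrightarrow> Ck (Suc 0) g \<Longrightarrow> grad (\<lambda>x. f x * g x) x = f x *\<^sub>R grad g x + g x *\<^sub>R grad f x"
  by (rule grad_eqI) (auto intro!: derivative_eq_intros has_derivative_gradI simp: inner_add_left simp del: Ck.simps)

lemma grad_const: "grad (\<lambda>x. c) x = 0"
  by (rule grad_eqI) auto

lemma grad_sum:
  "(\<And>i. i \<in> I \<Longrightarrow> Ck (Suc 0) (f i)) \<Longrightarrow> grad (\<lambda>x. \<Sum>i\<in>I. f i x) x = (\<Sum>i\<in>I. grad (f i) x)"
proof (induction I rule: infinite_finite_induct)
  case (insert i I)
  then show ?case using grad_add[of "f i" "\<lambda>x. \<Sum>i\<in>I. f i x" x] Ck_sum[of I "Suc 0" f]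
    by (simp del: Ck.simps)
qed (auto simp: grad_const)

lemma grad_translation: "Ck (Suc 0) f \<Longrightarrow> grad (\<lambda>x. f (x + a)) x = grad f (x + a)"
  by (rule grad_eqI, rule has_derivative_compose[of "\<lambda>x. x + a" "\<lambda>h. h" x UNIV f "\<lambda>h. grad f (x+a) \<bullet> h"])
     (auto intro!: derivative_eq_intros has_derivative_gradI simp del: Ck.simps)

lemma test_fun_add: "f \<in> test_fun U \<Longrightarrow> g \<in> test_fun U \<Longrightarrow> (\<lambda>x. f x + g x) \<in> test_fun U"
proof (elim test_funE)
  fix K L assume "\<And>k. Ck k f" "compact K" "K \<subseteq> U" "\<And>x. x \<notin> K \<Longrightarrow> f x = 0"
    "\<And>k. Ck k g" "compact L" "L \<subseteq> U" "\<And>x. x \<notin> L \<Longrightarrow> g x = 0"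
  then show ?thesis by (intro test_funI[where K="K \<union> L"]) (auto intro: Ck_add)
qed

lemma test_fun_cmult: "f \<in> test_fun U \<Longrightarrow> (\<lambda>x. c * f x) \<in> test_fun U" for f :: "_ \<Rightarrow> real"
  by (elim test_funE, rule test_funI) (auto intro: Ck_cmult)

lemma test_fun_diff: "f \<in> test_fun U \<Longrightarrow> g \<in> test_fun U \<Longrightarrow> (\<lambda>x. f x - g x) \<in> test_fun U" for f :: "_ \<Rightarrow> real"
  using test_fun_add[of f U "\<lambda>x. -1 * g x"] test_fun_cmult[of g U "-1"] by simp

text \<open>No scaling of one fixed kernel is required, only a bound on the radius of the support.
  Evenness makes convolution self-adjoint, which later moves the mollification from a function to
  the field it is tested with.\<close>

definition mollifier :: "real \<Rightarrow> ('a::euclidean_space \<Rightarrow> real) \<Rightarrow> bool" where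
  "mollifier \<epsilon> \<eta> \<longleftrightarrow> (\<forall>k. Ck k \<eta>) \<and> (\<forall>x. 0 \<le> \<eta> x) \<and> (\<forall>x. \<eta> (- x) = \<eta> x) \<and>
     (\<forall>x. \<epsilon> \<le> norm x \<longrightarrow> \<eta> x = 0) \<and> (LINT x|lborel. \<eta> x) = 1"

lemma mollifier_test_fun: "mollifier \<epsilon> \<eta> \<Longrightarrow> \<eta> \<in> test_fun UNIV"
  by (rule test_funI[where K="cball 0 \<epsilon>"]) (auto simp: mollifier_def)

lemma mollifier_exists:
  assumes "\<epsilon> > 0"
  obtains \<eta> :: "'a::euclidean_space \<Rightarrow> real" where "mollifier \<epsilon> \<eta>"
proof -
  define h where "h x = flat 0 (\<epsilon>\<^sup>2 - x \<bullet> x)" for x :: 'a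
  have Ckh: "Ck k h" for k
    unfolding h_def[abs_def] by (intro Ck_flat_comp Ck_diff Ck_const Ck_inner Ck_id)
  have pos: "h x > 0" if "norm x < \<epsilon>" for x
    using that power_strict_mono[OF that] by (simp add: h_def flat_def power2_norm_eq_inner[symmetric])
  have h0: "h x \<ge> 0" for x by (simp add: h_def flat_def)
  have z: "h x = 0" if "\<epsilon> \<le> norm x" for x
  proof -
    have "\<epsilon>\<^sup>2 \<le> (norm x)\<^sup>2" using that assms by (intro power_mono) auto
    then show ?thesis by (simp add: h_def flat_def power2_norm_eq_inner)
  qed
  have int: "integrable lborel h"
    by (rule continuous_compact_support_integrable[of _ "cball 0 \<epsilon>"])
       (use Ckh Ck_imp_continuous z in auto)
  define I where "I = (LINT x|lborel. h x)"
  have "I \<noteq> 0"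
  proof
    assume "I = 0"
    then have "AE x in lborel. h x = 0"
      using integral_nonneg_eq_0_iff_AE[OF int] h0 unfolding I_def by auto
    then have "AE x in lborel. x \<notin> ball (0::'a) \<epsilon>"
      by eventually_elim (use pos in \<open>force\<close>)
    then have "measure lborel (ball (0::'a) \<epsilon>) = 0"
      using AE_iff_null_sets[of "ball (0::'a) \<epsilon>" lborel] by (simp add: measure_eq_0_null_sets)
    then show False using content_ball_pos[OF assms, of "0::'a"] by simp
  qed
  moreover have "I \<ge> 0" unfolding I_def using h0 by simp
  ultimately have "mollifier \<epsilon> (\<lambda>x. (1/I) * h x)"
    unfolding mollifier_def using Ck_cmult[OF Ckh, of _ "1/I"] z h0 int
    by (auto simp: I_def[symmetric]) (auto simp: h_def)
  then show ?thesis using that by blast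
qed

subsection \<open>Integrals of test functions\<close>

lemma test_fun_measurable:
  fixes f :: "'a::euclidean_space \<Rightarrow> 'b::euclidean_space"
  shows "f \<in> test_fun U \<Longrightarrow> f \<in> borel_measurable borel"
  using borel_measurable_continuous_onI[OF Ck_imp_continuous[OF test_fun_Ck[where k=0]]] .

lemma test_fun_bounded:
  fixes f :: "'a::euclidean_space \<Rightarrow> 'b::euclidean_space"
  assumes "f \<in> test_fun U"
  obtains B where "B > 0" "\<And>x. norm (f x) \<le> B"
proof -
  obtain K where K: "\<And>k. Ck k f" "compact K" "K \<subseteq> U" "\<And>x. x \<notin> K \<Longrightarrow> f x = 0"
    using test_funE[OF assms] by blast
  obtain B where "B \<ge> 0" "\<And>x. norm (f x) \<le> B"
    using continuous_compact_support_bounded[OF Ck_imp_continuous[OF K(1)] K(2,4)] by blast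
  then show ?thesis using that[of "B + 1"] by (meson add_increasing2 le_add_same_cancel1 add_nonneg_pos zero_le_one zero_less_one order_trans)
qed

lemma lborel_integral_translation:
  fixes f :: "'a::euclidean_space \<Rightarrow> 'b::{banach, second_countable_topology}"
  assumes [measurable]: "f \<in> borel_measurable borel"
  shows "(LINT x|lborel. f (x + a)) = (LINT x|lborel. f x)"
proof -
  have "(LINT x|lborel. f x) = (LINT x|distr lborel borel ((+) a). f x)"
    by (simp add: lborel_distr_plus)
  also have "\<dots> = (LINT x|lborel. f (a + x))" by (rule integral_distr) auto
  finally show ?thesis by (simp add: add.commute)
qed

lemma lborel_integrable_translation:
  fixes f :: "'a::euclidean_space \<Rightarrow> 'b::{banach, second_countable_topology}"
  assumes "integrable lborel f"
  shows "integrable lborel (\<lambda>x. f (x + a))"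
proof -
  have "integrable (distr lborel borel ((+) a)) f" using assms by (simp add: lborel_distr_plus)
  then have "integrable lborel (\<lambda>x. f (a + x))"
    by (rule integrable_distr[rotated]) auto
  then show ?thesis by (simp add: add.commute)
qed

lemma lborel_AE_translation:
  fixes a :: "'a::euclidean_space"
  assumes "AE x in lborel. P x"
  shows "AE x in lborel. P (x + a)"
proof -
  have "AE x in distr lborel borel ((+) a). P x" using assms unfolding lborel_distr_plus .
  then have "AE x in lborel. P (a + x)"
    by (rule AE_distrD[rotated]) auto
  then show ?thesis by (simp add: add.commute)
qed

lemma test_fun_lipschitz:
  fixes \<phi> :: "'a::euclidean_space \<Rightarrow> real"
  assumes "\<phi> \<in> test_fun U"
  obtains M where "M > 0" "\<And>x y. \<bar>\<phi> x - \<phi> y\<bar> \<le> M * norm (x - y)"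
proof -
  obtain M where M: "M > 0" "\<And>x. norm (grad \<phi> x) \<le> M"
    using test_fun_bounded[OF grad_test_fun[OF assms]] by blast
  have "norm (\<phi> x - \<phi> y) \<le> M * norm (x - y)" for x y
  proof (rule differentiable_bound[where S=UNIV and f'="\<lambda>x h. grad \<phi> x \<bullet> h"])
    show "(\<phi> has_derivative (\<lambda>h. grad \<phi> z \<bullet> h)) (at z within UNIV)" for z
      using has_derivative_gradI[OF test_fun_Ck[OF assms]] by simp
    show "onorm (\<lambda>h. grad \<phi> z \<bullet> h) \<le> M" for z
      by (rule onorm_le) (use M in \<open>auto intro!: order_trans[OF Cauchy_Schwarz_ineq2] mult_right_mono\<close>)
  qed auto
  with M(1) show ?thesis using that by auto
qed

text \<open>The partial derivatives are test functions themselves, hence Lipschitz; the sum of their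
  constants is a Lipschitz constant of the gradient, and the mean value inequality on the segment
  gives the remainder. What matters is that \<open>M\<close> does not depend on
  \<open>x\<close>.\<close>

lemma test_fun_taylor:
  fixes \<phi> :: "'a::euclidean_space \<Rightarrow> real"
  assumes "\<phi> \<in> test_fun U"
  obtains M where "M > 0" "\<And>x h. \<bar>\<phi> (x + h) - \<phi> x - grad \<phi> x \<bullet> h\<bar> \<le> M * (norm h)\<^sup>2"
proof -
  have "\<exists>M>0. \<forall>x y. \<bar>frechet_derivative \<phi> (at x) b - frechet_derivative \<phi> (at y) b\<bar> \<le> M * norm (x - y)"
    if "b \<in> Basis" for b
    using test_fun_lipschitz[OF test_fun_partial[OF assms that]] by metis
  then obtain L where L: "\<And>b. b \<in> Basis \<Longrightarrow> L b > 0"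
    "\<And>b x y. b \<in> Basis \<Longrightarrow> \<bar>frechet_derivative \<phi> (at x) b - frechet_derivative \<phi> (at y) b\<bar> \<le> L b * norm (x - y)"
    by metis
  define M where "M = (\<Sum>b\<in>Basis. L b)"
  have M0: "M > 0" unfolding M_def by (rule sum_pos) (use L in auto)
  have lip: "norm (grad \<phi> x - grad \<phi> y) \<le> M * norm (x - y)" for x y
  proof -
    have "norm (grad \<phi> x - grad \<phi> y) \<le> (\<Sum>b\<in>Basis. \<bar>(grad \<phi> x - grad \<phi> y) \<bullet> b\<bar>)"
      by (rule norm_le_l1)
    also have "\<dots> \<le> (\<Sum>b\<in>Basis. L b * norm (x - y))"
      by (rule sum_mono) (simp add: inner_diff_left grad_inner_Basis L)
    finally show ?thesis by (simp add: M_def sum_distrib_right)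
  qed
  have "\<bar>\<phi> (x + h) - \<phi> x - grad \<phi> x \<bullet> h\<bar> \<le> M * (norm h)\<^sup>2" for x h
  proof -
    have "norm (\<phi> (x + h) - \<phi> x - grad \<phi> x \<bullet> ((x + h) - x)) \<le> norm ((x + h) - x) * (M * norm h)"
    proof (rule differentiable_bound_linearization[where S="closed_segment x (x + h)" and f'="\<lambda>x h. grad \<phi> x \<bullet> h"])
      show "x + t *\<^sub>R (x + h - x) \<in> closed_segment x (x + h)" if "t \<in> {0..1}" for t
        using that by (auto simp: closed_segment_def algebra_simps intro!: exI[of _ t])
      show "(\<phi> has_derivative (\<lambda>h. grad \<phi> z \<bullet> h)) (at z within closed_segment x (x+h))" for z
        using has_derivative_gradI[OF test_fun_Ck[OF assms]] has_derivative_at_withinI by blast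
      fix z assume "z \<in> closed_segment x (x + h)"
      then have zx: "norm (z - x) \<le> norm h"
        using segment_bound(1)[of z x "x + h"] by simp
      have "norm (grad \<phi> z - grad \<phi> x) \<le> M * norm h"
        using order_trans[OF lip mult_left_mono[OF zx]] M0 by simp
      then show "onorm ((\<lambda>h. grad \<phi> z \<bullet> h) - (\<lambda>h. grad \<phi> x \<bullet> h)) \<le> M * norm h"
        by (intro onorm_le)
           (auto simp: inner_diff_left[symmetric] intro!: order_trans[OF Cauchy_Schwarz_ineq2] mult_right_mono)
    qed auto
    then show ?thesis by (simp add: power2_eq_square mult.commute mult.left_commute)
  qed
  with M0 that show ?thesis by blast
qed

subsection \<open>Convolution\<close>

text \<open>The real kernel carries all smoothness. The function may be vector valued, so that the
  same operation applies to \<open>u\<close> and to the vector fields paired with its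
  gradient.\<close>

definition conv :: "('a::euclidean_space \<Rightarrow> 'b::euclidean_space) \<Rightarrow> ('a \<Rightarrow> real) \<Rightarrow> 'a \<Rightarrow> 'b" where
  "conv f \<eta> x = (LINT y|lborel. \<eta> (x - y) *\<^sub>R f y)"

lemma conv_integrable:
  fixes f :: "'a::euclidean_space \<Rightarrow> 'b::euclidean_space"
  assumes f: "integrable lborel f" and \<eta>: "\<eta> \<in> test_fun UNIV"
  shows "integrable lborel (\<lambda>y. \<eta> (x - y) *\<^sub>R f y)"
proof -
  obtain B where B: "B > 0" "\<And>x. norm (\<eta> x) \<le> B" using test_fun_bounded[OF \<eta>] by blast
  note [measurable] = test_fun_measurable[OF \<eta>] borel_measurable_integrable[OF f]
  show ?thesis
  proof (rule Bochner_Integration.integrable_bound[of _ "\<lambda>y. B *\<^sub>R f y"])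
    show "integrable lborel (\<lambda>y. B *\<^sub>R f y)" using f by simp
    show "AE y in lborel. norm (\<eta> (x - y) *\<^sub>R f y) \<le> norm (B *\<^sub>R f y)"
      using B by (intro AE_I2) (auto intro!: mult_right_mono)
  qed measurable
qed

lemma conv_partial_sum:
  fixes f :: "'a::euclidean_space \<Rightarrow> 'b::euclidean_space"
  assumes f: "integrable lborel f" and \<eta>: "\<eta> \<in> test_fun UNIV"
  shows "(\<Sum>b\<in>Basis. (h \<bullet> b) *\<^sub>R conv f (\<lambda>x. frechet_derivative \<eta> (at x) b) x) =
      (LINT y|lborel. (grad \<eta> (x - y) \<bullet> h) *\<^sub>R f y)" (is "?D h = _")
    and "integrable lborel (\<lambda>y. (grad \<eta> (x - y) \<bullet> h) *\<^sub>R f y)"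
proof -
  note P = test_fun_partial[OF \<eta>]
  have eq: "(grad \<eta> (x - y) \<bullet> h) *\<^sub>R f y = (\<Sum>b\<in>Basis. (h \<bullet> b) *\<^sub>R (frechet_derivative \<eta> (at (x - y)) b *\<^sub>R f y))" for y
    by (simp add: grad_def inner_sum_left scaleR_sum_left inner_commute[of h] mult.commute)
  show "?D h = (LINT y|lborel. (grad \<eta> (x - y) \<bullet> h) *\<^sub>R f y)"
    unfolding eq conv_def
    by (subst Bochner_Integration.integral_sum)
       (auto intro!: conv_integrable[OF f P] integrable_scaleR_right simp del: scaleR_scaleR)
  show "integrable lborel (\<lambda>y. (grad \<eta> (x - y) \<bullet> h) *\<^sub>R f y)"
    unfolding eq by (intro Bochner_Integration.integrable_sum integrable_scaleR_right conv_integrable[OF f P])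
qed

text \<open>The uniform Taylor bound for the kernel, integrated against \<open>f\<close>, gives a
  remainder of at most M |h|^2 times the L1 norm of \<open>f\<close>; no limit has to be taken under
  the integral.\<close>

lemma conv_has_derivative:
  fixes f :: "'a::euclidean_space \<Rightarrow> 'b::euclidean_space"
  assumes f: "integrable lborel f" and \<eta>: "\<eta> \<in> test_fun UNIV"
  shows "(conv f \<eta> has_derivative
    (\<lambda>h. \<Sum>b\<in>Basis. (h \<bullet> b) *\<^sub>R conv f (\<lambda>x. frechet_derivative \<eta> (at x) b) x)) (at x)"
    (is "(_ has_derivative ?D) _")
proof -
  obtain M where M: "M > 0" "\<And>x h. \<bar>\<eta> (x + h) - \<eta> x - grad \<eta> x \<bullet> h\<bar> \<le> M * (norm h)\<^sup>2"
    using test_fun_taylor[OF \<eta>] by blast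
  define N where "N = (LINT y|lborel. norm (f y))"
  have N: "N \<ge> 0" unfolding N_def by simp
  note D = conv_partial_sum(1)[OF f \<eta>, where x=x] and Di = conv_partial_sum(2)[OF f \<eta>, where x=x]
  have bd: "norm (conv f \<eta> (x + h) - conv f \<eta> x - ?D h) \<le> M * (norm h)\<^sup>2 * N" for h
  proof -
    let ?g = "\<lambda>y. \<eta> (x + h - y) *\<^sub>R f y - \<eta> (x - y) *\<^sub>R f y - (grad \<eta> (x - y) \<bullet> h) *\<^sub>R f y"
    have eq: "conv f \<eta> (x + h) - conv f \<eta> x - ?D h = (LINT y|lborel. ?g y)"
      unfolding D unfolding conv_def using conv_integrable[OF f \<eta>] Di by simp
    have "norm (conv f \<eta> (x + h) - conv f \<eta> x - ?D h) \<le> (LINT y|lborel. norm (?g y))"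
      unfolding eq by (rule integral_norm_bound)
    also have "\<dots> \<le> (LINT y|lborel. M * (norm h)\<^sup>2 * norm (f y))"
    proof (rule integral_mono)
      fix y
      have "?g y = (\<eta> ((x - y) + h) - \<eta> (x - y) - grad \<eta> (x - y) \<bullet> h) *\<^sub>R f y"
        by (simp only: scaleR_left_diff_distrib diff_add_eq)
      then have "norm (?g y) = \<bar>\<eta> ((x - y) + h) - \<eta> (x - y) - grad \<eta> (x - y) \<bullet> h\<bar> * norm (f y)"
        by (simp only: norm_scaleR)
      also have "\<dots> \<le> M * (norm h)\<^sup>2 * norm (f y)"
        by (rule mult_right_mono[OF M(2)]) simp
      finally show "norm (?g y) \<le> M * (norm h)\<^sup>2 * norm (f y)" .
    next
      show "integrable lborel (\<lambda>y. norm (?g y))"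
        by (intro integrable_norm Bochner_Integration.integrable_diff conv_integrable[OF f \<eta>] Di)
    qed (use f in auto)
    finally show ?thesis by (simp add: N_def)
  qed
  show ?thesis unfolding has_derivative_at_alt
  proof (intro conjI allI impI)
    show "bounded_linear ?D"
      by (intro bounded_linear_sum bounded_linear_scaleR_const bounded_linear_inner_left)
    fix e :: real assume e: "e > 0"
    define d where "d = e / (M * N + 1)"
    have MN: "M * N \<ge> 0" using M N by simp
    have "norm (conv f \<eta> y - conv f \<eta> x - ?D (y - x)) \<le> e * norm (y - x)" if "norm (y - x) < d" for y
    proof -
      have "norm (conv f \<eta> y - conv f \<eta> x - ?D (y - x)) \<le> (M * N) * norm (y - x) * norm (y - x)"
        using bd[of "y - x"] by (simp add: power2_eq_square mult_ac)
      also have "\<dots> \<le> e * norm (y - x)"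
      proof (rule mult_right_mono)
        have "(M * N) * norm (y - x) \<le> (M * N + 1) * d"
          using that MN by (intro mult_mono) auto
        also have "\<dots> = e" using MN by (simp add: d_def)
        finally show "(M * N) * norm (y - x) \<le> e" .
      qed simp
      finally show ?thesis .
    qed
    moreover have "d > 0" using e MN by (simp add: d_def)
    ultimately show "\<exists>d>0. \<forall>y. norm (y - x) < d \<longrightarrow> norm (conv f \<eta> y - conv f \<eta> x - ?D (y - x)) \<le> e * norm (y - x)"
      by blast
  qed
qed

lemma frechet_derivative_conv:
  assumes "integrable lborel f" "\<eta> \<in> test_fun UNIV" "b \<in> Basis"
  shows "frechet_derivative (conv f \<eta>) (at x) b = conv f (\<lambda>x. frechet_derivative \<eta> (at x) b) x"
  using fun_cong[OF frechet_derivative_at[OF conv_has_derivative[OF assms(1,2), of x]], of b, symmetric] assms(3)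
  by (simp add: inner_Basis if_distrib[of "\<lambda>c. c *\<^sub>R _"] cong: if_cong)

lemma Ck_conv:
  assumes "integrable lborel f"
  shows "\<eta> \<in> test_fun UNIV \<Longrightarrow> Ck k (conv f \<eta>)"
proof (induction k arbitrary: \<eta>)
  case 0
  have "conv f \<eta> differentiable_on UNIV"
    using conv_has_derivative[OF assms 0] by (auto simp: differentiable_on_def differentiable_def)
  then show ?case by (simp add: differentiable_imp_continuous_on)
next
  case (Suc k)
  show ?case
  proof (rule Ck_SucI[OF conv_has_derivative[OF assms Suc.prems]])
    fix b :: 'a assume b: "b \<in> Basis"
    then show "Ck k (\<lambda>x. \<Sum>c\<in>Basis. (b \<bullet> c) *\<^sub>R conv f (\<lambda>x. frechet_derivative \<eta> (at x) c) x)"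
      using Suc.IH[OF test_fun_partial[OF Suc.prems b]]
      by (simp add: inner_Basis if_distrib[of "\<lambda>c. c *\<^sub>R _"] cong: if_cong)
  qed
qed

lemma mollifier_zero: "mollifier \<epsilon> \<eta> \<Longrightarrow> \<epsilon> \<le> norm x \<Longrightarrow> \<eta> x = 0"
  and mollifier_nonneg: "mollifier \<epsilon> \<eta> \<Longrightarrow> 0 \<le> \<eta> x"
  and mollifier_even: "mollifier \<epsilon> \<eta> \<Longrightarrow> \<eta> (- x) = \<eta> x"
  and mollifier_integral: "mollifier \<epsilon> \<eta> \<Longrightarrow> (LINT x|lborel. \<eta> x) = 1"
  unfolding mollifier_def by auto

lemma mollifier_sym: "mollifier \<epsilon> \<eta> \<Longrightarrow> \<eta> (x - y) = \<eta> (y - x)"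
  using mollifier_even[of \<epsilon> \<eta> "y - x"] by simp

lemma mollifier_integral_diff: "mollifier \<epsilon> \<eta> \<Longrightarrow> (LINT y|lborel. \<eta> (x - y)) = 1"
  using lborel_integral_translation[OF test_fun_measurable[OF mollifier_test_fun], of \<epsilon> \<eta> "- x"]
  by (simp add: mollifier_sym[of \<epsilon> \<eta> x] mollifier_integral)

lemma mollifier_integrable_diff:
  assumes "mollifier \<epsilon> \<eta>" shows "integrable lborel (\<lambda>y. \<eta> (x - y))"
  using lborel_integrable_translation[OF test_fun_integrable[OF mollifier_test_fun[OF assms]], of "- x"]
  by (simp add: mollifier_sym[OF assms, of x])

lemma conv_translate:
  assumes [measurable]: "f \<in> borel_measurable borel" and "\<eta> \<in> test_fun UNIV"
  shows "conv f \<eta> x = (LINT z|lborel. \<eta> (- z) *\<^sub>R f (x + z))"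
proof -
  note [measurable] = test_fun_measurable[OF assms(2)]
  show ?thesis unfolding conv_def
    by (subst lborel_integral_translation[of _ x, symmetric]) (auto simp: add.commute)
qed

text \<open>The kernel has mass 1 and sees only the ball of radius \<epsilon>, so averaging a
  constant returns it. This transports vanishing outside \<Omega> and local constancy on the solid
  to the mollified function.\<close>

lemma conv_local:
  assumes "mollifier \<epsilon> \<eta>" "AE y in lborel. norm (x - y) < \<epsilon> \<longrightarrow> f y = c"
    "f \<in> borel_measurable borel"
  shows "conv f \<eta> x = c"
proof -
  note [measurable] = assms(3) test_fun_measurable[OF mollifier_test_fun[OF assms(1)]]
  have "conv f \<eta> x = (LINT y|lborel. \<eta> (x - y) *\<^sub>R c)"
    unfolding conv_def
  proof (rule integral_cong_AE)
    show "AE y in lborel. \<eta> (x - y) *\<^sub>R f y = \<eta> (x - y) *\<^sub>R c"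
      using assms(2) by eventually_elim (use mollifier_zero[OF assms(1)] in force)
  qed measurable
  also have "\<dots> = c"
    by (simp add: mollifier_integral_diff[OF assms(1)] mollifier_integrable_diff[OF assms(1)])
  finally show ?thesis .
qed

lemma conv_norm_le:
  assumes m: "mollifier \<epsilon> \<eta>" and f: "f \<in> borel_measurable borel" "\<And>y. norm (f y) \<le> B"
  shows "norm (conv f \<eta> x) \<le> B"
proof -
  note [measurable] = f(1) test_fun_measurable[OF mollifier_test_fun[OF m]]
  have i: "integrable lborel (\<lambda>y. \<eta> (x - y) * B)"
    using mollifier_integrable_diff[OF m] by simp
  have le: "norm (\<eta> (x - y) *\<^sub>R f y) \<le> \<eta> (x - y) * B" for y
    using mollifier_nonneg[OF m, of "x - y"] f(2)[of y] by (simp add: mult_left_mono)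
  have "integrable lborel (\<lambda>y. \<eta> (x - y) *\<^sub>R f y)"
    by (rule Bochner_Integration.integrable_bound[OF i])
       (use le in \<open>auto intro!: AE_I2 intro: order_trans[OF _ abs_ge_self]\<close>)
  then have "norm (conv f \<eta> x) \<le> (LINT y|lborel. \<eta> (x - y) * B)"
    unfolding conv_def using le i by (intro Bochner_Integration.integral_norm_bound_integral) auto
  then show ?thesis by (simp add: mollifier_integral_diff[OF m])
qed

text \<open>\<open>conv u \<eta> - u\<close> is an average over |z| < \<epsilon> of the differences
  between \<open>u\<close> and its translates, so its L1 norm is at most the largest L1 norm of such
  a difference.\<close>

lemma conv_sub_norm_le:
  fixes u :: "'a::euclidean_space \<Rightarrow> real"
  assumes m: "mollifier \<epsilon> \<eta>" and u: "integrable lborel u"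
    and B: "\<And>z. norm z < \<epsilon> \<Longrightarrow> (LINT x|lborel. \<bar>u (x + z) - u x\<bar>) \<le> B" "\<epsilon> > 0"
  shows "integrable lborel (conv u \<eta>)" "(LINT x|lborel. \<bar>conv u \<eta> x - u x\<bar>) \<le> B"
proof -
  note [measurable] = borel_measurable_integrable[OF u] test_fun_measurable[OF mollifier_test_fun[OF m]]
  have [measurable]: "conv u \<eta> \<in> borel_measurable borel"
    by (rule borel_measurable_continuous_onI, rule Ck_imp_continuous, rule Ck_conv[OF u mollifier_test_fun[OF m], of 0])
  have B0: "B \<ge> 0"
    using B(1)[of 0] B(2) by simp
  have pt: "ennreal \<bar>conv u \<eta> x - u x\<bar> \<le> (\<integral>\<^sup>+z. ennreal (\<eta> z * \<bar>u (x + z) - u x\<bar>) \<partial>lborel)" for x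
  proof -
    have 1: "integrable lborel (\<lambda>z. \<eta> z *\<^sub>R u (x + z))"
      using lborel_integrable_translation[OF conv_integrable[OF u mollifier_test_fun[OF m], of x], of x]
      by (simp add: mollifier_even[OF m] add.commute)
    have 2: "integrable lborel (\<lambda>z. \<eta> z * u x)"
      using test_fun_integrable[OF mollifier_test_fun[OF m]] by simp
    have "conv u \<eta> x - u x = (LINT z|lborel. \<eta> z * u (x + z)) - (LINT z|lborel. \<eta> z * u x)"
      using conv_translate[OF _ mollifier_test_fun[OF m], of u x] mollifier_integral[OF m]
      by (simp add: mollifier_even[OF m])
    also have "\<dots> = (LINT z|lborel. \<eta> z * (u (x + z) - u x))"
      using 1 2 by (simp add: right_diff_distrib)
    finally have eq: "conv u \<eta> x - u x = (LINT z|lborel. \<eta> z * (u (x + z) - u x))" .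
    have 3: "integrable lborel (\<lambda>z. \<eta> z * (u (x + z) - u x))"
      using 1 2 by (simp add: right_diff_distrib)
    have "ennreal (norm (conv u \<eta> x - u x)) \<le> (\<integral>\<^sup>+z. norm (\<eta> z * (u (x + z) - u x)) \<partial>lborel)"
      unfolding eq by (rule integral_norm_bound_ennreal[OF 3])
    then show ?thesis by (simp add: abs_mult mollifier_nonneg[OF m])
  qed
  have "(\<integral>\<^sup>+x. ennreal \<bar>conv u \<eta> x - u x\<bar> \<partial>lborel) \<le>
     (\<integral>\<^sup>+x. (\<integral>\<^sup>+z. ennreal (\<eta> z * \<bar>u (x + z) - u x\<bar>) \<partial>lborel) \<partial>lborel)"
    by (rule nn_integral_mono) (rule pt)
  \<comment> \<open>The interchange is made with nonnegative integrals because integrability of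
    \<open>conv u \<eta>\<close> is not known yet; it is read off from the resulting finite
    bound.\<close>
  also have "\<dots> = (\<integral>\<^sup>+z. (\<integral>\<^sup>+x. ennreal (\<eta> z * \<bar>u (x + z) - u x\<bar>) \<partial>lborel) \<partial>lborel)"
    by (rule lborel_pair.Fubini') measurable
  also have "\<dots> \<le> (\<integral>\<^sup>+z. ennreal (\<eta> z * B) \<partial>lborel)"
  proof (rule nn_integral_mono)
    fix z :: 'a
    have i: "integrable lborel (\<lambda>x. \<eta> z * \<bar>u (x + z) - u x\<bar>)"
      using lborel_integrable_translation[OF u, of z] u by auto
    have "(LINT x|lborel. \<eta> z * \<bar>u (x + z) - u x\<bar>) \<le> \<eta> z * B"
    proof (cases "norm z < \<epsilon>")
      case True
      then show ?thesis using B(1)[OF True] mollifier_nonneg[OF m, of z] by (simp add: mult_left_mono)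
    next
      case False
      then show ?thesis using mollifier_zero[OF m] by simp
    qed
    then show "(\<integral>\<^sup>+x. ennreal (\<eta> z * \<bar>u (x + z) - u x\<bar>) \<partial>lborel) \<le> ennreal (\<eta> z * B)"
      using mollifier_nonneg[OF m, of z]
      by (subst nn_integral_eq_integral[OF i]) (auto intro: ennreal_leI)
  qed
  also have "\<dots> = ennreal B"
    using test_fun_integrable[OF mollifier_test_fun[OF m]] mollifier_nonneg[OF m] B0 mollifier_integral[OF m]
    by (subst nn_integral_eq_integral) auto
  finally have nn: "(\<integral>\<^sup>+x. ennreal \<bar>conv u \<eta> x - u x\<bar> \<partial>lborel) \<le> ennreal B" .
  then have i: "integrable lborel (\<lambda>x. conv u \<eta> x - u x)"
    by (intro integrableI_bounded) (auto simp: less_top[symmetric] top_unique)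
  from Bochner_Integration.integrable_add[OF i u] show "integrable lborel (conv u \<eta>)" by simp
  show "(LINT x|lborel. \<bar>conv u \<eta> x - u x\<bar>) \<le> B"
    using nn nn_integral_eq_integral[OF integrable_abs[OF i]] B0 by simp
qed

subsection \<open>Integration by parts and translations\<close>

lemma test_fun_mult:
  fixes \<phi> \<psi> :: "'a::euclidean_space \<Rightarrow> real"
  assumes "\<phi> \<in> test_fun U" "\<And>k. Ck k \<psi>"
  shows "(\<lambda>x. \<phi> x * \<psi> x) \<in> test_fun U"
  using assms(1) by (elim test_funE, intro test_funI) (auto intro: Ck_mult assms(2))

text \<open>The Taylor remainder is bounded uniformly in \<open>x\<close>, and for t at most 1 it
  vanishes outside one ball whose radius exceeds that of the support by |h|. Hence the pointwise
  bound survives integration.\<close>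

lemma test_fun_difference_quotient:
  fixes \<phi> :: "'a::euclidean_space \<Rightarrow> real"
  assumes "\<phi> \<in> test_fun U"
  obtains C where "C \<ge> 0"
    "\<And>t. 0 < t \<Longrightarrow> t \<le> 1 \<Longrightarrow> (LINT x|lborel. \<bar>\<phi> (x + t *\<^sub>R h) - \<phi> x - t * (grad \<phi> x \<bullet> h)\<bar>) \<le> C * t\<^sup>2"
proof -
  obtain K where K: "\<And>k. Ck k \<phi>" "compact K" "K \<subseteq> U" "\<And>x. x \<notin> K \<Longrightarrow> \<phi> x = 0"
    using test_funE[OF assms] by blast
  obtain R where R: "\<And>x. x \<in> K \<Longrightarrow> norm x \<le> R"
    using compact_imp_bounded[OF K(2)] unfolding bounded_iff by blast
  obtain M where M: "M > 0" "\<And>x h. \<bar>\<phi> (x + h) - \<phi> x - grad \<phi> x \<bullet> h\<bar> \<le> M * (norm h)\<^sup>2"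
    using test_fun_taylor[OF assms] by blast
  define B where "B = cball (0::'a) (R + norm h)"
  have fin: "emeasure lborel B < \<infinity>" unfolding B_def by (rule emeasure_bounded_finite) simp
  define C where "C = M * (norm h)\<^sup>2 * measure lborel B"
  note [measurable] = test_fun_measurable[OF assms] test_fun_measurable[OF grad_test_fun[OF assms]]
  show ?thesis
  proof (rule that[of C])
    show "C \<ge> 0" using M by (simp add: C_def)
    fix t :: real assume t: "0 < t" "t \<le> 1"
    let ?g = "\<lambda>x. \<bar>\<phi> (x + t *\<^sub>R h) - \<phi> x - t * (grad \<phi> x \<bullet> h)\<bar>"
    let ?k = "\<lambda>x. indicator B x * (M * (norm h)\<^sup>2 * t\<^sup>2)"
    have le: "?g x \<le> ?k x" for x
    proof (cases "x \<in> B")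
      case True
      then show ?thesis using M(2)[of x "t *\<^sub>R h"] by (simp add: power_mult_distrib mult_ac)
    next
      case False
      then have nx: "norm x > R + norm h" by (simp add: B_def)
      then have "x \<notin> K" using R norm_ge_zero[of h] by (metis add_increasing2 not_less)
      moreover have "x + t *\<^sub>R h \<notin> K"
      proof
        assume "x + t *\<^sub>R h \<in> K"
        moreover have "norm (t *\<^sub>R h) \<le> norm h" using t by (simp add: mult_left_le_one_le)
        ultimately show False using R[of "x + t *\<^sub>R h"] nx norm_triangle_ineq4[of "x + t *\<^sub>R h" "t *\<^sub>R h"] by simp
      qed
      moreover have "grad \<phi> x = 0"
        using \<open>x \<notin> K\<close> frechet_derivative_zero_outside[OF compact_imp_closed[OF K(2)] K(4)] by (simp add: grad_def)
      ultimately show ?thesis using K(4) False by simp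
    qed
    have ik: "integrable lborel ?k" using fin by (auto simp: B_def)
    have "integrable lborel ?g"
      by (rule Bochner_Integration.integrable_bound[OF ik]) (use le in \<open>auto intro!: AE_I2 intro: order_trans[OF _ abs_ge_self]\<close>)
    then have "(LINT x|lborel. ?g x) \<le> (LINT x|lborel. ?k x)"
      by (rule integral_mono[OF _ ik le])
    also have "\<dots> = C * t\<^sup>2" using fin by (simp add: C_def B_def)
    finally show "(LINT x|lborel. ?g x) \<le> C * t\<^sup>2" .
  qed
qed

lemma le_all_multiples_imp_nonpos:
  fixes a C :: real
  assumes "\<And>t. 0 < t \<Longrightarrow> t \<le> 1 \<Longrightarrow> a \<le> C * t"
  shows "a \<le> 0"
proof -
  have "((\<lambda>t. C * t) \<longlongrightarrow> C * 0) (at_right 0)" by (intro tendsto_intros)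
  moreover have "eventually (\<lambda>t. a \<le> C * t) (at_right 0)"
    unfolding eventually_at_right_field by (rule exI[of _ 1]) (auto intro: assms)
  ultimately show ?thesis using tendsto_lowerbound[of "\<lambda>t. C * t" "C * 0" "at_right 0" a] by simp
qed

lemma integrable_test_fun_translation:
  fixes \<phi> :: "'a::euclidean_space \<Rightarrow> 'b::euclidean_space"
  assumes "\<phi> \<in> test_fun U" shows "integrable lborel (\<lambda>x. \<phi> (x + a))"
  by (rule lborel_integrable_translation[OF test_fun_integrable[OF assms]])

text \<open>By translation invariance the difference quotients of a test function have integral 0,
  and they approach the directional derivative in L1.\<close>

lemma integral_grad_test_fun:
  fixes \<phi> :: "'a::euclidean_space \<Rightarrow> real"
  assumes \<phi>: "\<phi> \<in> test_fun U"
  shows "(LINT x|lborel. grad \<phi> x \<bullet> h) = 0"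
proof -
  obtain C where C: "C \<ge> 0"
    "\<And>t. 0 < t \<Longrightarrow> t \<le> 1 \<Longrightarrow> (LINT x|lborel. \<bar>\<phi> (x + t *\<^sub>R h) - \<phi> x - t * (grad \<phi> x \<bullet> h)\<bar>) \<le> C * t\<^sup>2"
    using test_fun_difference_quotient[OF \<phi>, where h=h] by blast
  note i = integrable_test_fun_translation[OF \<phi>] test_fun_integrable[OF \<phi>] test_fun_integrable[OF grad_test_fun[OF \<phi>]]
  have "\<bar>LINT x|lborel. grad \<phi> x \<bullet> h\<bar> \<le> 0"
  proof (rule le_all_multiples_imp_nonpos)
    fix t :: real assume t: "0 < t" "t \<le> 1"
    let ?g = "\<lambda>x. \<phi> (x + t *\<^sub>R h) - \<phi> x - t * (grad \<phi> x \<bullet> h)"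
    have "(LINT x|lborel. ?g x) = - (t * (LINT x|lborel. grad \<phi> x \<bullet> h))"
      using i(1)[of "t *\<^sub>R h"] i(2,3) lborel_integral_translation[OF test_fun_measurable[OF \<phi>], of "t *\<^sub>R h"] by simp
    then have "t * \<bar>LINT x|lborel. grad \<phi> x \<bullet> h\<bar> = \<bar>LINT x|lborel. ?g x\<bar>"
      using t by (simp add: abs_mult)
    also have "\<dots> \<le> C * t\<^sup>2" using C(2)[OF t] by (rule order_trans[OF integral_abs_bound])
    finally show "\<bar>LINT x|lborel. grad \<phi> x \<bullet> h\<bar> \<le> C * t" using t by (simp add: power2_eq_square)
  qed
  then show ?thesis by simp
qed

lemma integration_by_parts:
  fixes \<phi> \<psi> :: "'a::euclidean_space \<Rightarrow> real"
  assumes \<phi>: "\<phi> \<in> test_fun U" and \<psi>: "\<And>k. Ck k \<psi>" and b: "b \<in> Basis"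
  shows "(LINT x|lborel. \<phi> x * frechet_derivative \<psi> (at x) b) = - (LINT x|lborel. frechet_derivative \<phi> (at x) b * \<psi> x)"
proof -
  have i: "integrable lborel (\<lambda>x. \<phi> x * frechet_derivative \<psi> (at x) b)"
    "integrable lborel (\<lambda>x. frechet_derivative \<phi> (at x) b * \<psi> x)"
    by (rule test_fun_integrable[OF test_fun_mult[OF \<phi> Ck_Suc_partial[OF \<psi> b]]],
        rule test_fun_integrable[OF test_fun_mult[OF test_fun_partial[OF \<phi> b] \<psi>]])
  have "grad (\<lambda>x. \<phi> x * \<psi> x) x \<bullet> b = \<phi> x * frechet_derivative \<psi> (at x) b + frechet_derivative \<phi> (at x) b * \<psi> x" for x
    by (subst grad_mult[OF test_fun_Ck[OF \<phi>] \<psi>]) (simp add: inner_add_left grad_inner_Basis[OF b])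
  then have "0 = (LINT x|lborel. \<phi> x * frechet_derivative \<psi> (at x) b + frechet_derivative \<phi> (at x) b * \<psi> x)"
    using integral_grad_test_fun[OF test_fun_mult[OF \<phi> \<psi>], of b] by simp
  with i show ?thesis by simp
qed

text \<open>The translation by \<open>h\<close> is split into n equal steps. Each step costs 1/n of
  the right-hand side up to an error of order 1/n^2, so the total error is of order 1/n and
  disappears in the limit.\<close>

lemma test_fun_translation_L1:
  fixes \<phi> :: "'a::euclidean_space \<Rightarrow> real"
  assumes \<phi>: "\<phi> \<in> test_fun U"
  shows "(LINT x|lborel. \<bar>\<phi> (x + h) - \<phi> x\<bar>) \<le> norm h * (LINT x|lborel. norm (grad \<phi> x))"
proof -
  obtain C where C: "C \<ge> 0"
    "\<And>t. 0 < t \<Longrightarrow> t \<le> 1 \<Longrightarrow> (LINT x|lborel. \<bar>\<phi> (x + t *\<^sub>R h) - \<phi> x - t * (grad \<phi> x \<bullet> h)\<bar>) \<le> C * t\<^sup>2"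
    using test_fun_difference_quotient[OF \<phi>, where h=h] by blast
  note i = integrable_test_fun_translation[OF \<phi>] test_fun_integrable[OF \<phi>] test_fun_integrable[OF grad_test_fun[OF \<phi>]]
  note [measurable] = test_fun_measurable[OF \<phi>]
  define G where "G = (LINT x|lborel. norm (grad \<phi> x))"
  have tele: "(LINT x|lborel. \<bar>\<phi> (x + real n *\<^sub>R k) - \<phi> x\<bar>) \<le> real n * (LINT x|lborel. \<bar>\<phi> (x + k) - \<phi> x\<bar>)" for n k
  proof (induction n)
    case (Suc n)
    have "(LINT x|lborel. \<bar>\<phi> (x + real (Suc n) *\<^sub>R k) - \<phi> x\<bar>) \<le>
      (LINT x|lborel. \<bar>\<phi> (x + real n *\<^sub>R k + k) - \<phi> (x + real n *\<^sub>R k)\<bar> + \<bar>\<phi> (x + real n *\<^sub>R k) - \<phi> x\<bar>)"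
    proof (rule integral_mono)
      show "integrable lborel (\<lambda>x. \<bar>\<phi> (x + real n *\<^sub>R k + k) - \<phi> (x + real n *\<^sub>R k)\<bar> + \<bar>\<phi> (x + real n *\<^sub>R k) - \<phi> x\<bar>)"
        unfolding add.assoc by (intro Bochner_Integration.integrable_add integrable_abs Bochner_Integration.integrable_diff i)
      show "integrable lborel (\<lambda>x. \<bar>\<phi> (x + real (Suc n) *\<^sub>R k) - \<phi> x\<bar>)"
        by (intro Bochner_Integration.integrable_add integrable_abs Bochner_Integration.integrable_diff i)
      fix x
      have eq: "x + real (Suc n) *\<^sub>R k = x + real n *\<^sub>R k + k" by (simp add: algebra_simps)
      show "\<bar>\<phi> (x + real (Suc n) *\<^sub>R k) - \<phi> x\<bar> \<le> \<bar>\<phi> (x + real n *\<^sub>R k + k) - \<phi> (x + real n *\<^sub>R k)\<bar> + \<bar>\<phi> (x + real n *\<^sub>R k) - \<phi> x\<bar>"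
        unfolding eq by linarith
    qed
    also have "\<dots> = (LINT x|lborel. \<bar>\<phi> (x + real n *\<^sub>R k + k) - \<phi> (x + real n *\<^sub>R k)\<bar>) + (LINT x|lborel. \<bar>\<phi> (x + real n *\<^sub>R k) - \<phi> x\<bar>)"
      unfolding add.assoc by (intro Bochner_Integration.integral_add Bochner_Integration.integrable_add integrable_abs Bochner_Integration.integrable_diff i)
    also have "(LINT x|lborel. \<bar>\<phi> (x + real n *\<^sub>R k + k) - \<phi> (x + real n *\<^sub>R k)\<bar>) = (LINT x|lborel. \<bar>\<phi> (x + k) - \<phi> x\<bar>)"
      by (rule lborel_integral_translation) measurable
    finally show ?case using Suc by (simp add: algebra_simps)
  qed simp
  have "(LINT x|lborel. \<bar>\<phi> (x + h) - \<phi> x\<bar>) - norm h * G \<le> 0"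
  proof (rule LIMSEQ_le[of _ _ "\<lambda>n. C * (1 / real (Suc n))"])
    show "(\<lambda>n. C * (1 / real (Suc n))) \<longlonglongrightarrow> 0"
      by (rule tendsto_mult_right_zero) (use LIMSEQ_Suc[OF lim_1_over_n] in simp)
    show "\<exists>N. \<forall>n\<ge>N. (LINT x|lborel. \<bar>\<phi> (x + h) - \<phi> x\<bar>) - norm h * G \<le> C * (1 / real (Suc n))"
    proof (intro exI allI impI)
      fix n :: nat
      define t where "t = 1 / real (Suc n)"
      have t: "0 < t" "t \<le> 1" "real (Suc n) * t = 1" by (auto simp: t_def)
      have "(LINT x|lborel. \<bar>\<phi> (x + t *\<^sub>R h) - \<phi> x\<bar>) \<le>
        (LINT x|lborel. \<bar>\<phi> (x + t *\<^sub>R h) - \<phi> x - t * (grad \<phi> x \<bullet> h)\<bar> + t * norm h * norm (grad \<phi> x))"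
      proof (rule integral_mono)
        fix x
        have "\<bar>t * (grad \<phi> x \<bullet> h)\<bar> \<le> t * norm h * norm (grad \<phi> x)"
          using Cauchy_Schwarz_ineq2[of "grad \<phi> x" h] t by (simp add: abs_mult mult_ac)
        then show "\<bar>\<phi> (x + t *\<^sub>R h) - \<phi> x\<bar> \<le> \<bar>\<phi> (x + t *\<^sub>R h) - \<phi> x - t * (grad \<phi> x \<bullet> h)\<bar> + t * norm h * norm (grad \<phi> x)"
          by linarith
      qed (auto intro!: Bochner_Integration.integrable_add integrable_abs Bochner_Integration.integrable_diff i integrable_norm)
      also have "\<dots> = (LINT x|lborel. \<bar>\<phi> (x + t *\<^sub>R h) - \<phi> x - t * (grad \<phi> x \<bullet> h)\<bar>) + t * norm h * G"
        unfolding G_def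
        by (subst Bochner_Integration.integral_add) (auto intro!: Bochner_Integration.integrable_add integrable_abs Bochner_Integration.integrable_diff i integrable_norm)
      also have "\<dots> \<le> C * t\<^sup>2 + t * norm h * G" using C(2)[OF t(1,2)] by simp
      finally have "(LINT x|lborel. \<bar>\<phi> (x + t *\<^sub>R h) - \<phi> x\<bar>) \<le> C * t\<^sup>2 + t * norm h * G" .
      then have "real (Suc n) * (LINT x|lborel. \<bar>\<phi> (x + t *\<^sub>R h) - \<phi> x\<bar>) \<le> real (Suc n) * (C * t\<^sup>2 + t * norm h * G)"
        by (intro mult_left_mono) auto
      also have "\<dots> = C * t * (real (Suc n) * t) + norm h * G * (real (Suc n) * t)"
        by (simp only: power2_eq_square ring_distribs mult_ac)
      also have "\<dots> = C * t + norm h * G" unfolding t(3) by simp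
      finally have "real (Suc n) * (LINT x|lborel. \<bar>\<phi> (x + t *\<^sub>R h) - \<phi> x\<bar>) \<le> C * t + norm h * G" .
      moreover have "(LINT x|lborel. \<bar>\<phi> (x + h) - \<phi> x\<bar>) \<le> real (Suc n) * (LINT x|lborel. \<bar>\<phi> (x + t *\<^sub>R h) - \<phi> x\<bar>)"
        using tele[of "Suc n" "t *\<^sub>R h"] t(3) by (simp only: scaleR_scaleR scaleR_one)
      ultimately show "(LINT x|lborel. \<bar>\<phi> (x + h) - \<phi> x\<bar>) - norm h * G \<le> C * (1 / real (Suc n))"
        unfolding t_def by linarith
    qed
  qed simp
  then show ?thesis by (simp add: G_def)
qed

text \<open>Induction over integrable functions: indicators of sets of finite measure, sums, and
  dominated limits. Only the indicator case has content.\<close>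

lemma L1_translation_continuous_seq:
  fixes u :: "'a::euclidean_space \<Rightarrow> real"
  assumes "integrable lborel u"
  shows "z \<longlonglongrightarrow> 0 \<Longrightarrow> (\<lambda>n. LINT x|lborel. \<bar>u (x + z n) - u x\<bar>) \<longlonglongrightarrow> 0"
  using assms
proof (induction u rule: integrable_induct)
  case (base A c)
  have A: "A \<in> sets borel" "emeasure lborel A < \<infinity>" using base by auto
  have ind: "\<exists>U. open U \<and> A \<subseteq> U \<and> emeasure lborel (U - A) < ennreal e" if "e > 0" for e :: real
    using outer_regular_lborel[OF A(1) that] by metis
  have "(\<lambda>n. LINT x|lborel. \<bar>indicat_real A (x + z n) - indicator A x\<bar>) \<longlonglongrightarrow> 0"
  proof (rule LIMSEQ_I)
    fix e :: real assume e: "e > 0"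
    \<comment> \<open>Outer regularity replaces \<open>A\<close> by an open set; the excess
      \<open>U - A\<close> enters twice, once for each of the two translates.\<close>
    obtain U where U: "open U" "A \<subseteq> U" "emeasure lborel (U - A) < ennreal (e/4)"
      using ind[of "e/4"] e by auto
    have UA: "emeasure lborel (U - A) < \<infinity>" using U(3) by (rule order.strict_trans) simp
    have "emeasure lborel U \<le> emeasure lborel (U - A) + emeasure lborel A"
      using U A by (metis (no_types, opaque_lifting) Diff_partition Un_commute borel_open emeasure_subadditive sets.Diff sets_lborel)
    then have Uf: "emeasure lborel U < \<infinity>" using UA A(2) by (simp add: ennreal_add_less_top le_less_trans)
    have iU: "integrable lborel (indicat_real U)" and iA: "integrable lborel (indicat_real A)"
      using Uf U(1) A by (auto simp: integrable_indicator_iff)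
    note tU = lborel_integrable_translation[OF iU] and tA = lborel_integrable_translation[OF iA]
    define d where "d = measure lborel (U - A)"
    have d: "d < e/4" using U(3) UA e unfolding d_def
      by (metis emeasure_eq_ennreal_measure ennreal_less_iff infinity_ennreal_def less_irrefl measure_nonneg)
    have [measurable]: "U \<in> sets borel" "A \<in> sets borel" using U A by auto
    have iD: "integrable lborel (\<lambda>x. indicat_real U x - indicator A x)" using iU iA by simp
    have D: "(LINT x|lborel. indicat_real U x - indicator A x) = d"
    proof -
      have "indicat_real U x - indicator A x = indicator (U - A) x" for x using U(2) by (auto simp: indicator_def)
      then show ?thesis by (simp add: d_def)
    qed
    \<comment> \<open>Openness gives only one half: a point of \<open>U\<close> stays in
      \<open>U\<close> under small translations. This is why only the positive part of the
      difference is treated by dominated convergence.\<close>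
    have lim: "(\<lambda>n. LINT x|lborel. max 0 (indicat_real U x - indicator U (x + z n))) \<longlonglongrightarrow> (LINT x|(lborel::'a measure). 0)"
    proof (rule integral_dominated_convergence[where w="indicat_real U"])
      show "AE x in lborel. (\<lambda>n. max 0 (indicat_real U x - indicator U (x + z n))) \<longlonglongrightarrow> 0"
      proof (rule AE_I2)
        fix x
        show "(\<lambda>n. max 0 (indicat_real U x - indicator U (x + z n))) \<longlonglongrightarrow> 0"
        proof (cases "x \<in> U")
          case True
          have "(\<lambda>n. x + z n) \<longlonglongrightarrow> x + 0" by (intro tendsto_intros base)
          then have "eventually (\<lambda>n. x + z n \<in> U) sequentially"
            using topological_tendstoD[OF _ U(1)] True by fastforce
          then show ?thesis by (intro tendsto_eventually, eventually_elim) (auto simp: True)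
        next
          case False
          then have "max 0 (indicat_real U x - indicator U (x + z n)) = 0" for n by (simp add: indicator_def)
          then show ?thesis by simp
        qed
      qed
      show "AE x in lborel. norm (max 0 (indicat_real U x - indicator U (x + z n))) \<le> indicator U x" for n
        by (rule AE_I2) (auto simp: indicator_def)
    qed (use iU in \<open>auto\<close>)
    \<comment> \<open>The other half follows from invariance of the measure: the signed difference
      has integral 0, so the absolute value integrates to twice the positive part.\<close>
    have eqU: "(LINT x|lborel. \<bar>indicat_real U (x + z n) - indicator U x\<bar>) = 2 * (LINT x|lborel. max 0 (indicat_real U x - indicator U (x + z n)))" for n
    proof -
      have "(LINT x|lborel. \<bar>indicat_real U (x + z n) - indicator U x\<bar>) =
        (LINT x|lborel. 2 * max 0 (indicat_real U x - indicator U (x + z n)) + (indicator U (x + z n) - indicator U x))"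
        by (rule Bochner_Integration.integral_cong) (auto simp: indicator_def)
      also have "\<dots> = 2 * (LINT x|lborel. max 0 (indicat_real U x - indicator U (x + z n)))"
        using iU tU[of "z n"] lborel_integral_translation[of "indicat_real U" "z n"] by simp
      finally show ?thesis .
    qed
    obtain N where N: "\<And>n. n \<ge> N \<Longrightarrow> \<bar>LINT x|lborel. max 0 (indicat_real U x - indicator U (x + z n))\<bar> < e/4"
      using LIMSEQ_D[OF lim, of "e/4"] e by auto
    show "\<exists>no. \<forall>n\<ge>no. norm ((LINT x|lborel. \<bar>indicat_real A (x + z n) - indicator A x\<bar>) - 0) < e"
    proof (intro exI allI impI)
      fix n assume n: "n \<ge> N"
      have "(LINT x|lborel. \<bar>indicat_real A (x + z n) - indicator A x\<bar>) \<le>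
        (LINT x|lborel. \<bar>indicat_real U (x + z n) - indicator U x\<bar> + (indicator U (x + z n) - indicator A (x + z n)) + (indicator U x - indicator A x))"
      proof (rule integral_mono)
        show "\<bar>indicat_real A (x + z n) - indicator A x\<bar> \<le> \<bar>indicat_real U (x + z n) - indicator U x\<bar> + (indicator U (x + z n) - indicator A (x + z n)) + (indicator U x - indicator A x)" for x
          using U(2) by (auto simp: indicator_def)
      qed (use iU iA tU[of "z n"] tA[of "z n"] in auto)
      also have "\<dots> = 2 * (LINT x|lborel. max 0 (indicat_real U x - indicator U (x + z n))) + d + d"
        using iU iA tU[of "z n"] tA[of "z n"] lborel_integral_translation[of "\<lambda>x. indicat_real U x - indicator A x" "z n"] D
        by (simp add: eqU)
      also have "\<dots> < e" using N[OF n] d by simp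
      finally have "(LINT x|lborel. \<bar>indicat_real A (x + z n) - indicator A x\<bar>) < e" .
      moreover have "(LINT x|lborel. \<bar>indicat_real A (x + z n) - indicator A x\<bar>) \<ge> 0" by simp
      ultimately show "norm ((LINT x|lborel. \<bar>indicat_real A (x + z n) - indicator A x\<bar>) - 0) < e" by simp
    qed
  qed
  moreover have "\<bar>indicat_real A (x + z n) *\<^sub>R c - indicat_real A x *\<^sub>R c\<bar> = \<bar>c\<bar> * \<bar>indicat_real A (x + z n) - indicator A x\<bar>" for x n
    by (simp add: abs_mult[symmetric] algebra_simps)
  ultimately show ?case using tendsto_mult_right_zero[of _ _ "\<bar>c\<bar>"] by simp
next
  case (add f g)
  note i = lborel_integrable_translation[OF add.hyps(1)] lborel_integrable_translation[OF add.hyps(2)] add.hyps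
  show ?case
  proof (rule tendsto_sandwich[OF _ _ tendsto_const])
    show "(\<lambda>n. (LINT x|lborel. \<bar>f (x + z n) - f x\<bar>) + (LINT x|lborel. \<bar>g (x + z n) - g x\<bar>)) \<longlonglongrightarrow> 0"
      using tendsto_add[OF add.IH[OF add.prems]] by simp
    have "(LINT x|lborel. \<bar>f (x + z n) + g (x + z n) - (f x + g x)\<bar>) \<le> (LINT x|lborel. \<bar>f (x + z n) - f x\<bar> + \<bar>g (x + z n) - g x\<bar>)" for n
      by (rule integral_mono) (use i in auto)
    then show "eventually (\<lambda>n. (LINT x|lborel. \<bar>f (x + z n) + g (x + z n) - (f x + g x)\<bar>) \<le> (LINT x|lborel. \<bar>f (x + z n) - f x\<bar>) + (LINT x|lborel. \<bar>g (x + z n) - g x\<bar>)) sequentially"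
      using i by simp
  qed (auto intro!: always_eventually)
next
  case (lim f s)
  have [measurable]: "f \<in> borel_measurable borel" "s i \<in> borel_measurable borel" for i
    using lim.hyps(1,4) borel_measurable_integrable by force+
  have "(\<lambda>i. LINT x|lborel. \<bar>s i x - f x\<bar>) \<longlonglongrightarrow> (LINT x|(lborel::'a measure). 0)"
  proof (rule integral_dominated_convergence[where w="\<lambda>x. 3 * \<bar>f x\<bar>"])
    show "AE x in lborel. (\<lambda>i. \<bar>s i x - f x\<bar>) \<longlonglongrightarrow> 0"
      using lim.hyps(2) by (intro AE_I2 tendsto_rabs_zero) (simp add: LIM_zero_iff)
    show "AE x in lborel. norm \<bar>s i x - f x\<bar> \<le> 3 * \<bar>f x\<bar>" for i
    proof (rule AE_I2)
      fix x
      show "norm \<bar>s i x - f x\<bar> \<le> 3 * \<bar>f x\<bar>" using lim.hyps(3)[of x i] by simp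
    qed
  qed (use lim.hyps(4) in auto)
  then have L: "(\<lambda>i. LINT x|lborel. \<bar>s i x - f x\<bar>) \<longlonglongrightarrow> 0" by simp
  show ?case
  proof (rule LIMSEQ_I)
    fix e :: real assume e: "e > 0"
    obtain i where i: "(LINT x|lborel. \<bar>s i x - f x\<bar>) < e/4"
      using LIMSEQ_D[OF L, of "e/4"] e by fastforce
    obtain N where N: "\<And>n. n \<ge> N \<Longrightarrow> (LINT x|lborel. \<bar>s i (x + z n) - s i x\<bar>) < e/4"
      using LIMSEQ_D[OF lim.IH[OF lim.prems, of i], of "e/4"] e by fastforce
    note I = lim.hyps(1)[of i] lim.hyps(4) lborel_integrable_translation[OF lim.hyps(1)[of i]] lborel_integrable_translation[OF lim.hyps(4)]
    show "\<exists>no. \<forall>n\<ge>no. norm ((LINT x|lborel. \<bar>f (x + z n) - f x\<bar>) - 0) < e"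
    proof (intro exI allI impI)
      fix n assume n: "n \<ge> N"
      have "(LINT x|lborel. \<bar>f (x + z n) - f x\<bar>) \<le> (LINT x|lborel. \<bar>s i (x + z n) - f (x + z n)\<bar> + \<bar>s i (x + z n) - s i x\<bar> + \<bar>s i x - f x\<bar>)"
        by (rule integral_mono) (use I(1,2) I(3,4)[of "z n"] in auto)
      also have "\<dots> = 2 * (LINT x|lborel. \<bar>s i x - f x\<bar>) + (LINT x|lborel. \<bar>s i (x + z n) - s i x\<bar>)"
        using I(1,2) I(3,4)[of "z n"] lborel_integral_translation[of "\<lambda>x. \<bar>s i x - f x\<bar>" "z n"] by simp
      also have "\<dots> < e" using i N[OF n] e by linarith
      finally show "norm ((LINT x|lborel. \<bar>f (x + z n) - f x\<bar>) - 0) < e" by simp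
    qed
  qed
qed

lemma L1_translation_continuous:
  fixes u :: "'a::euclidean_space \<Rightarrow> real"
  assumes "integrable lborel u" "e > 0"
  obtains d where "d > 0" "\<And>z. norm z < d \<Longrightarrow> (LINT x|lborel. \<bar>u (x + z) - u x\<bar>) < e"
proof -
  have "\<exists>d>0. \<forall>z. norm z < d \<longrightarrow> (LINT x|lborel. \<bar>u (x + z) - u x\<bar>) < e"
  proof (rule ccontr)
    assume "\<not> ?thesis"
    then have "\<forall>n. \<exists>z. norm z < 1 / real (Suc n) \<and> (LINT x|lborel. \<bar>u (x + z) - u x\<bar>) \<ge> e"
      by (metis not_less of_nat_0_less_iff zero_less_Suc zero_less_divide_1_iff)
    then obtain z where z: "\<And>n. norm (z n) < 1 / real (Suc n)" "\<And>n. (LINT x|lborel. \<bar>u (x + z n) - u x\<bar>) \<ge> e"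
      by metis
    have "z \<longlonglongrightarrow> 0"
      by (rule tendsto_norm_zero_cancel, rule tendsto_sandwich[OF _ _ tendsto_const LIMSEQ_Suc[OF lim_1_over_n]])
         (use z(1) in \<open>auto intro!: always_eventually less_imp_le\<close>)
    from LIMSEQ_le_const[OF L1_translation_continuous_seq[OF assms(1) this], of e] z(2) assms(2)
    show False by auto
  qed
  then show ?thesis using that by blast
qed

subsection \<open>Mollification does not increase the total variation\<close>

lemma grad_conv_inner:
  fixes u :: "'a::euclidean_space \<Rightarrow> real"
  assumes "integrable lborel u" "\<eta> \<in> test_fun UNIV"
  shows "grad (conv u \<eta>) x \<bullet> h = (LINT y|lborel. (grad \<eta> (x - y) \<bullet> h) * u y)"
  using has_derivative_grad[OF conv_has_derivative[OF assms], of h x] conv_partial_sum(1)[OF assms, of h x] by simp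

lemma divergence_conv:
  fixes \<phi> :: "'a::euclidean_space \<Rightarrow> 'a"
  assumes "integrable lborel \<phi>" "\<eta> \<in> test_fun UNIV"
  shows "divergence (conv \<phi> \<eta>) y = (LINT x|lborel. grad \<eta> (y - x) \<bullet> \<phi> x)"
proof -
  have i: "integrable lborel (\<lambda>x. frechet_derivative \<eta> (at (y - x)) b *\<^sub>R \<phi> x)" if "b \<in> Basis" for b
    by (rule conv_integrable[OF assms(1) test_fun_partial[OF assms(2) that]])
  have "divergence (conv \<phi> \<eta>) y = (\<Sum>b\<in>Basis. (LINT x|lborel. (frechet_derivative \<eta> (at (y - x)) b *\<^sub>R \<phi> x) \<bullet> b))"
    unfolding divergence_def
    by (rule sum.cong[OF refl]) (simp only: frechet_derivative_conv[OF assms] conv_def integral_inner_left[OF i])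
  also have "\<dots> = (LINT x|lborel. (\<Sum>b\<in>Basis. (frechet_derivative \<eta> (at (y - x)) b *\<^sub>R \<phi> x) \<bullet> b))"
    by (rule Bochner_Integration.integral_sum[symmetric]) (rule integrable_inner_left, rule i)
  also have "\<dots> = (LINT x|lborel. grad \<eta> (y - x) \<bullet> \<phi> x)"
    by (simp add: grad_def inner_sum_left inner_commute[of "\<phi> _"])
  finally show ?thesis .
qed

lemma mollifier_grad_odd:
  assumes "mollifier \<epsilon> \<eta>"
  shows "grad \<eta> (- z) = - grad \<eta> z"
proof -
  have "((\<lambda>z. \<eta> (- z)) has_derivative (\<lambda>h. grad \<eta> (- z) \<bullet> (- h))) (at z)"
    by (rule has_derivative_compose[of uminus uminus z UNIV \<eta> "\<lambda>h. grad \<eta> (-z) \<bullet> h"])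
       (auto intro!: derivative_eq_intros has_derivative_gradI test_fun_Ck[OF mollifier_test_fun[OF assms]] simp del: Ck.simps)
  then have "(\<eta> has_derivative (\<lambda>h. (- grad \<eta> (- z)) \<bullet> h)) (at z)"
    by (simp add: mollifier_even[OF assms])
  from grad_eqI[OF this] show ?thesis by simp
qed

text \<open>Both sides are the double integral of the gradient of the kernel against the field and
  \<open>u\<close>. Fubini exchanges the order, and the sign comes from the gradient of an even
  kernel being odd.\<close>

lemma grad_conv_duality:
  fixes u :: "'a::euclidean_space \<Rightarrow> real" and \<phi> :: "'a \<Rightarrow> 'a"
  assumes u: "integrable lborel u" and \<phi>: "integrable lborel \<phi>" and m: "mollifier \<epsilon> \<eta>"
  shows "(LINT x|lborel. grad (conv u \<eta>) x \<bullet> \<phi> x) = - (LINT y|lborel. u y * divergence (conv \<phi> \<eta>) y)"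
proof -
  note \<eta> = mollifier_test_fun[OF m]
  note [measurable] = borel_measurable_integrable[OF u] borel_measurable_integrable[OF \<phi>]
    test_fun_measurable[OF grad_test_fun[OF \<eta>]]
  obtain B where B: "B > 0" "\<And>x. norm (grad \<eta> x) \<le> B" using test_fun_bounded[OF grad_test_fun[OF \<eta>]] by blast
  let ?f = "\<lambda>x y. (grad \<eta> (x - y) \<bullet> \<phi> x) * u y"
  have bd: "norm (?f x y) \<le> (B * norm (\<phi> x)) * \<bar>u y\<bar>" for x y
    unfolding real_norm_def abs_mult
    by (intro mult_right_mono order_trans[OF Cauchy_Schwarz_ineq2] mult_right_mono B) auto
  have i1: "integrable lborel (\<lambda>y. ?f x y)" for x
  proof (rule Bochner_Integration.integrable_bound)
    show "integrable lborel (\<lambda>y. (B * norm (\<phi> x)) * \<bar>u y\<bar>)" using u by simp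
    show "AE y in lborel. norm (?f x y) \<le> norm ((B * norm (\<phi> x)) * \<bar>u y\<bar>)"
      by (rule AE_I2, rule order_trans[OF bd]) simp
  qed measurable
  have "integrable (lborel \<Otimes>\<^sub>M lborel) (case_prod ?f)"
  proof (rule lborel_pair.Fubini_integrable)
    show "case_prod ?f \<in> borel_measurable (lborel \<Otimes>\<^sub>M lborel)" by measurable
    show "AE x in lborel. integrable lborel (\<lambda>y. case_prod ?f (x, y))" using i1 by simp
    show "integrable lborel (\<lambda>x. LINT y|lborel. norm (case_prod ?f (x, y)))"
    proof (rule Bochner_Integration.integrable_bound[where f="\<lambda>x. norm (\<phi> x) * (B * (LINT y|lborel. \<bar>u y\<bar>))"])
      show "integrable lborel (\<lambda>x. norm (\<phi> x) * (B * (LINT y|lborel. \<bar>u y\<bar>)))" using \<phi> by simp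
      show "AE x in lborel. norm (LINT y|lborel. norm (case_prod ?f (x, y))) \<le> norm (norm (\<phi> x) * (B * (LINT y|lborel. \<bar>u y\<bar>)))"
      proof (rule AE_I2)
        fix x
        have "(LINT y|lborel. norm (?f x y)) \<le> (LINT y|lborel. (B * norm (\<phi> x)) * \<bar>u y\<bar>)"
          by (rule integral_mono[OF integrable_norm[OF i1] _ bd]) (use u in auto)
        also have "\<dots> = norm (\<phi> x) * (B * (LINT y|lborel. \<bar>u y\<bar>))" by simp
        finally show "norm (LINT y|lborel. norm (case_prod ?f (x, y))) \<le> norm (norm (\<phi> x) * (B * (LINT y|lborel. \<bar>u y\<bar>)))"
          by simp
      qed
    qed measurable
  qed
  from lborel_pair.Fubini_integral[OF this]
  have F: "(LINT y|lborel. (LINT x|lborel. ?f x y)) = (LINT x|lborel. (LINT y|lborel. ?f x y))" .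
  have "(LINT x|lborel. grad (conv u \<eta>) x \<bullet> \<phi> x) = (LINT x|lborel. (LINT y|lborel. ?f x y))"
    by (simp add: grad_conv_inner[OF u \<eta>])
  also have "\<dots> = (LINT y|lborel. (LINT x|lborel. ?f x y))" by (rule F[symmetric])
  also have "\<dots> = (LINT y|lborel. - (u y * divergence (conv \<phi> \<eta>) y))"
  proof (rule Bochner_Integration.integral_cong[OF refl])
    fix y
    have "grad \<eta> (x - y) = - grad \<eta> (y - x)" for x
      using mollifier_grad_odd[OF m, of "y - x"] by simp
    then show "(LINT x|lborel. ?f x y) = - (u y * divergence (conv \<phi> \<eta>) y)"
      by (simp add: divergence_conv[OF \<phi> \<eta>])
  qed
  finally show ?thesis by simp
qed

lemma conv_test_fun:
  fixes u :: "'a::euclidean_space \<Rightarrow> real"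
  assumes u: "integrable lborel u" "\<And>x. R < norm x \<Longrightarrow> u x = 0" and m: "mollifier \<epsilon> \<eta>"
  shows "conv u \<eta> \<in> test_fun UNIV"
proof (rule test_funI[of _ "cball 0 (R + \<epsilon>)"])
  fix x :: 'a assume x: "x \<notin> cball 0 (R + \<epsilon>)"
  have "u y = 0" if "norm (x - y) < \<epsilon>" for y
    using norm_triangle_ineq2[of x y] that x by (intro u(2)) simp
  then show "conv u \<eta> x = 0"
    by (intro conv_local[OF m]) (use borel_measurable_integrable[OF u(1)] in auto)
qed (use Ck_conv[OF u(1) mollifier_test_fun[OF m]] in auto)

text \<open>The integral of |g| is approached by pairing the gradient \<open>g\<close> with g / |g|.
  By duality this pairing equals one of \<open>u\<close> with a mollified field, to which the
  hypothesis on \<open>C\<close> applies.\<close>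

lemma integral_norm_grad_conv_le:
  fixes u :: "'a::euclidean_space \<Rightarrow> real"
  assumes u: "integrable lborel u" "\<And>x. R < norm x \<Longrightarrow> u x = 0" and m: "mollifier \<epsilon> \<eta>"
    and C: "\<And>\<phi>. \<phi> \<in> test_fun UNIV \<Longrightarrow> (\<And>x. norm (\<phi> x) \<le> 1) \<Longrightarrow> - (LINT x|lborel. u x * divergence \<phi> x) \<le> C"
  shows "(LINT x|lborel. norm (grad (conv u \<eta>) x)) \<le> C"
proof -
  define g where "g = grad (conv u \<eta>)"
  have g: "g \<in> test_fun UNIV" unfolding g_def by (rule grad_test_fun[OF conv_test_fun[OF u m]])
  obtain K where K: "\<And>k. Ck k g" "compact K" "K \<subseteq> UNIV" "\<And>x. x \<notin> K \<Longrightarrow> g x = 0"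
    using test_funE[OF g] by metis
  have gc: "continuous_on UNIV g" by (rule Ck_imp_continuous[OF K(1)])
  have Kf: "emeasure lborel K < \<infinity>" by (rule emeasure_bounded_finite[OF compact_imp_bounded[OF K(2)]])
  have Km: "K \<in> sets borel" using K(2) by (simp add: borel_compact)
  have "(LINT x|lborel. norm (g x)) - C \<le> 0"
  proof (rule le_all_multiples_imp_nonpos)
    fix \<delta> :: real assume \<delta>: "0 < \<delta>" "\<delta> \<le> 1"
    \<comment> \<open>Cutting off the denominator at \<delta> keeps the normalized gradient
      continuous at the zeros of \<open>g\<close>; the loss is at most \<delta> times the measure of
      \<open>K\<close>.\<close>
    define \<phi> where "\<phi> x = (1 / max \<delta> (norm (g x))) *\<^sub>R g x" for x
    have pc: "continuous_on UNIV \<phi>" unfolding \<phi>_def using \<delta>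
      by (intro continuous_intros gc) (auto simp: max_def)
    have pz: "x \<notin> K \<Longrightarrow> \<phi> x = 0" for x using K(4) by (simp add: \<phi>_def)
    note pi = continuous_compact_support_integrable[OF pc K(2) pz]
    have p1: "norm (\<phi> x) \<le> 1" for x
    proof -
      have "0 < max \<delta> (norm (g x))" using \<delta> by simp
      then show ?thesis by (simp add: \<phi>_def divide_le_eq_1)
    qed
    have pt: "conv \<phi> \<eta> \<in> test_fun UNIV"
    proof -
      obtain r where r: "\<And>x. x \<in> K \<Longrightarrow> norm x \<le> r" using compact_imp_bounded[OF K(2)] unfolding bounded_iff by blast
      show ?thesis
      proof (rule test_funI[of _ "cball 0 (r + \<epsilon>)"])
        fix x :: 'a assume x: "x \<notin> cball 0 (r + \<epsilon>)"
        have "\<phi> y = 0" if "norm (x - y) < \<epsilon>" for y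
          using norm_triangle_ineq2[of x y] that x r[of y] by (intro pz) auto
        then show "conv \<phi> \<eta> x = 0"
          by (intro conv_local[OF m]) (use borel_measurable_integrable[OF pi] in auto)
      qed (use Ck_conv[OF pi mollifier_test_fun[OF m]] in auto)
    qed
    have i: "integrable lborel (\<lambda>x. g x \<bullet> \<phi> x)"
      by (rule continuous_compact_support_integrable[OF _ K(2)])
         (auto intro!: continuous_intros gc pc simp: pz)
    have "(LINT x|lborel. norm (g x)) \<le> (LINT x|lborel. g x \<bullet> \<phi> x + indicator K x * \<delta>)"
    proof (rule integral_mono)
      show "integrable lborel (\<lambda>x. norm (g x))" using test_fun_integrable[OF g] by simp
      show "integrable lborel (\<lambda>x. g x \<bullet> \<phi> x + indicator K x * \<delta>)"
        using i Kf Km by auto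
      fix x
      show "norm (g x) \<le> g x \<bullet> \<phi> x + indicator K x * \<delta>"
      proof (cases "\<delta> \<le> norm (g x)")
        case True
        then have "g x \<bullet> \<phi> x = norm (g x)" using \<delta>
          by (simp add: \<phi>_def max_def power2_norm_eq_inner[symmetric] power2_eq_square)
        then show ?thesis using \<delta> by simp
      next
        case False
        then have "g x \<bullet> \<phi> x \<ge> 0" using \<delta> by (simp add: \<phi>_def)
        moreover have "norm (g x) \<le> indicator K x * \<delta>"
          using False K(4)[of x] by (cases "x \<in> K") auto
        ultimately show ?thesis by simp
      qed
    qed
    also have "\<dots> = (LINT x|lborel. g x \<bullet> \<phi> x) + measure lborel K * \<delta>"
      using i Kf Km by simp
    also have "(LINT x|lborel. g x \<bullet> \<phi> x) = - (LINT y|lborel. u y * divergence (conv \<phi> \<eta>) y)"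
      unfolding g_def by (rule grad_conv_duality[OF u(1) pi m])
    \<comment> \<open>\<open>\<phi>\<close> is merely continuous, but only
      \<open>conv \<phi> \<eta>\<close> is paired with \<open>u\<close>: it is smooth, compactly
      supported and still bounded by 1.\<close>
    also have "\<dots> \<le> C"
      by (rule C[OF pt conv_norm_le[OF m borel_measurable_integrable[OF pi, simplified] p1]])
    finally show "(LINT x|lborel. norm (g x)) - C \<le> measure lborel K * \<delta>" by simp
  qed
  then show ?thesis by (simp add: g_def)
qed

subsection \<open>The fundamental lemma and local constancy\<close>

lemma conv_L1_approx:
  fixes u :: "'a::euclidean_space \<Rightarrow> real"
  assumes u: "integrable lborel u" and e: "e > 0"
  obtains d where "d > 0" "\<And>\<epsilon> \<eta>. 0 < \<epsilon> \<Longrightarrow> \<epsilon> \<le> d \<Longrightarrow> mollifier \<epsilon> \<eta> \<Longrightarrow>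
     integrable lborel (conv u \<eta>) \<and> (LINT x|lborel. \<bar>conv u \<eta> x - u x\<bar>) \<le> e"
proof -
  obtain d where d: "d > 0" "\<And>z. norm z < d \<Longrightarrow> (LINT x|lborel. \<bar>u (x + z) - u x\<bar>) < e"
    using L1_translation_continuous[OF u e] by blast
  show ?thesis
    by (rule that[OF d(1)])
       (use conv_sub_norm_le[OF _ u, of _ _ e] d(2) in \<open>meson less_le_trans less_imp_le\<close>)
qed

text \<open>The exceptional sets of uncountably many neighbourhoods cannot simply be united; the
  Lindelof property leaves countably many.\<close>

lemma AE_locally:
  assumes "\<And>x. x \<in> U \<Longrightarrow> \<exists>V. open V \<and> x \<in> V \<and> (AE y in lborel. y \<in> V \<longrightarrow> P y)"
  shows "AE y in lborel. y \<in> (U::'a::euclidean_space set) \<longrightarrow> P y"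
proof -
  define F where "F = {V. open V \<and> (AE y in lborel. y \<in> V \<longrightarrow> P y)}"
  obtain F' where F': "F' \<subseteq> F" "countable F'" "\<Union>F' = \<Union>F"
    using Lindelof[of F] by (auto simp: F_def)
  have "AE y in lborel. \<forall>V\<in>F'. y \<in> V \<longrightarrow> P y"
    using F'(1) by (subst AE_ball_countable[OF F'(2)]) (auto simp: F_def)
  moreover have "U \<subseteq> \<Union>F'" using assms unfolding F'(3) by (auto simp: F_def)
  ultimately show ?thesis by (auto elim!: eventually_mono)
qed

lemma AE_open_ball_False:
  assumes "AE y in lborel. y \<notin> ball (x::'a::euclidean_space) r" shows "r \<le> 0"
proof (rule ccontr)
  assume "\<not> r \<le> 0"
  then have "measure lborel (ball x r) > 0" by (simp add: content_ball_pos)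
  moreover have "ball x r \<in> null_sets lborel" using assms by (subst AE_iff_null_sets) auto
  ultimately show False by (simp add: measure_eq_0_null_sets)
qed

lemma mollifier_diff_test_fun:
  fixes \<eta> :: "'a::euclidean_space \<Rightarrow> real"
  assumes "mollifier \<epsilon> \<eta>" "cball x \<epsilon> \<subseteq> U"
  shows "(\<lambda>y. \<eta> (x - y)) \<in> test_fun U"
proof (rule test_funI[of _ "cball x \<epsilon>"])
  show "Ck k (\<lambda>y. \<eta> (x - y))" for k
    using Ck_translation[OF test_fun_Ck[OF mollifier_test_fun[OF assms(1)]], of k "- x"]
    by (simp add: mollifier_sym[OF assms(1), of x])
  show "\<eta> (x - y) = 0" if "y \<notin> cball x \<epsilon>" for y
    by (rule mollifier_zero[OF assms(1)]) (use that in \<open>auto simp: dist_norm\<close>)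
qed (use assms in auto)

lemma frechet_derivative_mollifier_diff:
  fixes \<eta> :: "'a::euclidean_space \<Rightarrow> real"
  assumes "mollifier \<epsilon> \<eta>" "b \<in> Basis"
  shows "frechet_derivative (\<lambda>y. \<eta> (x - y)) (at y) b = - frechet_derivative \<eta> (at (x - y)) b"
proof -
  have "grad (\<lambda>y. \<eta> (x - y)) y = grad \<eta> (y + (- x))"
    using grad_translation[OF test_fun_Ck[OF mollifier_test_fun[OF assms(1)]], of "- x" y]
    by (simp add: mollifier_sym[OF assms(1), of x])
  also have "\<dots> = - grad \<eta> (x - y)" using mollifier_grad_odd[OF assms(1), of "x - y"] by simp
  finally show ?thesis using grad_inner_Basis[OF assms(2)] by (metis inner_minus_left)
qed

text \<open>The value of a mollification at \<open>x\<close> is the integral of the function against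
  the test function \<open>\<eta> (x - y)\<close>, hence 0. Letting the radius shrink, the L1 limit
  vanishes too. The function is first cut off to a ball because it is only locally
  integrable.\<close>

lemma AE_zero_of_test_fun:
  fixes f :: "'a::euclidean_space \<Rightarrow> real"
  assumes U: "open U" and f: "\<And>K. compact K \<Longrightarrow> K \<subseteq> U \<Longrightarrow> integrable lborel (\<lambda>x. indicator K x * f x)"
    and t: "\<And>\<phi>. \<phi> \<in> test_fun U \<Longrightarrow> (LINT x|lborel. \<phi> x * f x) = 0"
  shows "AE x in lborel. x \<in> U \<longrightarrow> f x = 0"
proof (rule AE_locally)
  fix x0 assume "x0 \<in> U"
  then obtain r where r: "r > 0" "cball x0 r \<subseteq> U" using U open_contains_cball by blast
  define f' where "f' x = indicator (cball x0 r) x * f x" for x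
  have f': "integrable lborel f'" unfolding f'_def using f r by simp
  define B where "B = ball x0 (r/2)"
  have [measurable]: "B \<in> sets borel" unfolding B_def by simp
  have iB: "integrable lborel (\<lambda>x. indicator B x * \<bar>f' x\<bar>)"
    using integrable_mult_indicator[of B lborel "\<lambda>x. \<bar>f' x\<bar>"] f' by auto
  have le: "(LINT x|lborel. indicator B x * \<bar>f' x\<bar>) \<le> e" if e: "e > 0" for e
  proof -
    obtain d where d: "d > 0" "\<And>\<epsilon> \<eta>. 0 < \<epsilon> \<Longrightarrow> \<epsilon> \<le> d \<Longrightarrow> mollifier \<epsilon> \<eta> \<Longrightarrow>
     integrable lborel (conv f' \<eta>) \<and> (LINT x|lborel. \<bar>conv f' \<eta> x - f' x\<bar>) \<le> e"
      using conv_L1_approx[OF f' e] by blast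
    \<comment> \<open>With radius at most r/2, kernels centred in the half ball \<open>B\<close>
      stay inside \<open>cball x0 r\<close>, where \<open>f\<close> and its cut-off agree.\<close>
    define \<epsilon> where "\<epsilon> = min d (r/2)"
    have \<epsilon>: "0 < \<epsilon>" "\<epsilon> \<le> d" "\<epsilon> \<le> r/2" using d r by (auto simp: \<epsilon>_def)
    obtain \<eta> :: "'a \<Rightarrow> real" where m: "mollifier \<epsilon> \<eta>" using mollifier_exists[OF \<epsilon>(1)] by blast
    have z: "conv f' \<eta> x = 0" if "x \<in> B" for x
    proof -
      have sub: "cball x \<epsilon> \<subseteq> cball x0 r"
        using that \<epsilon> by (intro cball_subset_cball_iff[THEN iffD2]) (auto simp: B_def dist_commute)
      have "conv f' \<eta> x = (LINT y|lborel. \<eta> (x - y) * f y)"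
        unfolding conv_def f'_def
      proof (rule Bochner_Integration.integral_cong[OF refl])
        fix y show "\<eta> (x - y) *\<^sub>R (indicator (cball x0 r) y * f y) = \<eta> (x - y) * f y"
          using sub mollifier_zero[OF m, of "x - y"] by (cases "y \<in> cball x \<epsilon>") (auto simp: dist_norm)
      qed
      then show ?thesis using t[OF mollifier_diff_test_fun[OF m, of x]] sub r by auto
    qed
    have "(LINT x|lborel. indicator B x * \<bar>f' x\<bar>) \<le> (LINT x|lborel. \<bar>conv f' \<eta> x - f' x\<bar>)"
    proof (rule integral_mono[OF iB])
      show "integrable lborel (\<lambda>x. \<bar>conv f' \<eta> x - f' x\<bar>)" using d(2)[OF \<epsilon>(1,2) m] f' by auto
      show "indicator B x * \<bar>f' x\<bar> \<le> \<bar>conv f' \<eta> x - f' x\<bar>" for x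
        using z by (auto simp: indicator_def)
    qed
    then show ?thesis using d(2)[OF \<epsilon>(1,2) m] by auto
  qed
  have "(LINT x|lborel. indicator B x * \<bar>f' x\<bar>) \<le> 0"
    by (rule field_le_epsilon) (use le in simp)
  moreover have "(LINT x|lborel. indicator B x * \<bar>f' x\<bar>) \<ge> 0" by simp
  ultimately have "AE x in lborel. indicator B x * \<bar>f' x\<bar> = 0"
    using integral_nonneg_eq_0_iff_AE[OF iB] by simp
  then have "AE x in lborel. x \<in> B \<longrightarrow> f x = 0"
    by eventually_elim (use r in \<open>auto simp: B_def f'_def indicator_def split: if_splits\<close>)
  then show "\<exists>V. open V \<and> x0 \<in> V \<and> (AE y in lborel. y \<in> V \<longrightarrow> f y = 0)"
    using r by (intro exI[of _ B]) (auto simp: B_def)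
qed

text \<open>On the half ball every mollification of small radius has zero derivative, since its
  partial derivatives are integrals of \<open>u\<close> against derivatives of test functions on
  \<open>S\<close>. So \<open>u\<close> is an L1 limit of constants there.\<close>

lemma AE_const_on_ball:
  fixes u :: "'a::euclidean_space \<Rightarrow> real"
  assumes u: "integrable lborel u" and r: "r > 0" "cball x0 r \<subseteq> S"
    and t: "\<And>\<psi> b. \<psi> \<in> test_fun S \<Longrightarrow> b \<in> Basis \<Longrightarrow> (LINT x|lborel. u x * frechet_derivative \<psi> (at x) b) = 0"
  obtains k where "AE y in lborel. y \<in> ball x0 (r/2) \<longrightarrow> u y = k"
proof -
  define B where "B = ball x0 (r/2)"
  have [measurable]: "B \<in> sets borel" unfolding B_def by simp
  have Bf: "emeasure lborel B < \<infinity>" unfolding B_def by (rule emeasure_bounded_finite) simp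
  have Bp: "measure lborel B > 0" using r by (simp add: B_def content_ball_pos)
  \<comment> \<open>The mean over \<open>B\<close> is the only possible constant and does not depend
    on the scale. It differs from the constant of any single mollification by at most the error
    divided by the measure of \<open>B\<close>.\<close>
  define k where "k = (LINT x|lborel. indicator B x * u x) / measure lborel B"
  have iB: "integrable lborel (\<lambda>x. indicator B x * f x)" if "integrable lborel f" for f :: "'a \<Rightarrow> real"
    using integrable_mult_indicator[of B lborel f] that by auto
  have iBc: "integrable lborel (\<lambda>x. indicator B x * c)" for c :: real using Bf by auto
  have iuc: "integrable lborel (\<lambda>x. indicator B x * \<bar>u x - c\<bar>)" for c
    using integrable_abs[OF Bochner_Integration.integrable_diff[OF iB[OF u] iBc[of c]]]
    by (rule Bochner_Integration.integrable_bound) (auto simp: indicator_def intro!: borel_measurable_times borel_measurable_abs borel_measurable_diff borel_measurable_integrable[OF u, simplified])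
  have le: "(LINT x|lborel. indicator B x * \<bar>u x - k\<bar>) \<le> 2 * e" if e: "e > 0" for e
  proof -
    obtain d where d: "d > 0" "\<And>\<epsilon> \<eta>. 0 < \<epsilon> \<Longrightarrow> \<epsilon> \<le> d \<Longrightarrow> mollifier \<epsilon> \<eta> \<Longrightarrow>
     integrable lborel (conv u \<eta>) \<and> (LINT x|lborel. \<bar>conv u \<eta> x - u x\<bar>) \<le> e"
      using conv_L1_approx[OF u e] by blast
    define \<epsilon> where "\<epsilon> = min d (r/2)"
    have \<epsilon>: "0 < \<epsilon>" "\<epsilon> \<le> d" "\<epsilon> \<le> r/2" using d r by (auto simp: \<epsilon>_def)
    obtain \<eta> :: "'a \<Rightarrow> real" where m: "mollifier \<epsilon> \<eta>" using mollifier_exists[OF \<epsilon>(1)] by blast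
    note \<eta> = mollifier_test_fun[OF m]
    have z: "conv u (\<lambda>x. frechet_derivative \<eta> (at x) b) x = 0" if x: "x \<in> B" and b: "b \<in> Basis" for x b
    proof -
      have sub: "cball x \<epsilon> \<subseteq> cball x0 r"
        using x \<epsilon> by (intro cball_subset_cball_iff[THEN iffD2]) (auto simp: B_def dist_commute)
      then have "(LINT y|lborel. u y * frechet_derivative (\<lambda>y. \<eta> (x - y)) (at y) b) = 0"
        using r by (intro t mollifier_diff_test_fun[OF m] b) auto
      then show ?thesis
        unfolding frechet_derivative_mollifier_diff[OF m b] by (simp add: conv_def mult.commute)
    qed
    have "\<exists>c. \<forall>x\<in>B. conv u \<eta> x = c"
    proof (rule has_derivative_zero_constant)
      show "convex B" unfolding B_def by simp
      fix x assume x: "x \<in> B"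
      have "(conv u \<eta> has_derivative (\<lambda>h. 0)) (at x)"
        using conv_has_derivative[OF u \<eta>, of x] z[OF x] by simp
      then show "(conv u \<eta> has_derivative (\<lambda>h. 0)) (at x within B)" by (rule has_derivative_at_withinI)
    qed
    then obtain c where c: "\<And>x. x \<in> B \<Longrightarrow> conv u \<eta> x = c" by auto
    have 1: "(LINT x|lborel. indicator B x * \<bar>u x - c\<bar>) \<le> e"
    proof -
      have "(LINT x|lborel. indicator B x * \<bar>u x - c\<bar>) \<le> (LINT x|lborel. \<bar>conv u \<eta> x - u x\<bar>)"
      proof (rule integral_mono[OF iuc])
        show "integrable lborel (\<lambda>x. \<bar>conv u \<eta> x - u x\<bar>)" using d(2)[OF \<epsilon>(1,2) m] u by auto
        show "indicator B x * \<bar>u x - c\<bar> \<le> \<bar>conv u \<eta> x - u x\<bar>" for x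
          using c[of x] by (auto simp: indicator_def)
      qed
      then show ?thesis using d(2)[OF \<epsilon>(1,2) m] by auto
    qed
    have "\<bar>k - c\<bar> * measure lborel B = \<bar>(LINT x|lborel. indicator B x * u x) - measure lborel B * c\<bar>"
      using Bp by (simp add: k_def abs_mult[symmetric] field_simps)
    also have "\<dots> = \<bar>(LINT x|lborel. indicator B x * u x - indicator B x * c)\<bar>"
      using iB[OF u] iBc[of c] Bf by simp
    also have "\<dots> \<le> (LINT x|lborel. \<bar>indicator B x * u x - indicator B x * c\<bar>)"
      by (rule integral_abs_bound)
    also have "\<dots> = (LINT x|lborel. indicator B x * \<bar>u x - c\<bar>)"
      by (rule Bochner_Integration.integral_cong) (auto simp: indicator_def)
    finally have 2: "\<bar>k - c\<bar> * measure lborel B \<le> e" using 1 by simp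
    have "(LINT x|lborel. indicator B x * \<bar>u x - k\<bar>) \<le> (LINT x|lborel. indicator B x * \<bar>u x - c\<bar> + indicator B x * \<bar>k - c\<bar>)"
      by (rule integral_mono[OF iuc Bochner_Integration.integrable_add[OF iuc iBc]]) (auto simp: indicator_def)
    also have "\<dots> = (LINT x|lborel. indicator B x * \<bar>u x - c\<bar>) + \<bar>k - c\<bar> * measure lborel B"
      using iuc[of c] iBc[of "\<bar>k - c\<bar>"] Bf by simp
    finally show ?thesis using 1 2 by simp
  qed
  have "(LINT x|lborel. indicator B x * \<bar>u x - k\<bar>) \<le> 0"
    by (rule field_le_epsilon) (use le[of "_ / 2"] in simp)
  moreover have "(LINT x|lborel. indicator B x * \<bar>u x - k\<bar>) \<ge> 0" by simp
  ultimately have "AE x in lborel. indicator B x * \<bar>u x - k\<bar> = 0"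
    using integral_nonneg_eq_0_iff_AE[OF iuc] by simp
  then have "AE x in lborel. x \<in> B \<longrightarrow> u x = k" by eventually_elim (auto split: if_splits)
  then show ?thesis using that unfolding B_def by blast
qed

text \<open>The constants of two overlapping balls agree, since their intersection contains a ball
  and hence is not a null set. The result is a representative that is locally constant at every
  point, not just almost everywhere, and can therefore be followed along paths.\<close>

lemma AE_locally_constant:
  fixes u :: "'a::euclidean_space \<Rightarrow> real"
  assumes u: "integrable lborel u" and S: "open S"
    and t: "\<And>\<psi> b. \<psi> \<in> test_fun S \<Longrightarrow> b \<in> Basis \<Longrightarrow> (LINT x|lborel. u x * frechet_derivative \<psi> (at x) b) = 0"
  obtains c where "AE x in lborel. x \<in> S \<longrightarrow> u x = c x"
    "\<And>x. x \<in> S \<Longrightarrow> \<exists>r>0. ball x r \<subseteq> S \<and> (\<forall>y\<in>ball x r. c y = c x)"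
proof -
  have "\<exists>r k. r > 0 \<and> ball x r \<subseteq> S \<and> (AE y in lborel. y \<in> ball x r \<longrightarrow> u y = k)" if x: "x \<in> S" for x
  proof -
    obtain r where r: "r > 0" "cball x r \<subseteq> S" using x S open_contains_cball by blast
    obtain k where "AE y in lborel. y \<in> ball x (r/2) \<longrightarrow> u y = k"
      using AE_const_on_ball[OF u r t] by blast
    moreover have "ball x (r/2) \<subseteq> cball x r" using r by auto
    ultimately show ?thesis using r by (intro exI[of _ "r/2"] exI[of _ k]) auto
  qed
  then obtain r c where rc: "\<And>x. x \<in> S \<Longrightarrow> r x > 0" "\<And>x. x \<in> S \<Longrightarrow> ball x (r x) \<subseteq> S"
    "\<And>x. x \<in> S \<Longrightarrow> AE y in lborel. y \<in> ball x (r x) \<longrightarrow> u y = c x"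
    by metis
  have loc: "c y = c x" if x: "x \<in> S" and y: "y \<in> ball x (r x)" for x y
  proof (rule ccontr)
    assume ne: "c y \<noteq> c x"
    have yS: "y \<in> S" using rc(2)[OF x] y by auto
    have "open (ball x (r x) \<inter> ball y (r y))" "y \<in> ball x (r x) \<inter> ball y (r y)" using y rc(1)[OF yS] by auto
    then obtain s where s: "s > 0" "ball y s \<subseteq> ball x (r x) \<inter> ball y (r y)" using open_contains_ball by blast
    have "AE z in lborel. z \<notin> ball y s"
      using rc(3)[OF x] rc(3)[OF yS] by eventually_elim (use s ne in auto)
    then show False using AE_open_ball_False s(1) by fastforce
  qed
  show ?thesis
  proof (rule that)
    show "AE x in lborel. x \<in> S \<longrightarrow> u x = c x"
    proof (rule AE_locally)
      fix x assume x: "x \<in> S"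
      show "\<exists>V. open V \<and> x \<in> V \<and> (AE y in lborel. y \<in> V \<longrightarrow> u y = c y)"
      proof (intro exI conjI)
        show "AE y in lborel. y \<in> ball x (r x) \<longrightarrow> u y = c y"
          using rc(3)[OF x] by eventually_elim (use loc[OF x] in auto)
      qed (use rc(1)[OF x] in auto)
    qed
  qed (use rc loc in blast)
qed

subsection \<open>Directions of shift at the boundaries\<close>

text \<open>From points of \<open>A\<close> near \<open>p\<close>, a truncated cone with axis
  \<open>n\<close> stays in \<open>A\<close>. The single number \<open>r\<close> serves as size of
  the neighbourhood, bound on the step and aperture, which makes the condition monotone in
  \<open>r\<close> and easy to combine for two sets.\<close>

definition inward_cone :: "'a::euclidean_space set \<Rightarrow> 'a \<Rightarrow> 'a \<Rightarrow> real \<Rightarrow> bool" where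
  "inward_cone A p n r \<longleftrightarrow> (\<forall>x s z. x \<in> A \<longrightarrow> dist p x < r \<longrightarrow> 0 \<le> s \<longrightarrow> s \<le> r \<longrightarrow> norm z \<le> r * s \<longrightarrow>
     x + s *\<^sub>R n + z \<in> A)"

lemma inward_coneD:
  "inward_cone A p n r \<Longrightarrow> x \<in> A \<Longrightarrow> dist p x < r \<Longrightarrow> 0 \<le> s \<Longrightarrow> s \<le> r \<Longrightarrow> norm z \<le> r * s \<Longrightarrow>
     x + s *\<^sub>R n + z \<in> A"
  unfolding inward_cone_def by blast

lemma inward_cone_mono:
  fixes A :: "'a::euclidean_space set"
  assumes "inward_cone A p n r" "r' \<le> r" shows "inward_cone A p n r'"
  unfolding inward_cone_def
proof (intro allI impI)
  fix x z :: 'a and s :: real assume a: "x \<in> A" "dist p x < r'" "0 \<le> s" "s \<le> r'" "norm z \<le> r' * s"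
  show "x + s *\<^sub>R n + z \<in> A"
    by (rule inward_coneD[OF assms(1) a(1)]) (use a assms(2) mult_right_mono[OF assms(2) a(3)] in auto)
qed

lemma cone_in_ball:
  fixes n :: "'a::euclidean_space"
  assumes "norm n \<le> 1" "dist p x < r" "0 \<le> s" "s \<le> r" "norm z \<le> r * s" "r \<le> 1" "3 * r \<le> R"
  shows "x + s *\<^sub>R n + z \<in> ball p R"
proof -
  have "norm (s *\<^sub>R n) \<le> r" using assms mult_mono[of s r "norm n" 1] by simp
  moreover have "norm z \<le> r" using assms mult_mono[of r 1 s r] by simp
  ultimately have "norm (x + s *\<^sub>R n + z - p) < 3 * r"
    using norm_triangle_ineq[of "x - p" "s *\<^sub>R n + z"] norm_triangle_ineq[of "s *\<^sub>R n" z] assms(2)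
    by (simp add: dist_norm norm_minus_commute algebra_simps)
  then show ?thesis using assms(7) by (simp add: dist_norm norm_minus_commute)
qed

text \<open>Near a point that is not on the frontier, membership in \<open>A\<close> does not
  change, so every direction is admissible, in particular one dictated by another set.\<close>

lemma inward_cone_trivial:
  fixes n :: "'a::euclidean_space"
  assumes "ball p R \<subseteq> A \<or> ball p R \<inter> A = {}" "R > 0" "norm n \<le> 1"
  shows "inward_cone A p n (min 1 (R/3))"
  unfolding inward_cone_def
proof (intro allI impI)
  fix x z :: 'a and s :: real assume a: "x \<in> A" "dist p x < min 1 (R/3)" "0 \<le> s" "s \<le> min 1 (R/3)" "norm z \<le> min 1 (R/3) * s"
  have "x + s *\<^sub>R n + z \<in> ball p R"
    by (rule cone_in_ball[OF assms(3) a(2-5)]) auto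
  moreover have "x \<in> ball p R" using a(2) assms(2) by auto
  ultimately show "x + s *\<^sub>R n + z \<in> A" using assms(1) a(1) by auto
qed

text \<open>Being in \<open>U\<close> is an inequality between the height above the hyperplane and
  the Lipschitz function. A step along \<open>n\<close> improves it for \<open>U\<close>, and a step
  along \<open>- n\<close> improves the reverse inequality for the complement by the same
  estimate.\<close>

lemma inward_cone_graph:
  fixes n :: "'a::euclidean_space"
  assumes n: "norm n = 1" and R: "R > 0" and lip: "L-lipschitz_on UNIV \<gamma>"
    and U: "U \<inter> ball p R = {y \<in> ball p R. \<gamma> (y - (y \<bullet> n) *\<^sub>R n) < y \<bullet> n}"
  obtains r where "r > 0" "inward_cone U p n r" "inward_cone (- U) p (- n) r"
proof -
  define pr where "pr y = y - (y \<bullet> n) *\<^sub>R n" for y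
  have L: "L \<ge> 0" using lip by (rule lipschitz_on_nonneg)
  have nn: "n \<bullet> n = 1" using n by (simp add: norm_eq_1)
  \<comment> \<open>The first two bounds keep the cone inside \<open>ball p R\<close>, where the
    graph description holds. The third lets the height gained, s, outweigh both the loss r s caused
    by \<open>z\<close> and the possible change 2 L r s of \<gamma>.\<close>
  define r where "r = min (min 1 (R/3)) (1 / (2 * L + 1))"
  have r: "r > 0" "r \<le> 1" "3 * r \<le> R" using R L by (auto simp: r_def)
  have rL: "(2 * L + 1) * r \<le> 1"
  proof -
    have "(2 * L + 1) * r \<le> (2 * L + 1) * (1 / (2 * L + 1))" using L by (intro mult_left_mono) (auto simp: r_def)
    also have "\<dots> = 1" using L by simp
    finally show ?thesis .
  qed
  have est: "\<bar>\<gamma> (pr (x + a *\<^sub>R n + z)) - \<gamma> (pr x)\<bar> \<le> 2 * L * (r * s)" "\<bar>z \<bullet> n\<bar> \<le> r * s" "(2 * L + 1) * (r * s) \<le> s"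
    if z: "norm z \<le> r * s" and s: "0 \<le> s" for x z :: 'a and a s :: real
  proof -
    show zn: "\<bar>z \<bullet> n\<bar> \<le> r * s" using Cauchy_Schwarz_ineq2[of z n] n z by simp
    \<comment> \<open>The step along \<open>n\<close> is invisible to the projection, so only
      \<open>z\<close> changes the argument of \<gamma>; the factor 2 comes from the triangle
      inequality for its projection.\<close>
    have "pr (x + a *\<^sub>R n + z) - pr x = z - (z \<bullet> n) *\<^sub>R n"
      by (simp add: pr_def inner_add_left nn algebra_simps)
    then have "norm (pr (x + a *\<^sub>R n + z) - pr x) \<le> 2 * (r * s)"
      using norm_triangle_ineq4[of z "(z \<bullet> n) *\<^sub>R n"] zn z n by simp
    then show "\<bar>\<gamma> (pr (x + a *\<^sub>R n + z)) - \<gamma> (pr x)\<bar> \<le> 2 * L * (r * s)"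
      using lipschitz_onD[OF lip, of "pr (x + a *\<^sub>R n + z)" "pr x"]
        mult_left_mono[OF \<open>norm (pr (x + a *\<^sub>R n + z) - pr x) \<le> 2 * (r * s)\<close> L]
      by (simp add: dist_norm)
    show "(2 * L + 1) * (r * s) \<le> s" using mult_right_mono[OF rL s] by (simp add: mult.assoc)
  qed
  have mem: "y \<in> U \<longleftrightarrow> \<gamma> (pr y) < y \<bullet> n" if "y \<in> ball p R" for y
    using U that unfolding pr_def by blast
  have xb: "x \<in> ball p R" if "dist p x < r" for x using that r by auto
  show ?thesis
  proof (rule that[OF r(1)])
    show "inward_cone U p n r" unfolding inward_cone_def
    proof (intro allI impI)
      fix x z :: 'a and s :: real assume a: "x \<in> U" "dist p x < r" "0 \<le> s" "s \<le> r" "norm z \<le> r * s"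
      have b: "x + s *\<^sub>R n + z \<in> ball p R"
        by (rule cone_in_ball[OF _ a(2-5) r(2,3)]) (simp add: n)
      have "\<gamma> (pr x) < x \<bullet> n" using mem[OF xb[OF a(2)]] a(1) by simp
      then have "\<gamma> (pr (x + s *\<^sub>R n + z)) < (x + s *\<^sub>R n + z) \<bullet> n"
        using est(1)[OF a(5,3), of x s] est(2,3)[OF a(5,3)] by (simp add: inner_add_left nn algebra_simps)
      then show "x + s *\<^sub>R n + z \<in> U" using mem[OF b] by simp
    qed
    show "inward_cone (- U) p (- n) r" unfolding inward_cone_def
    proof (intro allI impI)
      fix x z :: 'a and s :: real assume a: "x \<in> - U" "dist p x < r" "0 \<le> s" "s \<le> r" "norm z \<le> r * s"
      have b: "x + s *\<^sub>R (- n) + z \<in> ball p R"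
        by (rule cone_in_ball[OF _ a(2-5) r(2,3)]) (simp add: n)
      have "\<gamma> (pr x) \<ge> x \<bullet> n" using mem[OF xb[OF a(2)]] a(1) by simp
      then have "\<gamma> (pr (x + s *\<^sub>R (- n) + z)) \<ge> (x + s *\<^sub>R (- n) + z) \<bullet> n"
        using est(1)[OF a(5,3), of x "- s"] est(2,3)[OF a(5,3)] by (simp add: inner_add_left inner_diff_left nn algebra_simps)
      then show "x + s *\<^sub>R (- n) + z \<in> - U" using mem[OF b] by simp
    qed
  qed
qed

lemma strongly_lipschitz_open: "strongly_lipschitz U \<Longrightarrow> open U"
  by (simp add: strongly_lipschitz_def)

lemma strongly_lipschitz_inward_cone:
  assumes "strongly_lipschitz U" "p \<in> frontier U"
  obtains n r where "norm n = 1" "r > 0" "inward_cone U p n r" "inward_cone (- U) p (- n) r"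
proof -
  have "\<exists>n r L \<gamma>. norm n = 1 \<and> 0 < r \<and> L-lipschitz_on UNIV \<gamma> \<and>
        U \<inter> ball p r = {y \<in> ball p r. \<gamma> (y - (y \<bullet> n) *\<^sub>R n) < y \<bullet> n}"
    using assms unfolding strongly_lipschitz_def by simp
  then obtain n R L \<gamma> where g: "norm n = 1" "0 < R" "L-lipschitz_on UNIV \<gamma>"
     "U \<inter> ball p R = {y \<in> ball p R. \<gamma> (y - (y \<bullet> n) *\<^sub>R n) < y \<bullet> n}"
    by (elim exE conjE)
  show ?thesis by (rule inward_cone_graph[OF g]) (rule that[OF g(1)])
qed

lemma not_frontier_ball:
  assumes "p \<notin> frontier (A::'a::euclidean_space set)"
  obtains R where "R > 0" "ball p R \<subseteq> A \<or> ball p R \<inter> A = {}"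
proof (cases "p \<in> interior A")
  case True
  then show ?thesis using that mem_interior by metis
next
  case False
  then have "p \<notin> closure A" using assms by (simp add: frontier_def)
  then obtain R where "R > 0" "ball p R \<subseteq> - closure A"
    using open_contains_ball[of "- closure A"] by (auto simp: open_Compl)
  then show ?thesis using that[of R] closure_subset[of A] by blast
qed

text \<open>Near any point at most one of the two boundaries is present, so that one direction serves
  both the solid and the exterior.\<close>

lemma common_inward_cone:
  fixes \<Omega> S :: "'a::euclidean_space set"
  assumes "strongly_lipschitz \<Omega>" "strongly_lipschitz S" "frontier S \<inter> frontier \<Omega> = {}"
  shows "\<exists>n r. norm n \<le> 1 \<and> r > 0 \<and> inward_cone S p n r \<and> inward_cone (- \<Omega>) p n r"
proof -
  have comb: ?thesis if "norm n \<le> 1" "r > 0" "r' > 0" "inward_cone S p n r" "inward_cone (- \<Omega>) p n r'" for n r r'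
    using that inward_cone_mono[OF that(4), of "min r r'"] inward_cone_mono[OF that(5), of "min r r'"]
    by (intro exI[of _ n] exI[of _ "min r r'"]) auto
  consider "p \<in> frontier S" | "p \<in> frontier \<Omega>" | "p \<notin> frontier S" "p \<notin> frontier \<Omega>" by blast
  then show ?thesis
  proof cases
    case 1
    then have "p \<notin> frontier (- \<Omega>)" using assms(3) by (auto simp: frontier_complement)
    then obtain R where R: "R > 0" "ball p R \<subseteq> - \<Omega> \<or> ball p R \<inter> - \<Omega> = {}" by (rule not_frontier_ball)
    obtain n r where n: "norm n = 1" "r > 0" "inward_cone S p n r"
      using strongly_lipschitz_inward_cone[OF assms(2) 1] by metis
    show ?thesis
      by (rule comb[OF _ n(2) _ n(3) inward_cone_trivial[OF R(2,1)]]) (use n R in auto)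
  next
    case 2
    then have "p \<notin> frontier S" using assms(3) by auto
    then obtain R where R: "R > 0" "ball p R \<subseteq> S \<or> ball p R \<inter> S = {}" by (rule not_frontier_ball)
    \<comment> \<open>The graph direction leads into \<Omega>; its negative is chosen, since the
      shifted argument has to leave \<Omega>.\<close>
    obtain n r where n: "norm n = 1" "r > 0" "inward_cone (- \<Omega>) p (- n) r"
      using strongly_lipschitz_inward_cone[OF assms(1) 2] by metis
    show ?thesis
      by (rule comb[OF _ _ n(2) inward_cone_trivial[OF R(2,1)] n(3)]) (use n R in auto)
  next
    case 3
    obtain R where R: "R > 0" "ball p R \<subseteq> S \<or> ball p R \<inter> S = {}" using not_frontier_ball[OF 3(1)] by metis
    obtain R' where R': "R' > 0" "ball p R' \<subseteq> - \<Omega> \<or> ball p R' \<inter> - \<Omega> = {}"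
      using not_frontier_ball[of p "- \<Omega>"] 3(2) unfolding frontier_complement by metis
    \<comment> \<open>Away from both frontiers no shift is called for, and the direction 0 is
      taken.\<close>
    show ?thesis
      by (rule comb[OF _ _ _ inward_cone_trivial[OF R(2,1)] inward_cone_trivial[OF R'(2,1)], of 0]) (use R R' in auto)
  qed
qed

subsection \<open>A smooth partition of unity\<close>

text \<open>Instead of dividing bump functions by their sum, a finite Borel partition subordinate to
  the cover is mollified. Convolution is linear and preserves bounds and constants, so the sum is
  controlled without any quotient.\<close>

lemma smooth_partition_of_unity:
  fixes r :: "'a::euclidean_space \<Rightarrow> real" and R :: real
  assumes r: "\<And>p. r p > 0"
  obtains m :: nat and p :: "nat \<Rightarrow> 'a" and \<zeta> :: "nat \<Rightarrow> 'a \<Rightarrow> real" where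
    "\<And>i. \<zeta> i \<in> test_fun UNIV" "\<And>i x. 0 \<le> \<zeta> i x"
    "\<And>i x. i < m \<Longrightarrow> \<zeta> i x \<noteq> 0 \<Longrightarrow> dist (p i) x < r (p i)"
    "\<And>x. norm x < R \<Longrightarrow> (\<Sum>i<m. \<zeta> i x) = 1"
    "\<And>x. (\<Sum>i<m. \<zeta> i x) \<le> 1"
proof -
  \<comment> \<open>The additional unit is room for the mollification radius, which is at most 1; it
    makes the sum equal to 1 on the whole ball of radius \<open>R\<close>.\<close>
  define K where "K = cball (0::'a) (R + 1)"
  have K: "compact K" by (simp add: K_def)
  have cov: "K \<subseteq> (\<Union>q\<in>K. ball q (r q))" using r by force
  obtain P where P: "P \<subseteq> K" "finite P" "K \<subseteq> (\<Union>q\<in>P. ball q (r q))"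
    using compactE_image[OF K _ cov] by auto
  obtain e where e: "e > 0" "\<And>x. x \<in> K \<Longrightarrow> \<exists>G\<in>(\<lambda>q. ball q (r q)) ` P. ball x e \<subseteq> G"
    using Heine_Borel_lemma[OF K, of "(\<lambda>q. ball q (r q)) ` P"] P(3) by auto
  obtain xs where xs: "set xs = P" using finite_list[OF P(2)] by blast
  define m where "m = length xs"
  define p where "p i = xs ! i" for i
  \<comment> \<open>\<open>e\<close> is a Lebesgue number of the cover. Balls shrunk by
    \<open>e\<close> still cover \<open>K\<close>, and mollifying at a scale of at most
    \<open>e\<close> does not leave the original balls.\<close>
  define A where "A i = K \<inter> cball (p i) (r (p i) - e)" for i
  have Acov: "(\<Union>i\<in>{0..<m}. A i) = K"
  proof
    show "K \<subseteq> (\<Union>i\<in>{0..<m}. A i)"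
    proof
      fix x assume x: "x \<in> K"
      then obtain q where q: "q \<in> P" "ball x e \<subseteq> ball q (r q)" using e(2) by blast
      then obtain i where i: "i < m" "q = p i" using xs by (auto simp: in_set_conv_nth m_def p_def)
      have "dist x q + e \<le> r q" using q(2) e(1) by (simp add: ball_subset_ball_iff)
      then have "x \<in> A i" using x i by (simp add: A_def dist_commute)
      then show "x \<in> (\<Union>i\<in>{0..<m}. A i)" using i by auto
    qed
  qed (auto simp: A_def)
  define D where "D i = disjointed A i" for i
  have DA: "D i \<subseteq> A i" for i unfolding D_def by (rule disjointed_subset)
  have Ab: "range A \<subseteq> sets borel" by (auto simp: A_def K_def)
  have Dm: "D i \<in> sets borel" for i
    unfolding D_def using sets.range_disjointed_sets[OF Ab] by auto
  have DK: "D i \<subseteq> K" for i using DA by (auto simp: A_def)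
  have Dfin: "emeasure lborel (D i) < \<infinity>" for i
    by (rule emeasure_bounded_finite[OF bounded_subset[OF compact_imp_bounded[OF K] DK]])
  have iD: "integrable lborel (indicat_real (D i))" for i using Dfin Dm by (simp add: integrable_indicator_iff)
  have sumD: "(\<Sum>i<m. indicat_real (D i) x) = indicat_real K x" for x
  proof -
    have "indicat_real (\<Union>i\<in>{0..<m}. D i) x = (\<Sum>i\<in>{0..<m}. indicat_real (D i) x)"
      by (rule indicator_UN_disjoint)
         (use disjoint_family_disjointed[of A] in \<open>auto simp: D_def intro: disjoint_family_on_mono\<close>)
    moreover have "(\<Union>i\<in>{0..<m}. D i) = K" unfolding D_def finite_UN_disjointed_eq Acov ..
    ultimately show ?thesis by (simp add: lessThan_atLeast0)
  qed
  define \<delta> where "\<delta> = min e 1"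
  have \<delta>: "0 < \<delta>" "\<delta> \<le> e" "\<delta> \<le> 1" using e by (auto simp: \<delta>_def)
  obtain \<eta> :: "'a \<Rightarrow> real" where h: "mollifier \<delta> \<eta>" using mollifier_exists[OF \<delta>(1)] by blast
  note \<eta> = mollifier_test_fun[OF h]
  define \<zeta> where "\<zeta> i = conv (indicat_real (D i)) \<eta>" for i
  have sum: "(\<Sum>i<m. \<zeta> i x) = conv (indicat_real K) \<eta> x" for x
  proof -
    have "(\<Sum>i<m. \<zeta> i x) = (LINT y|lborel. (\<Sum>i<m. \<eta> (x - y) *\<^sub>R indicat_real (D i) y))"
      unfolding \<zeta>_def conv_def
      by (rule Bochner_Integration.integral_sum[symmetric]) (rule conv_integrable[OF iD \<eta>])
    also have "\<dots> = conv (indicat_real K) \<eta> x"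
      unfolding conv_def by (simp only: scaleR_sum_right[symmetric] sumD)
    finally show ?thesis .
  qed
  have Kb: "K \<in> sets borel" by (simp add: K_def)
  show ?thesis
  proof (rule that)
    show "\<zeta> i \<in> test_fun UNIV" for i
      unfolding \<zeta>_def by (rule conv_test_fun[OF iD _ h, of "R + 1"]) (use DK[of i] in \<open>auto simp: K_def subset_eq indicator_def\<close>)
    show "0 \<le> \<zeta> i x" for i x
      unfolding \<zeta>_def conv_def using mollifier_nonneg[OF h] by simp
    show "dist (p i) x < r (p i)" if "i < m" "\<zeta> i x \<noteq> 0" for i x
    proof -
      have "\<exists>y. norm (x - y) < \<delta> \<and> y \<in> D i"
      proof (rule ccontr)
        assume "\<not> ?thesis"
        then have "\<zeta> i x = 0" unfolding \<zeta>_def using Dm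
          by (intro conv_local[OF h]) (auto simp: indicator_def)
        with that show False by simp
      qed
      then obtain y where "norm (x - y) < \<delta>" "y \<in> A i" using DA by blast
      then show ?thesis using \<delta> dist_triangle[of "p i" x y] by (simp add: A_def dist_norm norm_minus_commute)
    qed
    show "(\<Sum>i<m. \<zeta> i x) = 1" if "norm x < R" for x
      unfolding sum
    proof (rule conv_local[OF h])
      have "y \<in> K" if "norm (x - y) < \<delta>" for y
        using norm_triangle_ineq4[of x "x - y"] that \<open>norm x < R\<close> \<delta> by (simp add: K_def)
      then show "AE y in lborel. norm (x - y) < \<delta> \<longrightarrow> indicat_real K y = 1" by simp
    qed (use Kb in simp)
    show "(\<Sum>i<m. \<zeta> i x) \<le> 1" for x
      using conv_norm_le[OF h, of "indicat_real K" 1 x] Kb unfolding sum by (simp add: indicator_def)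
  qed
qed

subsection \<open>Approximation by admissible test functions\<close>

lemma test_fun_times_integrable:
  fixes f :: "'a::euclidean_space \<Rightarrow> 'b::euclidean_space"
  assumes "integrable lborel f" "\<zeta> \<in> test_fun U"
  shows "integrable lborel (\<lambda>x. \<zeta> x *\<^sub>R f x)"
proof -
  obtain B where B: "B > 0" "\<And>x. norm (\<zeta> x) \<le> B" using test_fun_bounded[OF assms(2)] by blast
  note [measurable] = test_fun_measurable[OF assms(2)] borel_measurable_integrable[OF assms(1)]
  show ?thesis
  proof (rule Bochner_Integration.integrable_bound[of _ "\<lambda>y. B *\<^sub>R f y"])
    show "integrable lborel (\<lambda>y. B *\<^sub>R f y)" using assms(1) by simp
    show "AE y in lborel. norm (\<zeta> y *\<^sub>R f y) \<le> norm (B *\<^sub>R f y)"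
      using B by (intro AE_I2) (auto intro!: mult_right_mono)
  qed measurable
qed

lemma locally_constant_segment:
  assumes "\<And>x. x \<in> S \<Longrightarrow> \<exists>r>0. ball x r \<subseteq> S \<and> (\<forall>y\<in>ball x r. c y = c x)"
    and "closed_segment a b \<subseteq> (S :: 'a::euclidean_space set)"
  shows "c b = c a"
proof (rule connected_local_const[of "closed_segment a b"])
  show "\<forall>x\<in>closed_segment a b. \<forall>\<^sub>F y in at x within closed_segment a b. c x = c y"
  proof
    fix x assume "x \<in> closed_segment a b"
    then have "x \<in> S" using assms(2) by (rule rev_subsetD)
    then obtain r where r: "r > 0" "\<And>y. y \<in> ball x r \<Longrightarrow> c y = c x" using assms(1) by metis
    have "c x = c y" if "dist y x < r" for y using r(2)[of y] that by (simp add: dist_commute)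
    with r(1) show "\<forall>\<^sub>F y in at x within closed_segment a b. c x = c y"
      unfolding eventually_at by metis
  qed
qed auto

lemma Ck_lincomb_mult:
  assumes "\<And>i. Ck k (\<zeta> i)" "\<And>i. Ck k (v i)"
  shows "Ck k (\<lambda>x. \<Sum>i\<in>I. \<zeta> i x * v i x :: real)"
  by (intro Ck_sum Ck_mult assms)

text \<open>The approximation is \<open>w = \<Sum>i. \<zeta> i * (u * \<eta>) (\<cdot> + t n i)\<close>. The radius of the mollifier
  is proportional to \<open>t\<close>, so that near a boundary only values of \<open>u\<close> from one side of it are
  averaged.\<close>

lemma smooth_approximation:
  fixes \<Omega> S :: "'a::euclidean_space set" and u :: "'a \<Rightarrow> real"
  assumes Om: "bounded \<Omega>" "open \<Omega>" and S: "open S" "S \<subseteq> \<Omega>"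
    and cone: "\<And>p. \<exists>n r. norm n \<le> 1 \<and> r > 0 \<and> inward_cone S p n r \<and> inward_cone (- \<Omega>) p n r"
    and u: "integrable lborel u" "\<And>x. x \<notin> \<Omega> \<Longrightarrow> u x = 0"
    and C: "\<And>\<phi>. \<phi> \<in> test_fun UNIV \<Longrightarrow> (\<And>x. norm (\<phi> x) \<le> 1) \<Longrightarrow> - (LINT x|lborel. u x * divergence \<phi> x) \<le> C"
    and grad0: "\<And>\<psi> b. \<psi> \<in> test_fun S \<Longrightarrow> b \<in> Basis \<Longrightarrow> (LINT x|lborel. u x * frechet_derivative \<psi> (at x) b) = 0"
    and e: "e > 0"
  obtains w where "w \<in> test_fun \<Omega>" "\<And>x. x \<in> S \<Longrightarrow> grad w x = 0"
    "(LINT x|lborel. \<bar>w x - u x\<bar>) \<le> e" "(LINT x|lborel. norm (grad w x)) \<le> C + e"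
proof -
  obtain R where R: "\<And>x. x \<in> \<Omega> \<Longrightarrow> norm x < R"
    using Om(1) unfolding bounded_pos_less by blast
  have uR: "u x = 0" if "R < norm x" for x using u(2) R that by force
  have "\<exists>N r. \<forall>p. norm (N p) \<le> 1 \<and> r p > 0 \<and> inward_cone S p (N p) (r p) \<and> inward_cone (- \<Omega>) p (N p) (r p)"
    using cone by metis
  then obtain N r where Nr: "\<And>p. norm (N p :: 'a) \<le> 1" "\<And>p. r p > 0"
    "\<And>p. inward_cone S p (N p) (r p)" "\<And>p. inward_cone (- \<Omega>) p (N p) (r p)"
    by blast
  \<comment> \<open>The supports get half the admissible radius, so that points within \<rho>/2 of a
    support still lie in the neighbourhood where the cone property holds.\<close>
  obtain m :: nat and p :: "nat \<Rightarrow> 'a" and \<zeta> :: "nat \<Rightarrow> 'a \<Rightarrow> real" where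
    \<zeta>: "\<And>i. \<zeta> i \<in> test_fun UNIV" "\<And>i x. 0 \<le> \<zeta> i x"
    "\<And>i x. i < m \<Longrightarrow> \<zeta> i x \<noteq> 0 \<Longrightarrow> dist (p i) x < r (p i) / 2"
    "\<And>x. norm x < R \<Longrightarrow> (\<Sum>i<m. \<zeta> i x) = 1"
    "\<And>x. (\<Sum>i<m. \<zeta> i x) \<le> 1"
    using smooth_partition_of_unity[of "\<lambda>p. r p / 2" R] Nr(2) half_gt_zero by metis
  have \<zeta>1: "\<zeta> i x \<le> 1" if "i < m" for i x
    using member_le_sum[of i "{..<m}" "\<lambda>i. \<zeta> i x"] \<zeta>(2) \<zeta>(5)[of x] that by simp
  have "\<exists>M. M > 0 \<and> (\<forall>x y. \<bar>\<zeta> i x - \<zeta> i y\<bar> \<le> M * norm (x - y)) \<and> (\<forall>x. norm (grad (\<zeta> i) x) \<le> M)" for i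
  proof -
    obtain M1 where M1: "M1 > 0" "\<And>x y. \<bar>\<zeta> i x - \<zeta> i y\<bar> \<le> M1 * norm (x - y)"
      using test_fun_lipschitz[OF \<zeta>(1)] by blast
    obtain M2 where M2: "M2 > 0" "\<And>x. norm (grad (\<zeta> i) x) \<le> M2"
      using test_fun_bounded[OF grad_test_fun[OF \<zeta>(1)]] by blast
    have "\<bar>\<zeta> i x - \<zeta> i y\<bar> \<le> (M1 + M2) * norm (x - y)" for x y
      using M1(2)[of x y] M2(1) by (simp add: ring_distribs add_increasing2)
    moreover have "norm (grad (\<zeta> i) x) \<le> M1 + M2" for x using M2(2)[of x] M1(1) by linarith
    ultimately show ?thesis using M1 M2 by (intro exI[of _ "M1 + M2"]) auto
  qed
  then obtain Mi where Mi: "\<And>i. Mi i > 0" "\<And>i x y. \<bar>\<zeta> i x - \<zeta> i y\<bar> \<le> Mi i * norm (x - y)"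
    "\<And>i x. norm (grad (\<zeta> i) x) \<le> Mi i" by metis
  define M where "M = (\<Sum>i<m. Mi i)"
  have M0: "M \<ge> 0" unfolding M_def using Mi(1) by (simp add: sum_nonneg less_imp_le)
  \<comment> \<open>Inserting 1 makes the minimum meaningful for \<open>m = 0\<close> and ensures
    that \<rho> is at most 1.\<close>
  define \<rho> where "\<rho> = Min (insert 1 ((\<lambda>i. r (p i)) ` {..<m}))"
  have \<rho>: "\<rho> > 0" "\<rho> \<le> 1" "\<And>i. i < m \<Longrightarrow> \<rho> \<le> r (p i)"
    using Nr(2) by (auto simp: \<rho>_def)
  have C0: "C \<ge> 0" using C[of "\<lambda>_. 0"] by (simp add: test_fun_def Ck_const divergence_def frechet_derivative_const)
  \<comment> \<open>Each shifted mollification is within 2 e' of \<open>u\<close> in L1. Then 2 m e'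
    is at most \<open>e\<close>, and 2 M e' at most e/2, which bounds the terms with gradients of
    weights.\<close>
  define e' where "e' = e / (4 * (M + real m + 1))"
  have e': "e' > 0" using e M0 by (simp add: e'_def)
  obtain d where d: "d > 0" "\<And>z. norm z < d \<Longrightarrow> (LINT x|lborel. \<bar>u (x + z) - u x\<bar>) < e'"
    using L1_translation_continuous[OF u(1) e'] by blast
  \<comment> \<open>The three bounds: \<open>t\<close> is an admissible step in every cone,
    translation by \<open>t\<close> is small in L1, and moving the weights by \<open>t\<close> costs
    at most e/2 of gradient mass.\<close>
  define t where "t = min (min \<rho> (d/2)) (e / (2 * (C * M + 1)))"
  have CM: "C * M \<ge> 0" using C0 M0 by simp
  have t: "t > 0" "t \<le> \<rho>" "t < d" "t * (C * M) \<le> e/2"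
  proof -
    show "t > 0" "t \<le> \<rho>" "t < d" using \<rho> d(1) e CM by (auto simp: t_def)
    have "t * (C * M) \<le> (e / (2 * (C * M + 1))) * (C * M + 1)"
      using CM \<open>t > 0\<close> e by (intro mult_mono) (auto simp: t_def)
    also have "\<dots> = e / 2" using CM by (simp add: field_simps)
    finally show "t * (C * M) \<le> e/2" .
  qed
  \<comment> \<open>Two deviations of size \<epsilon> occur, the radius of the mollifier and the
    distance to a nearby reference point. Their sum \<open>\<rho> * t\<close> fits into the aperture
    of every cone at step \<open>t\<close>.\<close>
  define \<epsilon> where "\<epsilon> = \<rho> * t / 2"
  have \<epsilon>: "\<epsilon> > 0" "\<epsilon> \<le> t / 2" "\<epsilon> < d" "\<epsilon> + \<epsilon> = \<rho> * t" "\<epsilon> \<le> \<rho> / 2"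
  proof -
    have "\<rho> * t \<le> t" "\<rho> * t \<le> \<rho>" "0 < \<rho> * t"
      using \<rho> t mult_right_mono[of \<rho> 1 t] mult_left_mono[of t 1 \<rho>] by auto
    then show "\<epsilon> > 0" "\<epsilon> \<le> t / 2" "\<epsilon> < d" "\<epsilon> + \<epsilon> = \<rho> * t" "\<epsilon> \<le> \<rho> / 2"
      using t(1,3) unfolding \<epsilon>_def by linarith+
  qed
  obtain \<eta> :: "'a \<Rightarrow> real" where h: "mollifier \<epsilon> \<eta>" using mollifier_exists[OF \<epsilon>(1)] by blast
  define U where "U = conv u \<eta>"
  have U: "U \<in> test_fun UNIV" unfolding U_def by (rule conv_test_fun[OF u(1) uR h])
  define G where "G x = norm (grad U x)" for x
  have Gi: "integrable lborel G" unfolding G_def using test_fun_integrable[OF grad_test_fun[OF U]] by simp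
  have GC: "(LINT x|lborel. G x) \<le> C" unfolding G_def U_def
    by (rule integral_norm_grad_conv_le[OF u(1) uR h C])
  have G0: "G x \<ge> 0" for x by (simp add: G_def)
  have Uu: "(LINT x|lborel. \<bar>U x - u x\<bar>) \<le> e'"
    unfolding U_def by (rule conv_sub_norm_le(2)[OF h u(1) _ \<epsilon>(1)]) (use d(2) \<epsilon>(3) in \<open>force simp: less_imp_le\<close>)
  define V where "V i x = U (x + t *\<^sub>R N (p i))" for i x
  have VCk: "Ck k (V i)" for k i unfolding V_def[abs_def] by (rule Ck_translation[OF test_fun_Ck[OF U]])
  have tN': "norm (t *\<^sub>R N (p i)) \<le> t" for i
    using mult_left_le[OF Nr(1)[of "p i"], of t] t(1) by simp
  have tN: "norm (t *\<^sub>R N (p i)) < d" for i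
    using tN'[of i] t(3) by linarith
  have iV: "integrable lborel (V i)" for i
    unfolding V_def[abs_def] by (rule lborel_integrable_translation[OF test_fun_integrable[OF U]])
  have iVu: "integrable lborel (\<lambda>x. \<bar>V i x - u x\<bar>)" for i using iV u(1) by auto
  have Vu: "(LINT x|lborel. \<bar>V i x - u x\<bar>) \<le> 2 * e'" for i
  proof -
    let ?a = "t *\<^sub>R N (p i)"
    note I = lborel_integrable_translation[OF u(1), of ?a] lborel_integrable_translation[OF test_fun_integrable[OF U], of ?a]
    have [measurable]: "U \<in> borel_measurable borel" "u \<in> borel_measurable borel"
      using test_fun_measurable[OF U] borel_measurable_integrable[OF u(1)] by auto
    have "(LINT x|lborel. \<bar>V i x - u x\<bar>) \<le> (LINT x|lborel. \<bar>U (x + ?a) - u (x + ?a)\<bar> + \<bar>u (x + ?a) - u x\<bar>)"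
      by (rule integral_mono[OF iVu]) (use I u(1) in \<open>auto simp: V_def\<close>)
    also have "\<dots> = (LINT x|lborel. \<bar>U x - u x\<bar>) + (LINT x|lborel. \<bar>u (x + ?a) - u x\<bar>)"
      using I u(1) lborel_integral_translation[of "\<lambda>x. \<bar>U x - u x\<bar>" ?a] by simp
    also have "\<dots> \<le> 2 * e'" using Uu d(2)[OF tN[of i]] by simp
    finally show ?thesis .
  qed
  define w where "w x = (\<Sum>i<m. \<zeta> i x * V i x)" for x
  have wCk: "Ck k w" for k unfolding w_def[abs_def] by (rule Ck_lincomb_mult[OF test_fun_Ck[OF \<zeta>(1)] VCk])
  have near: "\<exists>z. norm z \<le> r (p i) * t \<and> y = x + t *\<^sub>R N (p i) + z"
    if "i < m" "norm (x' + t *\<^sub>R N (p i) - y) < \<epsilon>" "norm (x - x') \<le> \<epsilon>" for i x x' y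
  proof (intro exI conjI)
    have "norm (y - x - t *\<^sub>R N (p i)) \<le> \<epsilon> + \<epsilon>"
      using norm_triangle_ineq[of "y - x' - t *\<^sub>R N (p i)" "x' - x"] that
      by (simp add: norm_minus_commute algebra_simps)
    also have "\<dots> \<le> r (p i) * t" unfolding \<epsilon>(4) using \<rho>(3)[OF that(1)] t by (simp add: mult_right_mono)
    finally show "norm (y - x - t *\<^sub>R N (p i)) \<le> r (p i) * t" .
  qed simp
  have ri: "t \<le> r (p i)" if "i < m" for i using \<rho>(3)[OF that] t by simp

  \<comment> \<open>Vanishing is needed on the \<epsilon>-neighbourhood of the complement of
    \<Omega>, not just on the complement: what remains is a closed bounded subset of \<Omega>, which
    makes the support compact.\<close>
  have wz: "w y = 0" if x: "x \<notin> \<Omega>" "dist x y \<le> \<epsilon>" for x y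
  proof -
    have "\<zeta> i y * V i y = 0" if i: "i < m" for i
    proof (cases "\<zeta> i y = 0")
      case False
      have dx: "dist (p i) x < r (p i)"
        using \<zeta>(3)[OF i False] dist_triangle[of "p i" x y] x(2) \<epsilon>(5) \<rho>(3)[OF i] by (simp add: dist_commute)
      have "V i y = 0" unfolding V_def U_def
      proof (rule conv_local[OF h])
        have "v \<notin> \<Omega>" if v: "norm (y + t *\<^sub>R N (p i) - v) < \<epsilon>" for v
        proof -
          obtain z where "norm z \<le> r (p i) * t" "v = x + t *\<^sub>R N (p i) + z"
            using near[OF i v, of x] x(2) by (auto simp: dist_norm)
          with inward_coneD[OF Nr(4), of x "p i" t z] x(1) dx ri[OF i] t(1) show ?thesis by simp
        qed
        then show "AE v in lborel. norm (y + t *\<^sub>R N (p i) - v) < \<epsilon> \<longrightarrow> u v = 0" using u(2) by simp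
      qed (use borel_measurable_integrable[OF u(1)] in simp)
      then show ?thesis by simp
    qed simp
    then show ?thesis unfolding w_def by (intro sum.neutral) blast
  qed
  have w\<Omega>: "w \<in> test_fun \<Omega>"
  proof (rule test_funI[OF wCk])
    define O' where "O' = (\<Union>x\<in>-\<Omega>. ball x \<epsilon>)"
    have sub: "- O' \<subseteq> \<Omega>" using \<epsilon>(1) by (force simp: O'_def)
    have "closed (- O')" unfolding O'_def by (auto intro!: closed_Compl open_UN)
    then show "compact (- O')" using bounded_subset[OF Om(1) sub] by (simp add: compact_eq_bounded_closed)
    show "- O' \<subseteq> \<Omega>" by (rule sub)
    show "w x = 0" if "x \<notin> - O'" for x using that wz by (force simp: O'_def)
  qed

  obtain c where c: "AE x in lborel. x \<in> S \<longrightarrow> u x = c x"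
    "\<And>x. x \<in> S \<Longrightarrow> \<exists>r>0. ball x r \<subseteq> S \<and> (\<forall>y\<in>ball x r. c y = c x)"
    using AE_locally_constant[OF u(1) S(1) grad0] by blast
  have wc: "w x = c x" if x: "x \<in> S" for x
  proof -
    have "\<zeta> i x * V i x = \<zeta> i x * c x" if i: "i < m" for i
    proof (cases "\<zeta> i x = 0")
      case False
      have dx: "dist (p i) x < r (p i)"
        using \<zeta>(3)[OF i False] Nr(2)[of "p i"] by simp
      have "V i x = c x" unfolding V_def U_def
      proof (rule conv_local[OF h])
        have vS: "v \<in> S \<and> c v = c x" if v: "norm (x + t *\<^sub>R N (p i) - v) < \<epsilon>" for v
        proof -
          obtain z where z: "norm z \<le> r (p i) * t" "v = x + t *\<^sub>R N (p i) + z"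
            using near[OF i v, of x] \<epsilon>(1) by auto
          \<comment> \<open>Since \<open>c\<close> is only locally constant, it does not suffice
            that \<open>v\<close> lies in \<open>S\<close>. The whole segment lies in the cone,
            because scaling by \<open>s\<close> shortens the step and the deviation equally.\<close>
          have "closed_segment x v \<subseteq> S"
          proof
            fix y assume "y \<in> closed_segment x v"
            then obtain s where s: "0 \<le> s" "s \<le> 1" "y = (1 - s) *\<^sub>R x + s *\<^sub>R v" by (auto simp: closed_segment_def)
            then have y: "y = x + (s * t) *\<^sub>R N (p i) + s *\<^sub>R z" by (simp add: z(2) algebra_simps)
            have st: "s * t \<le> r (p i)" using mult_left_le_one_le[of t s] s(1,2) t(1) ri[OF i] by linarith
            then show "y \<in> S" unfolding y
              by (intro inward_coneD[OF Nr(3) x dx])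
                 (use st s t mult_left_mono[OF z(1) s(1)] in \<open>auto simp: mult_ac\<close>)
          qed
          then show ?thesis using locally_constant_segment[OF c(2)] by blast
        qed
        show "AE v in lborel. norm (x + t *\<^sub>R N (p i) - v) < \<epsilon> \<longrightarrow> u v = c x"
          using c(1) by eventually_elim (use vS in auto)
      qed (use borel_measurable_integrable[OF u(1)] in simp)
      then show ?thesis by simp
    qed simp
    then have "w x = (\<Sum>i<m. \<zeta> i x * c x)" unfolding w_def by (intro sum.cong) auto
    then have "w x = (\<Sum>i<m. \<zeta> i x) * c x" by (simp add: sum_distrib_right)
    then show ?thesis using \<zeta>(4)[OF R] S(2) x by auto
  qed
  have wS: "grad w x = 0" if x: "x \<in> S" for x
  proof (rule grad_eqI)
    obtain s where s: "s > 0" "ball x s \<subseteq> S" "\<forall>y\<in>ball x s. c y = c x" using c(2)[OF x] by blast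
    have const: "((\<lambda>y. c x) has_derivative (\<lambda>h. 0)) (at x)" by simp
    have eq: "c x = w y" if "y \<in> ball x s" for y
      using wc[OF subsetD[OF s(2) that]] bspec[OF s(3) that] by simp
    have "(w has_derivative (\<lambda>h. 0)) (at x)"
      by (rule has_derivative_transform_within_open[OF const open_ball centre_in_ball[THEN iffD2, OF s(1)] eq])
    then show "(w has_derivative (\<lambda>h. 0 \<bullet> h)) (at x)" by simp
  qed

  have i\<zeta>: "integrable lborel (\<lambda>x. \<zeta> i x * f x)" if "integrable lborel f" for f i
    using test_fun_times_integrable[OF that \<zeta>(1)] by simp
  have wu: "(LINT x|lborel. \<bar>w x - u x\<bar>) \<le> e"
  proof -
    have "(LINT x|lborel. \<bar>w x - u x\<bar>) \<le> (LINT x|lborel. (\<Sum>i<m. \<bar>V i x - u x\<bar>))"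
    proof (rule integral_mono)
      show "integrable lborel (\<lambda>x. \<bar>w x - u x\<bar>)" using test_fun_integrable[OF w\<Omega>] u(1) by auto
      show "integrable lborel (\<lambda>x. \<Sum>i<m. \<bar>V i x - u x\<bar>)" by (rule Bochner_Integration.integrable_sum[OF iVu])
      fix x
      have "u x = (\<Sum>i<m. \<zeta> i x) * u x"
        using \<zeta>(4)[OF R, of x] u(2)[of x] by (cases "x \<in> \<Omega>") auto
      then have "w x - u x = (\<Sum>i<m. \<zeta> i x * (V i x - u x))"
        by (simp add: w_def sum_distrib_right sum_subtractf right_diff_distrib)
      also have "\<bar>\<dots>\<bar> \<le> (\<Sum>i<m. \<bar>\<zeta> i x * (V i x - u x)\<bar>)" by (rule sum_abs)
      also have "\<dots> \<le> (\<Sum>i<m. \<bar>V i x - u x\<bar>)"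
      proof (rule sum_mono)
        fix i assume "i \<in> {..<m}"
        then have "\<bar>\<zeta> i x\<bar> \<le> 1" using \<zeta>1[of i x] \<zeta>(2)[of i x] by simp
        then show "\<bar>\<zeta> i x * (V i x - u x)\<bar> \<le> \<bar>V i x - u x\<bar>" unfolding abs_mult by (rule mult_left_le_one_le[rotated 2]) auto
      qed
      finally show "\<bar>w x - u x\<bar> \<le> (\<Sum>i<m. \<bar>V i x - u x\<bar>)" .
    qed
    also have "\<dots> = (\<Sum>i<m. (LINT x|lborel. \<bar>V i x - u x\<bar>))" by (rule Bochner_Integration.integral_sum[OF iVu])
    also have "\<dots> \<le> (\<Sum>i<m. 2 * e')" by (rule sum_mono[OF Vu])
    also have "\<dots> = 2 * real m * e'" by simp
    also have "\<dots> \<le> (4 * (M + real m + 1)) * e'" using M0 e' by (intro mult_right_mono) auto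
    also have "\<dots> = e" using M0 by (simp add: e'_def)
    finally show ?thesis .
  qed

  have gw: "norm (grad w x) \<le> (\<Sum>i<m. \<zeta> i x * G (x + t *\<^sub>R N (p i))) + (\<Sum>i<m. Mi i * \<bar>V i x - u x\<bar>)" for x
  proof -
    have gV: "grad (V i) x = grad U (x + t *\<^sub>R N (p i))" for i
      unfolding V_def[abs_def] by (rule grad_translation[OF test_fun_Ck[OF U]])
    have "grad w x = (\<Sum>i<m. grad (\<lambda>x. \<zeta> i x * V i x) x)"
      unfolding w_def[abs_def] by (rule grad_sum) (rule Ck_mult[OF test_fun_Ck[OF \<zeta>(1)] VCk])
    also have "\<dots> = (\<Sum>i<m. \<zeta> i x *\<^sub>R grad U (x + t *\<^sub>R N (p i)) + V i x *\<^sub>R grad (\<zeta> i) x)"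
      by (intro sum.cong refl) (simp only: grad_mult[OF test_fun_Ck[OF \<zeta>(1)] VCk] gV)
    finally have 1: "grad w x = (\<Sum>i<m. \<zeta> i x *\<^sub>R grad U (x + t *\<^sub>R N (p i))) + (\<Sum>i<m. V i x *\<^sub>R grad (\<zeta> i) x)"
      by (simp add: sum.distrib)
    \<comment> \<open>Inside the open set \<Omega> the weights add up to the constant 1, so their
      gradients add up to 0; outside, \<open>u\<close> is 0. This allows \<open>V i x\<close> to be
      replaced by \<open>V i x - u x\<close>.\<close>
    have "u x *\<^sub>R (\<Sum>i<m. grad (\<zeta> i) x) = 0"
    proof (cases "x \<in> \<Omega>")
      case True
      have "((\<lambda>y. 1) has_derivative (\<lambda>h. 0)) (at x)" by simp
      then have "((\<lambda>y. \<Sum>i<m. \<zeta> i y) has_derivative (\<lambda>h. 0)) (at x)"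
        by (rule has_derivative_transform_within_open[OF _ Om(2) True]) (simp add: \<zeta>(4)[OF R])
      then have "grad (\<lambda>y. \<Sum>i<m. \<zeta> i y) x = 0" by (intro grad_eqI) simp
      then have "(\<Sum>i<m. grad (\<zeta> i) x) = 0" by (subst (asm) grad_sum[OF test_fun_Ck[OF \<zeta>(1)]])
      then show ?thesis by simp
    qed (simp add: u(2))
    then have "(\<Sum>i<m. V i x *\<^sub>R grad (\<zeta> i) x) = (\<Sum>i<m. (V i x - u x) *\<^sub>R grad (\<zeta> i) x)"
      by (simp add: scaleR_diff_left sum_subtractf scaleR_sum_right)
    also have "norm \<dots> \<le> (\<Sum>i<m. Mi i * \<bar>V i x - u x\<bar>)"
      by (rule sum_norm_le) (simp add: mult.commute[of "\<bar>_\<bar>"] mult_right_mono[OF Mi(3)])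
    finally have 2: "norm (\<Sum>i<m. V i x *\<^sub>R grad (\<zeta> i) x) \<le> (\<Sum>i<m. Mi i * \<bar>V i x - u x\<bar>)" .
    have 3: "norm (\<Sum>i<m. \<zeta> i x *\<^sub>R grad U (x + t *\<^sub>R N (p i))) \<le> (\<Sum>i<m. \<zeta> i x * G (x + t *\<^sub>R N (p i)))"
      by (rule sum_norm_le) (use \<zeta>(2) in \<open>simp add: G_def\<close>)
    show ?thesis unfolding 1 using norm_triangle_mono[OF 3 2] .
  qed
  have "(LINT x|lborel. norm (grad w x)) \<le> (LINT x|lborel. (\<Sum>i<m. \<zeta> i x * G (x + t *\<^sub>R N (p i))) + (\<Sum>i<m. Mi i * \<bar>V i x - u x\<bar>))"
  proof (rule integral_mono[OF integrable_norm[OF test_fun_integrable[OF grad_test_fun[OF w\<Omega>]]] _ gw])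
    show "integrable lborel (\<lambda>x. (\<Sum>i<m. \<zeta> i x * G (x + t *\<^sub>R N (p i))) + (\<Sum>i<m. Mi i * \<bar>V i x - u x\<bar>))"
      by (intro Bochner_Integration.integrable_add Bochner_Integration.integrable_sum integrable_mult_right iVu i\<zeta> lborel_integrable_translation[OF Gi])
  qed
  also have "\<dots> = (LINT x|lborel. (\<Sum>i<m. \<zeta> i x * G (x + t *\<^sub>R N (p i)))) + (LINT x|lborel. (\<Sum>i<m. Mi i * \<bar>V i x - u x\<bar>))"
    by (intro Bochner_Integration.integral_add Bochner_Integration.integrable_sum integrable_mult_right iVu i\<zeta> lborel_integrable_translation[OF Gi])
  also have "(LINT x|lborel. (\<Sum>i<m. Mi i * \<bar>V i x - u x\<bar>)) \<le> e / 2"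
  proof -
    have "(LINT x|lborel. (\<Sum>i<m. Mi i * \<bar>V i x - u x\<bar>)) = (\<Sum>i<m. Mi i * (LINT x|lborel. \<bar>V i x - u x\<bar>))"
      by (subst Bochner_Integration.integral_sum) (auto intro!: integrable_mult_right iVu)
    also have "\<dots> \<le> (\<Sum>i<m. Mi i * (2 * e'))"
      by (intro sum_mono mult_left_mono Vu less_imp_le[OF Mi(1)])
    also have "\<dots> = 2 * M * e'" by (simp add: M_def sum_distrib_right mult_ac sum_distrib_left)
    also have "\<dots> \<le> (2 * (M + real m + 1)) * e'" using M0 e' by (intro mult_right_mono) auto
    also have "\<dots> = e / 2" using M0 by (simp add: e'_def divide_simps)
    finally show ?thesis .
  qed
  also have "(LINT x|lborel. (\<Sum>i<m. \<zeta> i x * G (x + t *\<^sub>R N (p i)))) \<le> C + e / 2"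
  proof -
    have [measurable]: "\<zeta> i \<in> borel_measurable borel" "G \<in> borel_measurable borel" for i
      using test_fun_measurable[OF \<zeta>(1)] borel_measurable_integrable[OF Gi] by auto
    have i2: "integrable lborel (\<lambda>x. \<zeta> i (x - t *\<^sub>R N (p i)) * G x)" for i
      using lborel_integrable_translation[OF i\<zeta>[OF lborel_integrable_translation[OF Gi, of "t *\<^sub>R N (p i)"], of i], of "- t *\<^sub>R N (p i)"]
      by simp
    have "(LINT x|lborel. (\<Sum>i<m. \<zeta> i x * G (x + t *\<^sub>R N (p i)))) = (\<Sum>i<m. (LINT x|lborel. \<zeta> i x * G (x + t *\<^sub>R N (p i))))"
      by (rule Bochner_Integration.integral_sum) (intro i\<zeta> lborel_integrable_translation[OF Gi])
    \<comment> \<open>The translation is moved from \<open>G\<close> to the weights, so that all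
      summands carry the same \<open>G\<close>. The moved weights add up to at most 1 + t M, which
      keeps the leading constant at 1.\<close>
    also have "\<dots> = (\<Sum>i<m. (LINT x|lborel. \<zeta> i (x - t *\<^sub>R N (p i)) * G x))"
    proof (rule sum.cong[OF refl])
      fix i
      show "(LINT x|lborel. \<zeta> i x * G (x + t *\<^sub>R N (p i))) = (LINT x|lborel. \<zeta> i (x - t *\<^sub>R N (p i)) * G x)"
        using lborel_integral_translation[of "\<lambda>x. \<zeta> i (x - t *\<^sub>R N (p i)) * G x" "t *\<^sub>R N (p i)"] by simp
    qed
    also have "\<dots> = (LINT x|lborel. (\<Sum>i<m. \<zeta> i (x - t *\<^sub>R N (p i)) * G x))"
      by (rule Bochner_Integration.integral_sum[symmetric, OF i2])
    also have "\<dots> \<le> (LINT x|lborel. (1 + t * M) * G x)"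
    proof (rule integral_mono)
      show "integrable lborel (\<lambda>x. \<Sum>i<m. \<zeta> i (x - t *\<^sub>R N (p i)) * G x)"
        by (rule Bochner_Integration.integrable_sum[OF i2])
      show "integrable lborel (\<lambda>x. (1 + t * M) * G x)" using Gi by simp
      fix x
      have "(\<Sum>i<m. \<zeta> i (x - t *\<^sub>R N (p i))) \<le> (\<Sum>i<m. \<zeta> i x + t * Mi i)"
      proof (rule sum_mono)
        fix i
        have "\<zeta> i (x - t *\<^sub>R N (p i)) - \<zeta> i x \<le> Mi i * norm (t *\<^sub>R N (p i))"
          using Mi(2)[of i "x - t *\<^sub>R N (p i)" x] by simp
        also have "\<dots> \<le> Mi i * t"
          by (rule mult_left_mono[OF tN' less_imp_le[OF Mi(1)]])
        finally show "\<zeta> i (x - t *\<^sub>R N (p i)) \<le> \<zeta> i x + t * Mi i" by (simp add: mult.commute)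
      qed
      also have "\<dots> \<le> 1 + t * M" using \<zeta>(5)[of x] by (simp add: sum.distrib M_def sum_distrib_left)
      finally show "(\<Sum>i<m. \<zeta> i (x - t *\<^sub>R N (p i)) * G x) \<le> (1 + t * M) * G x"
        unfolding sum_distrib_right[symmetric] by (rule mult_right_mono) (rule G0)
    qed
    also have "\<dots> = (1 + t * M) * (LINT x|lborel. G x)" by simp
    also have "\<dots> \<le> (1 + t * M) * C" using GC t M0 by (intro mult_left_mono) auto
    also have "\<dots> = C + t * (C * M)" by (simp add: algebra_simps)
    also have "\<dots> \<le> C + e / 2" using t(4) by simp
    finally show ?thesis .
  qed
  finally have "(LINT x|lborel. norm (grad w x)) \<le> C + e" by simp
  with that w\<Omega> wS wu show ?thesis by blast
qed

subsection \<open>Passing between Borel and Lebesgue measure\<close>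

lemma lebesgue_integral_eq_lborel:
  fixes f :: "'a::euclidean_space \<Rightarrow> 'b::euclidean_space"
  assumes "f \<in> borel_measurable borel"
  shows "integrable lebesgue f \<longleftrightarrow> integrable lborel f" "(LINT x|lebesgue. f x) = (LINT x|lborel. f x)"
  using integrable_completion[of f lborel] integral_completion[of f lborel] assms by simp_all

lemma borel_measurable_lebesgueI:
  fixes f :: "'a::euclidean_space \<Rightarrow> 'b::euclidean_space"
  shows "f \<in> borel_measurable borel \<Longrightarrow> f \<in> borel_measurable lebesgue"
  by (rule measurable_completion) simp

lemma integrable_lebesgueI:
  fixes f :: "'a::euclidean_space \<Rightarrow> 'b::euclidean_space"
  shows "integrable lborel f \<Longrightarrow> integrable lebesgue f"
  using lebesgue_integral_eq_lborel(1)[of f] borel_measurable_integrable[of lborel f] by simp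

lemma borel_measurable_lebesgue_AE:
  fixes f g :: "'a::euclidean_space \<Rightarrow> 'b::euclidean_space"
  assumes f: "f \<in> borel_measurable lebesgue" and ae: "AE x in lebesgue. f x = g x"
  shows "g \<in> borel_measurable lebesgue"
proof (rule measurableI)
  fix A :: "'b set" assume A: "A \<in> sets borel"
  have m: "f -` A \<inter> space lebesgue \<in> sets lebesgue" using f A by (rule measurable_sets)
  show "g -` A \<inter> space lebesgue \<in> sets lebesgue"
    by (rule completion.in_sets_AE[OF _ m]) (use ae in \<open>auto elim: eventually_mono\<close>)
qed simp

text \<open>Translation, convolution and Fubini are carried out for Borel functions; this lemma is
  the bridge to Lebesgue measurable ones.\<close>

lemma lebesgue_borel_representative:
  fixes f :: "'a::euclidean_space \<Rightarrow> real"
  assumes "integrable lebesgue f"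
  obtains f' where "integrable lborel f'" "AE x in lebesgue. f x = f' x"
proof -
  obtain f' where f': "f' \<in> borel_measurable lborel" "AE x in lborel. f x = f' x"
    using completion_ex_borel_measurable_real[OF borel_measurable_integrable[OF assms]] by blast
  have ae: "AE x in lebesgue. f x = f' x" by (rule AE_completion[OF f'(2)])
  have "integrable lebesgue f'"
    by (rule integrable_cong_AE_imp[OF assms]) (use f' ae in \<open>auto intro: borel_measurable_lebesgueI elim: eventually_mono\<close>)
  then have "integrable lborel f'" using f'(1) lebesgue_integral_eq_lborel(1)[of f'] by simp
  then show ?thesis using ae that by blast
qed

lemma lebesgue_AE_translation:
  fixes a :: "'a::euclidean_space"
  assumes "AE x in lebesgue. P x"
  shows "AE x in lebesgue. P (x + a)"
  using assms unfolding AE_completion_iff by (rule lborel_AE_translation)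

lemma lebesgue_integral_translation:
  fixes f :: "'a::euclidean_space \<Rightarrow> real"
  assumes f: "integrable lebesgue f"
  shows "integrable lebesgue (\<lambda>x. f (x + a))" "(LINT x|lebesgue. f (x + a)) = (LINT x|lebesgue. f x)"
proof -
  obtain f' where f': "integrable lborel f'" "AE x in lebesgue. f x = f' x"
    using lebesgue_borel_representative[OF f] by blast
  have m: "f' \<in> borel_measurable borel" "(\<lambda>x. f' (x + a)) \<in> borel_measurable borel"
    using borel_measurable_integrable[OF f'(1)] borel_measurable_integrable[OF lborel_integrable_translation[OF f'(1), of a]] by auto
  have ae: "AE x in lebesgue. f' (x + a) = f (x + a)"
    using lebesgue_AE_translation[OF f'(2), of a] by eventually_elim simp
  have mt: "(\<lambda>x. f (x + a)) \<in> borel_measurable lebesgue"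
    by (rule borel_measurable_lebesgue_AE[OF borel_measurable_lebesgueI[OF m(2)] ae])
  show "integrable lebesgue (\<lambda>x. f (x + a))"
    by (rule integrable_cong_AE_imp[OF integrable_lebesgueI[OF lborel_integrable_translation[OF f'(1), of a]] mt ae])
  have "(LINT x|lebesgue. f (x + a)) = (LINT x|lebesgue. f' (x + a))"
    by (rule integral_cong_AE[OF mt borel_measurable_lebesgueI[OF m(2)]]) (use ae in \<open>auto elim: eventually_mono\<close>)
  also have "\<dots> = (LINT x|lebesgue. f' x)"
    using lebesgue_integral_eq_lborel(2)[OF m(1)] lebesgue_integral_eq_lborel(2)[OF m(2)] lborel_integral_translation[OF m(1)] by simp
  also have "\<dots> = (LINT x|lebesgue. f x)"
    by (rule integral_cong_AE[OF borel_measurable_lebesgueI[OF m(1)] borel_measurable_integrable[OF f]]) (use f'(2) in \<open>auto elim: eventually_mono\<close>)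
  finally show "(LINT x|lebesgue. f (x + a)) = (LINT x|lebesgue. f x)" .
qed

lemma integrable_mult_indicator_lebesgue:
  fixes f :: "'a::euclidean_space \<Rightarrow> real"
  shows "A \<in> sets lebesgue \<Longrightarrow> integrable lebesgue f \<Longrightarrow> integrable lebesgue (\<lambda>x. indicator A x * f x)"
  using integrable_mult_indicator[of A lebesgue f] by simp

subsection \<open>Uniqueness of weak gradients\<close>

text \<open>A locally integrable \<open>f\<close> is replaced by a Borel representative on one ball
  at a time, which suffices because the conclusion is local.\<close>

lemma AE_zero_of_test_fun_lebesgue:
  fixes f :: "'a::euclidean_space \<Rightarrow> real"
  assumes U: "open U" and f: "\<And>K. compact K \<Longrightarrow> K \<subseteq> U \<Longrightarrow> integrable lebesgue (\<lambda>x. indicator K x * f x)"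
    and t: "\<And>\<phi>. \<phi> \<in> test_fun U \<Longrightarrow> (LINT x|lebesgue. \<phi> x * f x) = 0"
  shows "AE x in lebesgue. x \<in> U \<longrightarrow> f x = 0"
  unfolding AE_completion_iff
proof (rule AE_locally)
  fix x0 assume "x0 \<in> U"
  then obtain r where r: "r > 0" "cball x0 r \<subseteq> U" using U open_contains_cball by blast
  have i: "integrable lebesgue (\<lambda>x. indicator (cball x0 r) x * f x)" using f[of "cball x0 r"] r by simp
  obtain f' where f': "integrable lborel f'" "AE x in lebesgue. indicator (cball x0 r) x * f x = f' x"
    using lebesgue_borel_representative[OF i] by blast
  have "AE x in lborel. x \<in> ball x0 r \<longrightarrow> f' x = 0"
  proof (rule AE_zero_of_test_fun)
    show "integrable lborel (\<lambda>x. indicator K x * f' x)" if "compact K" for K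
      using integrable_mult_indicator[of K lborel f'] f'(1) that by (simp add: borel_compact)
    fix \<phi> :: "'a \<Rightarrow> real" assume \<phi>: "\<phi> \<in> test_fun (ball x0 r)"
    have sub: "ball x0 r \<subseteq> U" using r(2) ball_subset_cball by blast
    have [measurable]: "\<phi> \<in> borel_measurable borel" "f' \<in> borel_measurable borel"
      using test_fun_measurable[OF \<phi>] borel_measurable_integrable[OF f'(1)] by auto
    have z: "\<phi> x = 0" if "x \<notin> cball x0 r" for x
      using \<phi> closure_subset[of "{x. \<phi> x \<noteq> 0}"] that ball_subset_cball unfolding test_fun_def by blast
    have ae: "AE x in lebesgue. \<phi> x * f' x = \<phi> x * f x"
      using f'(2)
    proof eventually_elim
      fix x assume "indicator (cball x0 r) x * f x = f' x"
      then show "\<phi> x * f' x = \<phi> x * f x" using z[of x] by (cases "x \<in> cball x0 r") auto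
    qed
    have m: "(\<lambda>x. \<phi> x * f' x) \<in> borel_measurable borel" by measurable
    have "(LINT x|lborel. \<phi> x * f' x) = (LINT x|lebesgue. \<phi> x * f' x)"
      using lebesgue_integral_eq_lborel(2)[OF m] by simp
    also have "\<dots> = (LINT x|lebesgue. \<phi> x * f x)"
      by (rule integral_cong_AE[OF borel_measurable_lebesgueI[OF m] borel_measurable_lebesgue_AE[OF borel_measurable_lebesgueI[OF m] ae]])
         (rule ae)
    also have "\<dots> = 0" using t test_fun_mono[OF sub] \<phi> by blast
    finally show "(LINT x|lborel. \<phi> x * f' x) = 0" .
  qed simp
  then have "AE x in lborel. x \<in> ball x0 r \<longrightarrow> f x = 0"
    using f'(2) unfolding AE_completion_iff by eventually_elim (auto split: if_splits)
  then show "\<exists>V. open V \<and> x0 \<in> V \<and> (AE y in lborel. y \<in> V \<longrightarrow> f y = 0)"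
    using r by (intro exI[of _ "ball x0 r"]) auto
qed

text \<open>Each component of the difference integrates to 0 against every test function, so the
  fundamental lemma applies. This makes the choice in \<open>wgrad\<close> irrelevant up to null
  sets.\<close>

lemma weak_gradient_unique:
  fixes g g' :: "'a::euclidean_space \<Rightarrow> 'a"
  assumes U: "open U" and g: "is_weak_gradient U v g" and g': "is_weak_gradient U v g'"
  shows "AE x in lebesgue. x \<in> U \<longrightarrow> g x = g' x"
proof -
  have "AE x in lebesgue. x \<in> U \<longrightarrow> (g x - g' x) \<bullet> b = 0" if b: "b \<in> Basis" for b
  proof (rule AE_zero_of_test_fun_lebesgue[OF U])
    have i: "integrable lebesgue (\<lambda>x. indicator K x * (g x \<bullet> b))" if "compact K" "K \<subseteq> U" "is_weak_gradient U v g" for K g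
    proof -
      have "integrable lebesgue (\<lambda>x. (indicator K x *\<^sub>R g x) \<bullet> b)"
        using that by (intro integrable_inner_left) (auto simp: is_weak_gradient_def set_integrable_def)
      then show ?thesis by simp
    qed
    show "integrable lebesgue (\<lambda>x. indicator K x * ((g x - g' x) \<bullet> b))" if "compact K" "K \<subseteq> U" for K
      using Bochner_Integration.integrable_diff[OF i[OF that g] i[OF that g']]
      by (simp add: inner_diff_left right_diff_distrib)
    fix \<phi> :: "'a \<Rightarrow> real" assume \<phi>: "\<phi> \<in> test_fun U"
    obtain K where K: "\<And>k. Ck k \<phi>" "compact K" "K \<subseteq> U" "\<And>x. x \<notin> K \<Longrightarrow> \<phi> x = 0"
      using test_funE[OF \<phi>] by metis
    obtain B where B: "B > 0" "\<And>x. norm (\<phi> x) \<le> B" using test_fun_bounded[OF \<phi>] by blast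
    have j: "integrable lebesgue (\<lambda>x. \<phi> x * (g x \<bullet> b))"
      and e: "(LINT x|lebesgue. \<phi> x * (g x \<bullet> b)) = - (LINT x:U|lebesgue. v x * frechet_derivative \<phi> (at x) b)"
      if w: "is_weak_gradient U v g" for g
    proof -
      note ik = i[OF K(2,3) w]
      have "integrable lebesgue (\<lambda>x. \<phi> x * (indicator K x * (g x \<bullet> b)))"
      proof (rule Bochner_Integration.integrable_bound)
        show "integrable lebesgue (\<lambda>x. B * (indicator K x * (g x \<bullet> b)))" using ik by simp
        show "AE x in lebesgue. norm (\<phi> x * (indicator K x * (g x \<bullet> b))) \<le> norm (B * (indicator K x * (g x \<bullet> b)))"
          using B by (intro AE_I2) (auto simp: abs_mult intro!: mult_right_mono)
        show "(\<lambda>x. \<phi> x * (indicator K x * (g x \<bullet> b))) \<in> borel_measurable lebesgue"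
          by (intro borel_measurable_times borel_measurable_lebesgueI[OF test_fun_measurable[OF \<phi>]] borel_measurable_integrable[OF ik])
      qed
      moreover have "\<phi> x * (indicator K x * (g x \<bullet> b)) = \<phi> x * (g x \<bullet> b)" for x using K(4) by (auto simp: indicator_def)
      ultimately show "integrable lebesgue (\<lambda>x. \<phi> x * (g x \<bullet> b))" by simp
      have "(LINT x|lebesgue. \<phi> x * (g x \<bullet> b)) = (LINT x:U|lebesgue. (g x \<bullet> b) * \<phi> x)"
        unfolding set_lebesgue_integral_def
        by (rule Bochner_Integration.integral_cong) (use K(3,4) in \<open>auto simp: indicator_def\<close>)
      then show "(LINT x|lebesgue. \<phi> x * (g x \<bullet> b)) = - (LINT x:U|lebesgue. v x * frechet_derivative \<phi> (at x) b)"
        using w \<phi> b by (simp add: is_weak_gradient_def)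
    qed
    show "(LINT x|lebesgue. \<phi> x * ((g x - g' x) \<bullet> b)) = 0"
      using j[OF g] j[OF g'] e[OF g] e[OF g'] by (simp add: inner_diff_left right_diff_distrib)
  qed
  then have "AE x in lebesgue. \<forall>b\<in>Basis. x \<in> U \<longrightarrow> (g x - g' x) \<bullet> b = 0"
    by (intro AE_finite_allI) auto
  then show ?thesis
    by eventually_elim (auto simp: inner_diff_left intro: euclidean_eqI)
qed

lemma wgrad_weak_gradient: "is_weak_gradient U v g \<Longrightarrow> is_weak_gradient U v (wgrad U v)"
  unfolding wgrad_def by (rule someI[of "is_weak_gradient U v"])

lemma wgrad_AE_eq:
  "open U \<Longrightarrow> is_weak_gradient U v g \<Longrightarrow> AE x in lebesgue. x \<in> U \<longrightarrow> wgrad U v x = g x"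
  using weak_gradient_unique wgrad_weak_gradient by blast

lemma set_integrable_lebesgueI:
  fixes f :: "'a::euclidean_space \<Rightarrow> 'b::euclidean_space"
  assumes "integrable lebesgue f" "A \<in> sets lebesgue" shows "set_integrable lebesgue A f"
  unfolding set_integrable_def using integrable_mult_indicator[OF assms(2,1)] .

lemma test_fun_integrable_lebesgue:
  fixes \<phi> :: "'a::euclidean_space \<Rightarrow> 'b::euclidean_space"
  shows "\<phi> \<in> test_fun U \<Longrightarrow> integrable lebesgue \<phi>"
  by (rule integrable_lebesgueI[OF test_fun_integrable])

lemma test_fun_zero_outside: "\<phi> \<in> test_fun U \<Longrightarrow> x \<notin> U \<Longrightarrow> \<phi> x = 0"
  using closure_subset[of "{x. \<phi> x \<noteq> 0}"] unfolding test_fun_def by blast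

lemma test_fun_weak_gradient:
  fixes \<phi> :: "'a::euclidean_space \<Rightarrow> real"
  assumes \<phi>: "\<phi> \<in> test_fun U"
  shows "is_weak_gradient U \<phi> (grad \<phi>)"
  unfolding is_weak_gradient_def
proof (intro conjI ballI allI impI)
  fix K assume "compact K \<and> K \<subseteq> U"
  then have K: "K \<in> sets lebesgue" by (simp add: borel_compact)
  show "set_integrable lebesgue K \<phi>" "set_integrable lebesgue K (grad \<phi>)"
    by (intro set_integrable_lebesgueI K test_fun_integrable_lebesgue[OF \<phi>] test_fun_integrable_lebesgue[OF grad_test_fun[OF \<phi>]])+
next
  fix \<psi> :: "'a \<Rightarrow> real" and b :: 'a assume \<psi>: "\<psi> \<in> test_fun U" and b: "b \<in> Basis"
  note [measurable] = test_fun_measurable[OF \<phi>] test_fun_measurable[OF \<psi>]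
    test_fun_measurable[OF test_fun_partial[OF \<phi> b]] test_fun_measurable[OF test_fun_partial[OF \<psi> b]]
  have "(LINT x:U|lebesgue. \<phi> x * frechet_derivative \<psi> (at x) b) = (LINT x|lebesgue. \<phi> x * frechet_derivative \<psi> (at x) b)"
    unfolding set_lebesgue_integral_def
    by (rule Bochner_Integration.integral_cong) (use test_fun_zero_outside[OF \<phi>] in \<open>auto simp: indicator_def\<close>)
  also have "\<dots> = (LINT x|lborel. \<phi> x * frechet_derivative \<psi> (at x) b)"
    by (rule lebesgue_integral_eq_lborel(2)) measurable
  also have "\<dots> = - (LINT x|lborel. frechet_derivative \<phi> (at x) b * \<psi> x)"
    by (rule integration_by_parts[OF \<phi> test_fun_Ck[OF \<psi>] b])
  also have "(LINT x|lborel. frechet_derivative \<phi> (at x) b * \<psi> x) = (LINT x|lebesgue. frechet_derivative \<phi> (at x) b * \<psi> x)"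
    by (rule lebesgue_integral_eq_lborel(2)[symmetric]) measurable
  also have "\<dots> = (LINT x:U|lebesgue. (grad \<phi> x \<bullet> b) * \<psi> x)"
    unfolding set_lebesgue_integral_def grad_inner_Basis[OF b]
    by (rule Bochner_Integration.integral_cong) (use test_fun_zero_outside[OF \<psi>] in \<open>auto simp: indicator_def\<close>)
  finally show "(LINT x:U|lebesgue. \<phi> x * frechet_derivative \<psi> (at x) b) = - (LINT x:U|lebesgue. (grad \<phi> x \<bullet> b) * \<psi> x)" .
qed

lemma weak_gradient_cmult:
  assumes "is_weak_gradient U v g"
  shows "is_weak_gradient U (\<lambda>x. c * v x) (\<lambda>x. c *\<^sub>R g x)"
  using assms unfolding is_weak_gradient_def
  by (auto simp: mult.assoc)

subsection \<open>The space of test velocities\<close>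

text \<open>\<open>wgrad\<close> is unconstrained outside \<open>U\<close>. Extending by 0 turns set
  integrals into integrals over the whole space, as needed for translations and for pairings with
  global test fields.\<close>

definition zgrad :: "'a::euclidean_space set \<Rightarrow> ('a \<Rightarrow> real) \<Rightarrow> 'a \<Rightarrow> 'a" where
  "zgrad U v x = indicator U x *\<^sub>R wgrad U v x"

lemma zgrad_AE_eq:
  assumes "open U" "is_weak_gradient U v g" "\<And>x. x \<notin> U \<Longrightarrow> g x = 0"
  shows "AE x in lebesgue. zgrad U v x = g x"
  using wgrad_AE_eq[OF assms(1,2)] by eventually_elim (use assms(3) in \<open>auto simp: zgrad_def indicator_def\<close>)

lemma test_fun_grad_zero_outside: "\<phi> \<in> test_fun U \<Longrightarrow> x \<notin> U \<Longrightarrow> grad \<phi> x = 0"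
  using test_fun_zero_outside[OF grad_test_fun] .

lemma zgrad_test_fun: "open U \<Longrightarrow> \<phi> \<in> test_fun U \<Longrightarrow> AE x in lebesgue. zgrad U \<phi> x = grad \<phi> x"
  by (rule zgrad_AE_eq[OF _ test_fun_weak_gradient test_fun_grad_zero_outside])

lemma L2_iff:
  fixes f :: "'a::euclidean_space \<Rightarrow> 'b::euclidean_space"
  shows "f \<in> L2 U \<longleftrightarrow> (\<lambda>x. indicator U x *\<^sub>R f x) \<in> borel_measurable lebesgue \<and>
    integrable lebesgue (\<lambda>x. (norm (indicator U x *\<^sub>R f x))\<^sup>2)"
proof -
  have "(\<lambda>x. indicator U x *\<^sub>R (norm (f x))\<^sup>2) = (\<lambda>x. (norm (indicator U x *\<^sub>R f x))\<^sup>2)"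
    by (auto simp: indicator_def)
  then show ?thesis unfolding L2_def set_borel_measurable_def set_integrable_def by simp
qed

lemma integrable_indicator_bounded_open:
  fixes U :: "'a::euclidean_space set"
  assumes "bounded U" "open U" shows "integrable lebesgue (indicat_real U)"
  by (rule integrable_lebesgueI) (use assms emeasure_bounded_finite[of U] in \<open>simp add: integrable_indicator_iff\<close>)

lemma integrable_of_square_integrable:
  fixes f :: "'a::euclidean_space \<Rightarrow> 'b::euclidean_space"
  assumes "bounded U" "open U" "f \<in> borel_measurable lebesgue" "integrable lebesgue (\<lambda>x. (norm (f x))\<^sup>2)"
    "\<And>x. x \<notin> U \<Longrightarrow> f x = 0"
  shows "integrable lebesgue f"
proof (rule Bochner_Integration.integrable_bound)
  have "integrable lebesgue (indicat_real U)"
    by (rule integrable_indicator_bounded_open[OF assms(1,2)])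
  then show "integrable lebesgue (\<lambda>x. indicat_real U x + (norm (f x))\<^sup>2)" using assms(4) by simp
  show "AE x in lebesgue. norm (f x) \<le> norm (indicat_real U x + (norm (f x))\<^sup>2)"
  proof (rule AE_I2)
    fix x
    have "norm (f x) \<le> 1 + (norm (f x))\<^sup>2"
    proof -
      have "0 \<le> (norm (f x) - 1)\<^sup>2 + (norm (f x))\<^sup>2" by simp
      then show ?thesis unfolding power2_diff by (simp add: power2_eq_square)
    qed
    then show "norm (f x) \<le> norm (indicat_real U x + (norm (f x))\<^sup>2)"
      using assms(5)[of x] by (cases "x \<in> U") auto
  qed
qed fact

text \<open>A weighted Young inequality on the bounded set \<open>U\<close>: |f| is at most d/2 +
  |f|^2 / (2 d). The constant part is made small through \<open>d\<close>, the rest by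
  convergence.\<close>

lemma L2_tendsto_imp_L1_tendsto:
  fixes f :: "nat \<Rightarrow> 'a::euclidean_space \<Rightarrow> 'b::euclidean_space"
  assumes U: "bounded U" "open U" and f: "\<And>n. f n \<in> borel_measurable lebesgue"
    "\<And>n. integrable lebesgue (\<lambda>x. (norm (f n x))\<^sup>2)" "\<And>n x. x \<notin> U \<Longrightarrow> f n x = 0"
    and lim: "(\<lambda>n. LINT x|lebesgue. (norm (f n x))\<^sup>2) \<longlonglongrightarrow> 0"
  shows "(\<lambda>n. LINT x|lebesgue. norm (f n x)) \<longlonglongrightarrow> 0"
proof (rule LIMSEQ_I)
  fix e :: real assume e: "e > 0"
  define m where "m = measure lebesgue U"
  have iU: "integrable lebesgue (indicat_real U)"
    by (rule integrable_indicator_bounded_open[OF U])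
  \<comment> \<open>Then \<open>d * m\<close> is at most \<open>e\<close>, and square integrals
    below \<open>e * d\<close> contribute less than e/2; the summand 1 covers
    \<open>m = 0\<close>.\<close>
  define d where "d = e / (m + 1)"
  have m0: "m \<ge> 0" by (simp add: m_def)
  have d: "d > 0" "d * m \<le> e" using e m0 by (auto simp: d_def field_simps)
  obtain N where N: "\<And>n. n \<ge> N \<Longrightarrow> (LINT x|lebesgue. (norm (f n x))\<^sup>2) < e * d"
    using LIMSEQ_D[OF lim, of "e * d"] e d by fastforce
  show "\<exists>no. \<forall>n\<ge>no. norm ((LINT x|lebesgue. norm (f n x)) - 0) < e"
  proof (intro exI allI impI)
    fix n assume n: "n \<ge> N"
    have "(LINT x|lebesgue. norm (f n x)) \<le> (LINT x|lebesgue. d/2 * indicator U x + 1/(2*d) * (norm (f n x))\<^sup>2)"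
    proof (rule integral_mono)
      show "integrable lebesgue (\<lambda>x. norm (f n x))"
        using integrable_of_square_integrable[OF U f(1,2,3)] by simp
      show "integrable lebesgue (\<lambda>x. d/2 * indicator U x + 1/(2*d) * (norm (f n x))\<^sup>2)"
        using iU f(2) by simp
      fix x
      have "norm (f n x) \<le> d/2 + 1/(2*d) * (norm (f n x))\<^sup>2"
      proof -
        have "0 \<le> (norm (f n x) - d)\<^sup>2" by simp
        then have "2 * d * norm (f n x) \<le> d\<^sup>2 + (norm (f n x))\<^sup>2" by (simp add: power2_diff mult_ac)
        then show ?thesis using d by (simp add: field_simps power2_eq_square)
      qed
      then show "norm (f n x) \<le> d/2 * indicator U x + 1/(2*d) * (norm (f n x))\<^sup>2"
        using f(3)[of x n] by (cases "x \<in> U") auto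
    qed
    also have "\<dots> = d/2 * m + 1/(2*d) * (LINT x|lebesgue. (norm (f n x))\<^sup>2)"
      using iU f(2) by (simp add: m_def)
    also have "\<dots> < e"
    proof -
      have "1/(2*d) * (LINT x|lebesgue. (norm (f n x))\<^sup>2) < 1/(2*d) * (e * d)"
        using N[OF n] d by (intro mult_strict_left_mono) auto
      then show ?thesis using d by simp
    qed
    finally show "norm ((LINT x|lebesgue. norm (f n x)) - 0) < e" by simp
  qed
qed

lemma square_integrable_diff:
  fixes f g :: "'a::euclidean_space \<Rightarrow> 'b::euclidean_space"
  assumes "f \<in> borel_measurable lebesgue" "integrable lebesgue (\<lambda>x. (norm (f x))\<^sup>2)"
    "g \<in> borel_measurable lebesgue" "integrable lebesgue (\<lambda>x. (norm (g x))\<^sup>2)"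
  shows "integrable lebesgue (\<lambda>x. (norm (f x - g x))\<^sup>2)"
proof (rule Bochner_Integration.integrable_bound)
  note [measurable] = assms(1,3)
  show "integrable lebesgue (\<lambda>x. 2 * (norm (f x))\<^sup>2 + 2 * (norm (g x))\<^sup>2)" using assms(2,4) by simp
  show "AE x in lebesgue. norm ((norm (f x - g x))\<^sup>2) \<le> norm (2 * (norm (f x))\<^sup>2 + 2 * (norm (g x))\<^sup>2)"
  proof (rule AE_I2)
    fix x
    have "(norm (f x - g x))\<^sup>2 \<le> (norm (f x) + norm (g x))\<^sup>2"
      by (rule power_mono[OF norm_triangle_ineq4]) simp
    also have "\<dots> \<le> 2 * (norm (f x))\<^sup>2 + 2 * (norm (g x))\<^sup>2"
      using zero_le_power2[of "norm (f x) - norm (g x)"] unfolding power2_sum power2_diff by linarith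
    finally show "norm ((norm (f x - g x))\<^sup>2) \<le> norm (2 * (norm (f x))\<^sup>2 + 2 * (norm (g x))\<^sup>2)" by simp
  qed
  show "(\<lambda>x. (norm (f x - g x))\<^sup>2) \<in> borel_measurable lebesgue" by measurable
qed

lemma test_fun_square_integrable:
  fixes \<phi> :: "'a::euclidean_space \<Rightarrow> 'b::euclidean_space"
  assumes "\<phi> \<in> test_fun U" shows "integrable lebesgue (\<lambda>x. (norm (\<phi> x))\<^sup>2)"
proof -
  obtain K where K: "\<And>k. Ck k \<phi>" "compact K" "K \<subseteq> U" "\<And>x. x \<notin> K \<Longrightarrow> \<phi> x = 0"
    using test_funE[OF assms] by metis
  show ?thesis
    by (rule integrable_lebesgueI, rule continuous_compact_support_integrable[OF _ K(2)])
       (use K(4) Ck_imp_continuous[OF K(1)] in \<open>auto intro!: continuous_intros\<close>)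
qed

lemma test_fun_H10:
  fixes \<phi> :: "'a::euclidean_space \<Rightarrow> real"
  assumes U: "open U" and \<phi>: "\<phi> \<in> test_fun U"
  shows "\<phi> \<in> H10 U"
proof -
  have "\<phi> \<in> L2 U"
  proof -
    have eq: "indicator U x *\<^sub>R \<phi> x = \<phi> x" for x using test_fun_zero_outside[OF \<phi>, of x] by (auto simp: indicator_def)
    show ?thesis unfolding L2_iff eq
      using test_fun_square_integrable[OF \<phi>] borel_measurable_lebesgueI[OF test_fun_measurable[OF \<phi>]] by simp
  qed
  moreover have "wgrad U \<phi> \<in> L2 U"
  proof -
    have ae: "AE x in lebesgue. grad \<phi> x = zgrad U \<phi> x" using zgrad_test_fun[OF U \<phi>] by (auto elim: eventually_mono)
    have m: "zgrad U \<phi> \<in> borel_measurable lebesgue"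
      by (rule borel_measurable_lebesgue_AE[OF borel_measurable_lebesgueI[OF test_fun_measurable[OF grad_test_fun[OF \<phi>]]] ae])
    have "integrable lebesgue (\<lambda>x. (norm (zgrad U \<phi> x))\<^sup>2)"
      by (rule integrable_cong_AE_imp[OF test_fun_square_integrable[OF grad_test_fun[OF \<phi>]]])
         (use m ae in \<open>auto elim: eventually_mono\<close>)
    then show ?thesis using m unfolding L2_iff zgrad_def[abs_def] by simp
  qed
  ultimately have "\<phi> \<in> H1 U" using test_fun_weak_gradient[OF \<phi>] by (auto simp: H1_def)
  then show ?thesis unfolding H10_def using \<phi> by (auto intro!: exI[of _ "\<lambda>_. \<phi>"])
qed

text \<open>On a bounded domain the approximation in the Sobolev norm yields approximation in L1 of
  function and gradient, the only form used from here on. The weak gradients of the test functions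
  are exchanged for classical ones on the way.\<close>

lemma
  fixes v :: "'a::euclidean_space \<Rightarrow> real"
  assumes U: "open U" "bounded U" and v: "v \<in> H10 U" "\<And>x. x \<notin> U \<Longrightarrow> v x = 0"
  shows H10_approximation: "\<exists>\<phi>. (\<forall>n. \<phi> n \<in> test_fun U) \<and>
    (\<lambda>n. LINT x|lebesgue. \<bar>v x - \<phi> n x\<bar>) \<longlonglongrightarrow> 0 \<and>
    (\<lambda>n. LINT x|lebesgue. norm (zgrad U v x - grad (\<phi> n) x)) \<longlonglongrightarrow> 0" (is ?A)
    and H10_integrable: "integrable lebesgue v" "integrable lebesgue (zgrad U v)"
    "integrable lebesgue (\<lambda>x. (norm (zgrad U v x))\<^sup>2)"
    and H10_weak_gradient: "is_weak_gradient U v (wgrad U v)"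
proof -
  have H1: "v \<in> L2 U" "wgrad U v \<in> L2 U" "is_weak_gradient U v (wgrad U v)"
    using v(1) wgrad_weak_gradient by (auto simp: H10_def H1_def)
  obtain \<phi> where \<phi>: "\<And>n. \<phi> n \<in> test_fun U"
    and lim: "(\<lambda>n::nat. (LINT x:U|lebesgue. (v x - \<phi> n x)\<^sup>2)
            + (LINT x:U|lebesgue. (norm (wgrad U v x - wgrad U (\<phi> n) x))\<^sup>2)) \<longlonglongrightarrow> 0"
    using v(1) unfolding H10_def by blast
  have eq: "indicator U x *\<^sub>R v x = v x" for x using v(2)[of x] by (auto simp: indicator_def)
  have vm: "v \<in> borel_measurable lebesgue" "integrable lebesgue (\<lambda>x. (norm (v x))\<^sup>2)"
    using H1(1) unfolding L2_iff eq by simp_all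
  have gm: "zgrad U v \<in> borel_measurable lebesgue" "integrable lebesgue (\<lambda>x. (norm (zgrad U v x))\<^sup>2)"
    using H1(2) unfolding L2_iff zgrad_def[abs_def] by simp_all
  have gz: "x \<notin> U \<Longrightarrow> zgrad U v x = 0" for x by (simp add: zgrad_def)
  note pm = borel_measurable_lebesgueI[OF test_fun_measurable[OF \<phi>]]
    and gpm = borel_measurable_lebesgueI[OF test_fun_measurable[OF grad_test_fun[OF \<phi>]]]
  have e1: "(LINT x:U|lebesgue. (v x - \<phi> n x)\<^sup>2) = (LINT x|lebesgue. (norm (v x - \<phi> n x))\<^sup>2)" for n
    unfolding set_lebesgue_integral_def
    by (rule Bochner_Integration.integral_cong) (use v(2) test_fun_zero_outside[OF \<phi>] in \<open>auto simp: indicator_def\<close>)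
  have e2: "(LINT x:U|lebesgue. (norm (wgrad U v x - wgrad U (\<phi> n) x))\<^sup>2) = (LINT x|lebesgue. (norm (zgrad U v x - grad (\<phi> n) x))\<^sup>2)" for n
  proof -
    have "(LINT x:U|lebesgue. (norm (wgrad U v x - wgrad U (\<phi> n) x))\<^sup>2) = (LINT x|lebesgue. (norm (zgrad U v x - zgrad U (\<phi> n) x))\<^sup>2)"
      unfolding set_lebesgue_integral_def
      by (rule Bochner_Integration.integral_cong) (auto simp: indicator_def zgrad_def)
    also have "\<dots> = (LINT x|lebesgue. (norm (zgrad U v x - grad (\<phi> n) x))\<^sup>2)"
    proof (rule integral_cong_AE)
      have ae: "AE x in lebesgue. grad (\<phi> n) x = zgrad U (\<phi> n) x" using zgrad_test_fun[OF U(1) \<phi>[of n]] by (auto elim: eventually_mono)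
      have [measurable]: "zgrad U (\<phi> n) \<in> borel_measurable lebesgue" "zgrad U v \<in> borel_measurable lebesgue"
         "grad (\<phi> n) \<in> borel_measurable lebesgue"
        using borel_measurable_lebesgue_AE[OF gpm ae] gm gpm by auto
      show "(\<lambda>x. (norm (zgrad U v x - zgrad U (\<phi> n) x))\<^sup>2) \<in> borel_measurable lebesgue"
        "(\<lambda>x. (norm (zgrad U v x - grad (\<phi> n) x))\<^sup>2) \<in> borel_measurable lebesgue" by measurable
      show "AE x in lebesgue. (norm (zgrad U v x - zgrad U (\<phi> n) x))\<^sup>2 = (norm (zgrad U v x - grad (\<phi> n) x))\<^sup>2"
        using ae by eventually_elim simp
    qed
    finally show ?thesis .
  qed
  have l1: "(\<lambda>n. LINT x|lebesgue. (norm (v x - \<phi> n x))\<^sup>2) \<longlonglongrightarrow> 0"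
    by (rule tendsto_sandwich[OF _ _ tendsto_const lim[unfolded e1 e2]]) (auto intro!: always_eventually)
  have l2: "(\<lambda>n. LINT x|lebesgue. (norm (zgrad U v x - grad (\<phi> n) x))\<^sup>2) \<longlonglongrightarrow> 0"
    by (rule tendsto_sandwich[OF _ _ tendsto_const lim[unfolded e1 e2]]) (auto intro!: always_eventually)
  have "(\<lambda>n. LINT x|lebesgue. norm (v x - \<phi> n x)) \<longlonglongrightarrow> 0"
    by (rule L2_tendsto_imp_L1_tendsto[OF U(2,1) _ _ _ l1])
       (use v(2) test_fun_zero_outside[OF \<phi>] in \<open>auto intro!: borel_measurable_diff vm pm square_integrable_diff test_fun_square_integrable[OF \<phi>] simp del: real_norm_def\<close>)
  moreover have "(\<lambda>n. LINT x|lebesgue. norm (zgrad U v x - grad (\<phi> n) x)) \<longlonglongrightarrow> 0"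
    by (rule L2_tendsto_imp_L1_tendsto[OF U(2,1) _ _ _ l2])
       (use gz test_fun_grad_zero_outside[OF \<phi>] in \<open>auto intro!: borel_measurable_diff gm gpm square_integrable_diff test_fun_square_integrable[OF grad_test_fun[OF \<phi>]]\<close>)
  ultimately show ?A using \<phi> by (intro exI[of _ \<phi>]) simp
  show "integrable lebesgue v" "integrable lebesgue (zgrad U v)"
    using integrable_of_square_integrable[OF U(2,1) vm v(2)] integrable_of_square_integrable[OF U(2,1) gm gz] by auto
  show "integrable lebesgue (\<lambda>x. (norm (zgrad U v x))\<^sup>2)" by (rule gm(2))
  show "is_weak_gradient U v (wgrad U v)" by (rule H1(3))
qed

lemma abs_integral_diff_le:
  fixes f g :: "'a \<Rightarrow> real"
  assumes "integrable M f" "integrable M g" "integrable M h" "\<And>x. \<bar>f x - g x\<bar> \<le> h x"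
  shows "\<bar>(LINT x|M. f x) - (LINT x|M. g x)\<bar> \<le> (LINT x|M. h x)"
proof -
  have "\<bar>(LINT x|M. f x) - (LINT x|M. g x)\<bar> = \<bar>LINT x|M. f x - g x\<bar>" using assms by simp
  also have "\<dots> \<le> (LINT x|M. \<bar>f x - g x\<bar>)" by (rule integral_abs_bound)
  also have "\<dots> \<le> (LINT x|M. h x)" by (rule integral_mono) (use assms in auto)
  finally show ?thesis .
qed

lemma tendsto_of_abs_diff_le:
  fixes a b :: "nat \<Rightarrow> real"
  assumes "\<And>n. \<bar>a n - l\<bar> \<le> b n" "b \<longlonglongrightarrow> 0"
  shows "a \<longlonglongrightarrow> l"
  by (rule LIM_zero_cancel, rule Lim_null_comparison[OF always_eventually assms(2)]) (simp add: assms(1))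

lemma H10_translation:
  fixes v :: "'a::euclidean_space \<Rightarrow> real"
  assumes U: "open U" "bounded U" and v: "v \<in> H10 U" "\<And>x. x \<notin> U \<Longrightarrow> v x = 0"
  shows "(LINT x|lebesgue. \<bar>v (x + h) - v x\<bar>) \<le> norm h * (LINT x|lebesgue. norm (zgrad U v x))"
proof -
  obtain \<phi> where \<phi>: "\<And>n. \<phi> n \<in> test_fun U"
    "(\<lambda>n. LINT x|lebesgue. \<bar>v x - \<phi> n x\<bar>) \<longlonglongrightarrow> 0"
    "(\<lambda>n. LINT x|lebesgue. norm (zgrad U v x - grad (\<phi> n) x)) \<longlonglongrightarrow> 0"
    using H10_approximation[OF U v] by blast
  have i: "integrable lebesgue v" "integrable lebesgue (zgrad U v)"
    by (rule H10_integrable[OF U v]; assumption)+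
  note ip = test_fun_integrable_lebesgue[OF \<phi>(1)] and ig = test_fun_integrable_lebesgue[OF grad_test_fun[OF \<phi>(1)]]
  have le: "(LINT x|lebesgue. \<bar>v (x + h) - v x\<bar>) \<le> 2 * (LINT x|lebesgue. \<bar>v x - \<phi> n x\<bar>) +
    norm h * ((LINT x|lebesgue. norm (zgrad U v x)) + (LINT x|lebesgue. norm (zgrad U v x - grad (\<phi> n) x)))" for n
  proof -
    have d: "integrable lebesgue (\<lambda>x. \<bar>v x - \<phi> n x\<bar>)" using i(1) ip by auto
    note t = lebesgue_integral_translation[OF i(1), of h] lebesgue_integral_translation[OF ip, of n h]
       lebesgue_integral_translation[OF d, of h]
    have "(LINT x|lebesgue. \<bar>v (x + h) - v x\<bar>) \<le> (LINT x|lebesgue. \<bar>v (x + h) - \<phi> n (x + h)\<bar> + \<bar>\<phi> n (x + h) - \<phi> n x\<bar> + \<bar>v x - \<phi> n x\<bar>)"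
      by (rule integral_mono) (use t(1,3,5) i(1) ip in auto)
    also have "\<dots> = 2 * (LINT x|lebesgue. \<bar>v x - \<phi> n x\<bar>) + (LINT x|lebesgue. \<bar>\<phi> n (x + h) - \<phi> n x\<bar>)"
      using t(1,3,5,6) i(1) ip[of n] d by simp
    also have "(LINT x|lebesgue. \<bar>\<phi> n (x + h) - \<phi> n x\<bar>) \<le> norm h * (LINT x|lebesgue. norm (grad (\<phi> n) x))"
    proof -
      have m: "(\<lambda>x. \<bar>\<phi> n (x + h) - \<phi> n x\<bar>) \<in> borel_measurable borel" "(\<lambda>x. norm (grad (\<phi> n) x)) \<in> borel_measurable borel"
        using test_fun_measurable[OF \<phi>(1)] test_fun_measurable[OF grad_test_fun[OF \<phi>(1)]] by measurable
      show ?thesis unfolding lebesgue_integral_eq_lborel(2)[OF m(1)] lebesgue_integral_eq_lborel(2)[OF m(2)]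
        by (rule test_fun_translation_L1[OF \<phi>(1)])
    qed
    also have "(LINT x|lebesgue. norm (grad (\<phi> n) x)) \<le> (LINT x|lebesgue. norm (zgrad U v x) + norm (zgrad U v x - grad (\<phi> n) x))"
    proof (rule integral_mono)
      show "norm (grad (\<phi> n) x) \<le> norm (zgrad U v x) + norm (zgrad U v x - grad (\<phi> n) x)" for x
        using norm_triangle_ineq4[of "zgrad U v x" "zgrad U v x - grad (\<phi> n) x"] by simp
    qed (use i ig in auto)
    also have "\<dots> = (LINT x|lebesgue. norm (zgrad U v x)) + (LINT x|lebesgue. norm (zgrad U v x - grad (\<phi> n) x))"
      using i ig by simp
    finally show ?thesis by (simp add: mult_left_mono)
  qed
  have "(\<lambda>n. 2 * (LINT x|lebesgue. \<bar>v x - \<phi> n x\<bar>) +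
    norm h * ((LINT x|lebesgue. norm (zgrad U v x)) + (LINT x|lebesgue. norm (zgrad U v x - grad (\<phi> n) x)))) \<longlonglongrightarrow>
     2 * 0 + norm h * ((LINT x|lebesgue. norm (zgrad U v x)) + 0)"
    by (intro tendsto_intros \<phi>(2,3))
  from LIMSEQ_le_const[OF this, of "LINT x|lebesgue. \<bar>v (x + h) - v x\<bar>"] le show ?thesis by auto
qed

text \<open>A translation by \<open>h\<close> longer than any chord moves \<open>U\<close> off
  itself, so |v(x)| is at most |v(x + h) - v(x)|; the translation estimate then gives the diameter
  bound 2 R as constant.\<close>

lemma H10_poincare:
  fixes U :: "'a::euclidean_space set"
  assumes U: "open U" "bounded U"
  obtains D where "D > 0" "\<And>v. v \<in> H10 U \<Longrightarrow> (\<And>x. x \<notin> U \<Longrightarrow> v x = 0) \<Longrightarrow>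
    (LINT x|lebesgue. \<bar>v x\<bar>) \<le> D * (LINT x|lebesgue. norm (zgrad U v x))"
proof -
  obtain R where R: "R > 0" "\<And>x. x \<in> U \<Longrightarrow> norm x < R" using U(2) unfolding bounded_pos_less by blast
  obtain b :: 'a where b: "b \<in> Basis" using nonempty_Basis by blast
  define h where "h = (2 * R) *\<^sub>R b"
  have nh: "norm h = 2 * R" using b R by (simp add: h_def)
  have "(LINT x|lebesgue. \<bar>v x\<bar>) \<le> (2 * R) * (LINT x|lebesgue. norm (zgrad U v x))"
    if v: "v \<in> H10 U" "\<And>x. x \<notin> U \<Longrightarrow> v x = 0" for v
  proof -
    have i: "integrable lebesgue v" by (rule H10_integrable(1)[OF U v])
    have "(LINT x|lebesgue. \<bar>v x\<bar>) \<le> (LINT x|lebesgue. \<bar>v (x + h) - v x\<bar>)"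
    proof (rule integral_mono)
      show "integrable lebesgue (\<lambda>x. \<bar>v (x + h) - v x\<bar>)" using i lebesgue_integral_translation(1)[OF i, of h] by auto
      fix x
      show "\<bar>v x\<bar> \<le> \<bar>v (x + h) - v x\<bar>"
      proof (cases "x \<in> U")
        case True
        have "x + h \<notin> U"
        proof
          assume "x + h \<in> U"
          then show False using R(2)[of "x + h"] R(2)[OF True] norm_triangle_ineq4[of "x + h" x] nh by simp
        qed
        then show ?thesis using v(2) by simp
      qed (use v(2) in simp)
    qed (use i in auto)
    also have "\<dots> \<le> norm h * (LINT x|lebesgue. norm (zgrad U v x))" by (rule H10_translation[OF U v])
    finally show ?thesis using nh by simp
  qed
  then show ?thesis using that[of "2 * R"] R by simp
qed

section \<open>Distributional gradients of Sobolev functions and their limits\<close>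

lemma divergence_continuous:
  fixes \<phi> :: "'a::euclidean_space \<Rightarrow> 'a"
  assumes "\<phi> \<in> test_fun U"
  shows "continuous_on UNIV (divergence \<phi>)" "\<exists>B>0. \<forall>x. \<bar>divergence \<phi> x\<bar> \<le> B"
proof -
  have c: "Ck 0 (\<lambda>x. frechet_derivative \<phi> (at x) b)" if "b \<in> Basis" for b
    by (rule test_fun_Ck[OF test_fun_partial[OF assms that]])
  show cont: "continuous_on UNIV (divergence \<phi>)"
    unfolding divergence_def[abs_def] using c by (auto intro!: continuous_intros)
  obtain K where K: "\<And>k. Ck k \<phi>" "compact K" "K \<subseteq> U" "\<And>x. x \<notin> K \<Longrightarrow> \<phi> x = 0"
    using test_funE[OF assms] by metis
  have z: "divergence \<phi> x = 0" if "x \<notin> K" for x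
    using frechet_derivative_zero_outside[OF compact_imp_closed[OF K(2)] K(4) that] by (simp add: divergence_def)
  obtain B where "B \<ge> 0" "\<And>x. norm (divergence \<phi> x) \<le> B"
    using continuous_compact_support_bounded[OF cont K(2) z] by metis
  then show "\<exists>B>0. \<forall>x. \<bar>divergence \<phi> x\<bar> \<le> B"
    by (intro exI[of _ "B + 1"]) (auto intro: order_trans add_increasing2)
qed

lemma integrable_mult_continuous_bounded:
  fixes f :: "'a::euclidean_space \<Rightarrow> real"
  assumes "integrable lebesgue f" "continuous_on UNIV g" "\<And>x. \<bar>g x\<bar> \<le> B"
  shows "integrable lebesgue (\<lambda>x. f x * g x)"
proof (rule Bochner_Integration.integrable_bound)
  show "integrable lebesgue (\<lambda>x. B * f x)" using assms(1) by simp
  show "AE x in lebesgue. norm (f x * g x) \<le> norm (B * f x)"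
  proof (rule AE_I2)
    fix x
    have "\<bar>f x\<bar> * \<bar>g x\<bar> \<le> \<bar>f x\<bar> * \<bar>B\<bar>" using assms(3)[of x] by (intro mult_left_mono) auto
    then show "norm (f x * g x) \<le> norm (B * f x)" by (simp add: abs_mult mult.commute)
  qed
  show "(\<lambda>x. f x * g x) \<in> borel_measurable lebesgue"
    by (intro borel_measurable_times borel_measurable_integrable[OF assms(1)] borel_measurable_lebesgueI borel_measurable_continuous_onI assms(2))
qed

lemma integrable_inner_test_fun:
  fixes f \<phi> :: "'a::euclidean_space \<Rightarrow> 'a"
  assumes "integrable lebesgue f" "\<phi> \<in> test_fun U" "\<And>x. norm (\<phi> x) \<le> B"
  shows "integrable lebesgue (\<lambda>x. f x \<bullet> \<phi> x)"
proof (rule Bochner_Integration.integrable_bound)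
  show "integrable lebesgue (\<lambda>x. norm (f x) * B)" using assms(1) by simp
  show "AE x in lebesgue. norm (f x \<bullet> \<phi> x) \<le> norm (norm (f x) * B)"
  proof (rule AE_I2)
    fix x
    have "\<bar>f x \<bullet> \<phi> x\<bar> \<le> norm (f x) * norm (\<phi> x)" by (rule Cauchy_Schwarz_ineq2)
    also have "\<dots> \<le> norm (f x) * B" using assms(3) by (intro mult_left_mono) auto
    finally show "norm (f x \<bullet> \<phi> x) \<le> norm (norm (f x) * B)" by simp
  qed
  show "(\<lambda>x. f x \<bullet> \<phi> x) \<in> borel_measurable lebesgue"
    by (intro borel_measurable_inner borel_measurable_integrable[OF assms(1)] borel_measurable_lebesgueI[OF test_fun_measurable[OF assms(2)]])
qed

lemma Ck_inner_const: "Ck k \<phi> \<Longrightarrow> Ck k (\<lambda>x. \<phi> x \<bullet> b)"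
  by (intro Ck_inner Ck_const)

lemma dist_grad_test_fun:
  fixes \<psi> :: "'a::euclidean_space \<Rightarrow> real" and \<phi> :: "'a \<Rightarrow> 'a"
  assumes \<psi>: "\<psi> \<in> test_fun U" and \<phi>: "\<phi> \<in> test_fun V"
  shows "dist_grad \<psi> \<phi> = (LINT x|lebesgue. grad \<psi> x \<bullet> \<phi> x)"
proof -
  have comp: "frechet_derivative (\<lambda>x. \<phi> x \<bullet> b) (at x) b = frechet_derivative \<phi> (at x) b \<bullet> b" for x b
  proof -
    have "((\<lambda>x. \<phi> x \<bullet> b) has_derivative (\<lambda>h. frechet_derivative \<phi> (at x) h \<bullet> b)) (at x)"
      by (rule has_derivative_inner_left[OF test_fun_has_derivative[OF \<phi>]])
    from fun_cong[OF frechet_derivative_at[OF this], of b] show ?thesis by simp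
  qed
  have cb: "Ck k (\<lambda>x. \<phi> x \<bullet> b)" for k b by (rule Ck_inner_const[OF test_fun_Ck[OF \<phi>]])
  have m1: "(\<lambda>x. \<psi> x * divergence \<phi> x) \<in> borel_measurable borel"
    by (intro borel_measurable_times test_fun_measurable[OF \<psi>] borel_measurable_continuous_onI divergence_continuous(1)[OF \<phi>])
  have m2: "(\<lambda>x. grad \<psi> x \<bullet> \<phi> x) \<in> borel_measurable borel"
    by (intro borel_measurable_inner test_fun_measurable[OF grad_test_fun[OF \<psi>]] test_fun_measurable[OF \<phi>])
  have i: "integrable lborel (\<lambda>x. \<psi> x * frechet_derivative (\<lambda>x. \<phi> x \<bullet> b) (at x) b)"
     "integrable lborel (\<lambda>x. frechet_derivative \<psi> (at x) b * (\<phi> x \<bullet> b))" if b: "b \<in> Basis" for b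
    by (rule test_fun_integrable[OF test_fun_mult[OF \<psi> Ck_Suc_partial[OF cb b]]],
        rule test_fun_integrable[OF test_fun_mult[OF test_fun_partial[OF \<psi> b] cb]])
  have "(LINT x|lborel. \<psi> x * divergence \<phi> x) = (LINT x|lborel. (\<Sum>b\<in>Basis. \<psi> x * frechet_derivative (\<lambda>x. \<phi> x \<bullet> b) (at x) b))"
    unfolding divergence_def comp by (simp add: sum_distrib_left)
  also have "\<dots> = (\<Sum>b\<in>Basis. (LINT x|lborel. \<psi> x * frechet_derivative (\<lambda>x. \<phi> x \<bullet> b) (at x) b))"
    by (rule Bochner_Integration.integral_sum) (rule i(1))
  also have "\<dots> = (\<Sum>b\<in>Basis. - (LINT x|lborel. frechet_derivative \<psi> (at x) b * (\<phi> x \<bullet> b)))"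
    by (rule sum.cong[OF refl]) (rule integration_by_parts[OF \<psi> cb])
  also have "\<dots> = - (LINT x|lborel. (\<Sum>b\<in>Basis. frechet_derivative \<psi> (at x) b * (\<phi> x \<bullet> b)))"
    unfolding sum_negf by (subst Bochner_Integration.integral_sum) (auto intro: i(2))
  also have "\<dots> = - (LINT x|lborel. grad \<psi> x \<bullet> \<phi> x)"
    by (simp add: grad_def inner_sum_left inner_commute[of "\<phi> _"])
  finally show ?thesis
    unfolding dist_grad_def lebesgue_integral_eq_lborel(2)[OF m1] lebesgue_integral_eq_lborel(2)[OF m2] by simp
qed

text \<open>The divergence of a fixed test field is bounded, so L1 convergence is enough. Applied
  field by field, this is the lower semicontinuity of \<open>TV\<close>.\<close>

lemma dist_grad_tendsto:
  fixes v :: "'a::euclidean_space \<Rightarrow> real" and \<phi> :: "'a \<Rightarrow> 'a"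
  assumes \<phi>: "\<phi> \<in> test_fun V" and i: "integrable lebesgue v" "\<And>n. integrable lebesgue (w n)"
    and lim: "(\<lambda>n. LINT x|lebesgue. \<bar>w n x - v x\<bar>) \<longlonglongrightarrow> 0"
  shows "(\<lambda>n. dist_grad (w n) \<phi>) \<longlonglongrightarrow> dist_grad v \<phi>"
proof -
  obtain B where B: "B > 0" "\<And>x. \<bar>divergence \<phi> x\<bar> \<le> B" using divergence_continuous(2)[OF \<phi>] by blast
  note im = integrable_mult_continuous_bounded[OF _ divergence_continuous(1)[OF \<phi>] B(2)]
  have "\<bar>dist_grad (w n) \<phi> - dist_grad v \<phi>\<bar> \<le> (LINT x|lebesgue. \<bar>w n x - v x\<bar>) * B" for n
  proof -
    have "\<bar>(LINT x|lebesgue. w n x * divergence \<phi> x) - (LINT x|lebesgue. v x * divergence \<phi> x)\<bar> \<le> (LINT x|lebesgue. \<bar>w n x - v x\<bar> * B)"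
    proof (rule abs_integral_diff_le[OF im[OF i(2)] im[OF i(1)]])
      show "integrable lebesgue (\<lambda>x. \<bar>w n x - v x\<bar> * B)" using i by auto
      show "\<bar>w n x * divergence \<phi> x - v x * divergence \<phi> x\<bar> \<le> \<bar>w n x - v x\<bar> * B" for x
        unfolding left_diff_distrib[symmetric] abs_mult by (rule mult_left_mono[OF B(2)]) simp
    qed
    then show ?thesis by (simp add: dist_grad_def abs_minus_commute)
  qed
  then show ?thesis by (rule tendsto_of_abs_diff_le[OF _ tendsto_mult_left_zero[OF lim]])
qed

text \<open>The test field need not vanish on the boundary of \<open>U\<close>: membership in
  \<open>H10\<close> ensures that extension by 0 adds no singular part to the gradient
  there.\<close>

lemma H10_dist_grad:
  fixes v :: "'a::euclidean_space \<Rightarrow> real" and \<phi> :: "'a \<Rightarrow> 'a"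
  assumes U: "open U" "bounded U" and v: "v \<in> H10 U" "\<And>x. x \<notin> U \<Longrightarrow> v x = 0" and \<phi>: "\<phi> \<in> test_fun V"
  shows "dist_grad v \<phi> = (LINT x|lebesgue. zgrad U v x \<bullet> \<phi> x)"
proof -
  obtain \<psi> where \<psi>: "\<And>n. \<psi> n \<in> test_fun U"
    "(\<lambda>n. LINT x|lebesgue. \<bar>v x - \<psi> n x\<bar>) \<longlonglongrightarrow> 0"
    "(\<lambda>n. LINT x|lebesgue. norm (zgrad U v x - grad (\<psi> n) x)) \<longlonglongrightarrow> 0"
    using H10_approximation[OF U v] by blast
  have i: "integrable lebesgue v" "integrable lebesgue (zgrad U v)"
    by (rule H10_integrable[OF U v]; assumption)+
  obtain B where B: "B > 0" "\<And>x. norm (\<phi> x) \<le> B" using test_fun_bounded[OF \<phi>] by blast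
  note ig = test_fun_integrable_lebesgue[OF grad_test_fun[OF \<psi>(1)]]
  have eq: "\<bar>\<psi> n x - v x\<bar> = \<bar>v x - \<psi> n x\<bar>" for n x by simp
  have "(\<lambda>n. dist_grad (\<psi> n) \<phi>) \<longlonglongrightarrow> dist_grad v \<phi>"
    by (rule dist_grad_tendsto[OF \<phi> i(1) test_fun_integrable_lebesgue[OF \<psi>(1)]]) (unfold eq, rule \<psi>(2))
  moreover have "(\<lambda>n. dist_grad (\<psi> n) \<phi>) \<longlonglongrightarrow> (LINT x|lebesgue. zgrad U v x \<bullet> \<phi> x)"
  proof -
    have "\<bar>dist_grad (\<psi> n) \<phi> - (LINT x|lebesgue. zgrad U v x \<bullet> \<phi> x)\<bar> \<le> (LINT x|lebesgue. norm (zgrad U v x - grad (\<psi> n) x)) * B" for n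
    proof -
      have "\<bar>(LINT x|lebesgue. grad (\<psi> n) x \<bullet> \<phi> x) - (LINT x|lebesgue. zgrad U v x \<bullet> \<phi> x)\<bar> \<le> (LINT x|lebesgue. norm (zgrad U v x - grad (\<psi> n) x) * B)"
      proof (rule abs_integral_diff_le[OF integrable_inner_test_fun[OF ig \<phi> B(2)] integrable_inner_test_fun[OF i(2) \<phi> B(2)]])
        show "integrable lebesgue (\<lambda>x. norm (zgrad U v x - grad (\<psi> n) x) * B)" using i ig by auto
        fix x
        have "\<bar>grad (\<psi> n) x \<bullet> \<phi> x - zgrad U v x \<bullet> \<phi> x\<bar> \<le> norm (grad (\<psi> n) x - zgrad U v x) * norm (\<phi> x)"
          unfolding inner_diff_left[symmetric] by (rule Cauchy_Schwarz_ineq2)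
        also have "\<dots> \<le> norm (grad (\<psi> n) x - zgrad U v x) * B" using B(2) by (intro mult_left_mono) auto
        finally show "\<bar>grad (\<psi> n) x \<bullet> \<phi> x - zgrad U v x \<bullet> \<phi> x\<bar> \<le> norm (zgrad U v x - grad (\<psi> n) x) * B"
          by (simp add: norm_minus_commute)
      qed
      then show ?thesis by (simp add: dist_grad_test_fun[OF \<psi>(1) \<phi>])
    qed
    then show ?thesis by (rule tendsto_of_abs_diff_le[OF _ tendsto_mult_left_zero[OF \<psi>(3)]])
  qed
  ultimately show ?thesis by (rule LIMSEQ_unique)
qed

lemma zgrad_cmult:
  assumes "open U" "is_weak_gradient U v g"
  shows "AE x in lebesgue. zgrad U (\<lambda>x. c * v x) x = c *\<^sub>R zgrad U v x"
  using wgrad_AE_eq[OF assms(1) weak_gradient_cmult[OF wgrad_weak_gradient[OF assms(2)], of c]]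
  by eventually_elim (auto simp: zgrad_def indicator_def)

lemma L2_cmult:
  fixes f :: "'a::euclidean_space \<Rightarrow> 'b::euclidean_space"
  assumes "f \<in> L2 U" shows "(\<lambda>x. c *\<^sub>R f x) \<in> L2 U"
proof -
  have eq: "indicator U x *\<^sub>R c *\<^sub>R f x = c *\<^sub>R (indicator U x *\<^sub>R f x)" for x by simp
  show ?thesis using assms unfolding L2_iff eq
    by (auto simp: power_mult_distrib simp del: scaleR_scaleR intro: borel_measurable_scaleR)
qed

lemma L2_AE_cong:
  fixes f g :: "'a::euclidean_space \<Rightarrow> 'b::euclidean_space"
  assumes "f \<in> L2 U" and ae: "AE x in lebesgue. x \<in> U \<longrightarrow> f x = g x" shows "g \<in> L2 U"
proof -
  have ae': "AE x in lebesgue. indicator U x *\<^sub>R f x = indicator U x *\<^sub>R g x"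
    using ae by eventually_elim (auto simp: indicator_def)
  have f: "(\<lambda>x. indicator U x *\<^sub>R f x) \<in> borel_measurable lebesgue"
    "integrable lebesgue (\<lambda>x. (norm (indicator U x *\<^sub>R f x))\<^sup>2)" using assms(1) unfolding L2_iff by auto
  have m: "(\<lambda>x. indicator U x *\<^sub>R g x) \<in> borel_measurable lebesgue"
    by (rule borel_measurable_lebesgue_AE[OF f(1) ae'])
  have "integrable lebesgue (\<lambda>x. (norm (indicator U x *\<^sub>R g x))\<^sup>2)"
  proof (rule integrable_cong_AE_imp[OF f(2)])
    show "(\<lambda>x. (norm (indicator U x *\<^sub>R g x))\<^sup>2) \<in> borel_measurable lebesgue"
      using m by measurable
    show "AE x in lebesgue. (norm (indicator U x *\<^sub>R f x))\<^sup>2 = (norm (indicator U x *\<^sub>R g x))\<^sup>2"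
      using ae' by (rule eventually_mono) metis
  qed
  with m show ?thesis unfolding L2_iff by simp
qed

lemma H10_cmult:
  fixes v :: "'a::euclidean_space \<Rightarrow> real"
  assumes U: "open U" and v: "v \<in> H10 U"
  shows "(\<lambda>x. c * v x) \<in> H10 U"
proof -
  have H1: "v \<in> L2 U" "wgrad U v \<in> L2 U" "is_weak_gradient U v (wgrad U v)"
    using v wgrad_weak_gradient by (auto simp: H10_def H1_def)
  have w: "is_weak_gradient U (\<lambda>x. c * v x) (\<lambda>x. c *\<^sub>R wgrad U v x)" by (rule weak_gradient_cmult[OF H1(3)])
  note ae = wgrad_AE_eq[OF U w]
  have "wgrad U (\<lambda>x. c * v x) \<in> L2 U"
    by (rule L2_AE_cong[OF L2_cmult[OF H1(2), of c]]) (use ae in \<open>auto elim: eventually_mono\<close>)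
  then have 1: "(\<lambda>x. c * v x) \<in> H1 U" using L2_cmult[OF H1(1), of c] w by (auto simp: H1_def)
  obtain \<phi> where \<phi>: "\<And>n. \<phi> n \<in> test_fun U"
    and lim: "(\<lambda>n::nat. (LINT x:U|lebesgue. (v x - \<phi> n x)\<^sup>2)
            + (LINT x:U|lebesgue. (norm (wgrad U v x - wgrad U (\<phi> n) x))\<^sup>2)) \<longlonglongrightarrow> 0"
    using v unfolding H10_def by blast
  have e1: "(LINT x:U|lebesgue. (c * v x - c * \<phi> n x)\<^sup>2) = c\<^sup>2 * (LINT x:U|lebesgue. (v x - \<phi> n x)\<^sup>2)" for n
    unfolding right_diff_distrib[symmetric] power_mult_distrib by simp
  have z2: "(\<lambda>x. indicator U x *\<^sub>R wgrad U u x) \<in> borel_measurable lebesgue" if "u \<in> H10 U" for u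
    using that unfolding H10_def H1_def by (simp add: L2_iff)
  have zs: "zgrad U u \<in> borel_measurable lebesgue" if "u \<in> H10 U" for u
    using z2[OF that] unfolding zgrad_def[abs_def] .
  have conv: "(LINT x:U|lebesgue. (norm (wgrad U f x - wgrad U g x))\<^sup>2) = (LINT x|lebesgue. (norm (zgrad U f x - zgrad U g x))\<^sup>2)" for f g
    unfolding set_lebesgue_integral_def
    by (rule Bochner_Integration.integral_cong) (auto simp: indicator_def zgrad_def)
  have e2: "(LINT x:U|lebesgue. (norm (wgrad U (\<lambda>x. c * v x) x - wgrad U (\<lambda>x. c * \<phi> n x) x))\<^sup>2)
     = c\<^sup>2 * (LINT x:U|lebesgue. (norm (wgrad U v x - wgrad U (\<phi> n) x))\<^sup>2)" for n
  proof -
    have a1: "AE x in lebesgue. c *\<^sub>R zgrad U v x = zgrad U (\<lambda>x. c * v x) x"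
      using zgrad_cmult[OF U H1(3), of c] by (auto elim: eventually_mono)
    have a2: "AE x in lebesgue. c *\<^sub>R zgrad U (\<phi> n) x = zgrad U (\<lambda>x. c * \<phi> n x) x"
      using zgrad_cmult[OF U test_fun_weak_gradient[OF \<phi>[of n]], of c] by (auto elim: eventually_mono)
    note m1 = zs[OF v] zs[OF test_fun_H10[OF U \<phi>[of n]]]
    have mc: "(\<lambda>x. c *\<^sub>R zgrad U v x) \<in> borel_measurable lebesgue" "(\<lambda>x. c *\<^sub>R zgrad U (\<phi> n) x) \<in> borel_measurable lebesgue"
      using m1 by (auto intro!: borel_measurable_scaleR)
    note m2 = borel_measurable_lebesgue_AE[OF mc(1) a1] borel_measurable_lebesgue_AE[OF mc(2) a2]
    have "(LINT x|lebesgue. (norm (zgrad U (\<lambda>x. c * v x) x - zgrad U (\<lambda>x. c * \<phi> n x) x))\<^sup>2) =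
      (LINT x|lebesgue. c\<^sup>2 * (norm (zgrad U v x - zgrad U (\<phi> n) x))\<^sup>2)"
    proof (rule integral_cong_AE)
      show "AE x in lebesgue. (norm (zgrad U (\<lambda>x. c * v x) x - zgrad U (\<lambda>x. c * \<phi> n x) x))\<^sup>2 = c\<^sup>2 * (norm (zgrad U v x - zgrad U (\<phi> n) x))\<^sup>2"
        using a1 a2
      proof eventually_elim
        fix x assume a: "c *\<^sub>R zgrad U v x = zgrad U (\<lambda>x. c * v x) x" "c *\<^sub>R zgrad U (\<phi> n) x = zgrad U (\<lambda>x. c * \<phi> n x) x"
        show "(norm (zgrad U (\<lambda>x. c * v x) x - zgrad U (\<lambda>x. c * \<phi> n x) x))\<^sup>2 = c\<^sup>2 * (norm (zgrad U v x - zgrad U (\<phi> n) x))\<^sup>2"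
          unfolding a[symmetric] scaleR_diff_right[symmetric] by (simp add: power_mult_distrib)
      qed
    qed (use m1 m2 in measurable)
    then show ?thesis unfolding conv by simp
  qed
  have "(\<lambda>n. c\<^sup>2 * ((LINT x:U|lebesgue. (v x - \<phi> n x)\<^sup>2)
            + (LINT x:U|lebesgue. (norm (wgrad U v x - wgrad U (\<phi> n) x))\<^sup>2))) \<longlonglongrightarrow> 0"
    by (rule tendsto_mult_right_zero[OF lim])
  then show ?thesis
    unfolding H10_def using 1 test_fun_cmult[OF \<phi>]
    by (auto intro!: exI[of _ "\<lambda>n x. c * \<phi> n x"] simp: e1 e2 ring_distribs)
qed

subsection \<open>Compactness in the space of integrable functions\<close>

text \<open>An almost everywhere convergent subsequence supplies the limit; Fatou's lemma then
  carries the Cauchy bound over to the distance of the whole sequence from it.\<close>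

lemma L1_Cauchy_convergent:
  fixes f :: "nat \<Rightarrow> 'a \<Rightarrow> real"
  assumes f: "\<And>n. integrable M (f n)"
    and C: "\<And>e. e > 0 \<Longrightarrow> \<exists>N. \<forall>i\<ge>N. \<forall>j\<ge>N. (LINT x|M. \<bar>f i x - f j x\<bar>) < e"
  obtains g where "integrable M g" "(\<lambda>n. LINT x|M. \<bar>f n x - g x\<bar>) \<longlonglongrightarrow> 0"
proof -
  note [measurable] = borel_measurable_integrable[OF f]
  have C': "\<exists>N. \<forall>i\<ge>N. \<forall>j\<ge>N. (LINT x|M. norm (f i x - f j x)) < e" if "e > 0" for e
    using C[OF that] unfolding real_norm_def .
  obtain r where r: "strict_mono (r :: nat \<Rightarrow> nat)" "AE x in M. Cauchy (\<lambda>i. f (r i) x)"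
    using cauchy_L1_AE_cauchy_subseq[of M f, OF f C'] by blast
  define g where "g x = lim (\<lambda>i. f (r i) x)" for x
  have gm[measurable]: "g \<in> borel_measurable M"
    unfolding g_def[abs_def] by (rule borel_measurable_lim_metric) measurable
  have glim: "AE x in M. (\<lambda>i. f (r i) x) \<longlonglongrightarrow> g x"
    using r(2) by eventually_elim (simp add: g_def Cauchy_convergent_iff convergent_LIMSEQ_iff)
  have F: "(\<integral>\<^sup>+x. ennreal \<bar>f n x - g x\<bar> \<partial>M) \<le> ennreal e"
    if N: "\<forall>i\<ge>N. \<forall>j\<ge>N. (LINT x|M. \<bar>f i x - f j x\<bar>) < e" and n: "n \<ge> N" for n N e
  proof -
    have "(\<integral>\<^sup>+x. ennreal \<bar>f n x - g x\<bar> \<partial>M) = (\<integral>\<^sup>+x. liminf (\<lambda>i. ennreal \<bar>f n x - f (r i) x\<bar>) \<partial>M)"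
    proof (rule nn_integral_cong_AE)
      show "AE x in M. ennreal \<bar>f n x - g x\<bar> = liminf (\<lambda>i. ennreal \<bar>f n x - f (r i) x\<bar>)"
        using glim
      proof eventually_elim
        fix x assume "(\<lambda>i. f (r i) x) \<longlonglongrightarrow> g x"
        then have "(\<lambda>i. ennreal \<bar>f n x - f (r i) x\<bar>) \<longlonglongrightarrow> ennreal \<bar>f n x - g x\<bar>"
          by (intro tendsto_ennrealI tendsto_rabs tendsto_diff tendsto_const)
        then show "ennreal \<bar>f n x - g x\<bar> = liminf (\<lambda>i. ennreal \<bar>f n x - f (r i) x\<bar>)"
          using lim_imp_Liminf[OF sequentially_bot] by metis
      qed
    qed
    also have "\<dots> \<le> liminf (\<lambda>i. \<integral>\<^sup>+x. ennreal \<bar>f n x - f (r i) x\<bar> \<partial>M)"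
      by (rule nn_integral_liminf) measurable
    also have "\<dots> \<le> ennreal e"
    proof -
      have "eventually (\<lambda>i. (\<integral>\<^sup>+x. ennreal \<bar>f n x - f (r i) x\<bar> \<partial>M) \<le> ennreal e) sequentially"
        unfolding eventually_sequentially
      proof (intro exI allI impI)
        fix i assume "i \<ge> N"
        then have "r i \<ge> N" using seq_suble[OF r(1), of i] by simp
        then have "(LINT x|M. \<bar>f n x - f (r i) x\<bar>) < e" using N n by blast
        then show "(\<integral>\<^sup>+x. ennreal \<bar>f n x - f (r i) x\<bar> \<partial>M) \<le> ennreal e"
          using f by (subst nn_integral_eq_integral) (auto intro!: ennreal_leI)
      qed
      then show ?thesis by (intro Liminf_le) auto
    qed
    finally show ?thesis .
  qed
  have gi: "integrable M g"
  proof -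
    obtain N where N: "\<forall>i\<ge>N. \<forall>j\<ge>N. (LINT x|M. \<bar>f i x - f j x\<bar>) < 1" using C[of 1] by auto
    have "(\<integral>\<^sup>+x. ennreal \<bar>f N x - g x\<bar> \<partial>M) < \<infinity>"
      using F[OF N order_refl] by (rule order.strict_trans1) simp
    then have "integrable M (\<lambda>x. f N x - g x)" by (intro integrableI_bounded) auto
    from Bochner_Integration.integrable_diff[OF f[of N] this] show ?thesis by simp
  qed
  show ?thesis
  proof (rule that[OF gi], rule LIMSEQ_I)
    fix e :: real assume e: "e > 0"
    obtain N where N: "\<forall>i\<ge>N. \<forall>j\<ge>N. (LINT x|M. \<bar>f i x - f j x\<bar>) < e/2" using C[of "e/2"] e by auto
    have "(LINT x|M. \<bar>f n x - g x\<bar>) < e" if "n \<ge> N" for n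
    proof -
      have "ennreal (LINT x|M. \<bar>f n x - g x\<bar>) \<le> ennreal (e/2)"
        using F[OF N that] f gi by (subst (asm) nn_integral_eq_integral) auto
      then show ?thesis using e by simp
    qed
    then show "\<exists>no. \<forall>n\<ge>no. norm ((LINT x|M. \<bar>f n x - g x\<bar>) - 0) < e" by auto
  qed
qed

lemma conv_uniform_bounds:
  fixes f :: "'a::euclidean_space \<Rightarrow> real"
  assumes f: "integrable lborel f" and \<eta>: "\<eta> \<in> test_fun UNIV" and B: "\<And>x. \<bar>\<eta> x\<bar> \<le> B"
    and L: "\<And>x y. \<bar>\<eta> x - \<eta> y\<bar> \<le> L * norm (x - y)"
  shows "\<bar>conv f \<eta> x\<bar> \<le> B * (LINT x|lborel. \<bar>f x\<bar>)"
    "\<bar>conv f \<eta> x - conv f \<eta> y\<bar> \<le> L * norm (x - y) * (LINT x|lborel. \<bar>f x\<bar>)"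
proof -
  have i: "integrable lborel (\<lambda>y. \<eta> (x - y) * f y)" for x using conv_integrable[OF f \<eta>, of x] by simp
  have "\<bar>conv f \<eta> x\<bar> \<le> (LINT y|lborel. \<bar>\<eta> (x - y) * f y\<bar>)" unfolding conv_def real_scaleR_def by (rule integral_abs_bound)
  also have "\<dots> \<le> (LINT y|lborel. B * \<bar>f y\<bar>)"
    by (rule integral_mono[OF integrable_abs[OF i]]) (use f B in \<open>auto simp: abs_mult intro!: mult_right_mono\<close>)
  finally show "\<bar>conv f \<eta> x\<bar> \<le> B * (LINT x|lborel. \<bar>f x\<bar>)" by simp
  have "\<bar>conv f \<eta> x - conv f \<eta> y\<bar> \<le> (LINT z|lborel. L * norm (x - y) * \<bar>f z\<bar>)"
    unfolding conv_def real_scaleR_def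
  proof (rule abs_integral_diff_le[OF i i])
    show "integrable lborel (\<lambda>z. L * norm (x - y) * \<bar>f z\<bar>)" using f by auto
    show "\<bar>\<eta> (x - z) * f z - \<eta> (y - z) * f z\<bar> \<le> L * norm (x - y) * \<bar>f z\<bar>" for z
      using L[of "x - z" "y - z"] unfolding left_diff_distrib[symmetric] abs_mult by (intro mult_right_mono) auto
  qed
  then show "\<bar>conv f \<eta> x - conv f \<eta> y\<bar> \<le> L * norm (x - y) * (LINT x|lborel. \<bar>f x\<bar>)" by simp
qed

text \<open>At a fixed scale, a bound in L1 makes the mollifications uniformly bounded and uniformly
  Lipschitz on a common compact set, so Arzela-Ascoli applies; uniform closeness there gives
  closeness in L1.\<close>

lemma mollified_subsequence_Cauchy:
  fixes f :: "nat \<Rightarrow> 'a::euclidean_space \<Rightarrow> real"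
  assumes f: "\<And>n. integrable lborel (f n)" "\<And>n x. R < norm x \<Longrightarrow> f n x = 0"
    and D: "\<And>n. (LINT x|lborel. \<bar>f n x\<bar>) \<le> D" and m: "mollifier \<epsilon> \<eta>"
  shows "\<exists>k. strict_mono (k::nat\<Rightarrow>nat) \<and> (\<forall>e>0. \<exists>N. \<forall>i\<ge>N. \<forall>j\<ge>N. (LINT x|lborel. \<bar>conv (f (k i)) \<eta> x - conv (f (k j)) \<eta> x\<bar>) < e)"
proof -
  note \<eta> = mollifier_test_fun[OF m]
  obtain B where B: "B > 0" "\<And>x. norm (\<eta> x) \<le> B" using test_fun_bounded[OF \<eta>] by blast
  obtain L where L: "L > 0" "\<And>x y. \<bar>\<eta> x - \<eta> y\<bar> \<le> L * norm (x - y)" using test_fun_lipschitz[OF \<eta>] by blast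
  define F where "F n = conv (f n) \<eta>" for n
  define K where "K = cball (0::'a) (R + \<epsilon>)"
  have D0: "D \<ge> 0" by (rule order_trans[OF _ D[of 0]]) simp
  have Fb: "\<bar>F n x\<bar> \<le> B * D" and Fl: "\<bar>F n x - F n y\<bar> \<le> L * D * norm (x - y)" for n x y
  proof -
    note cb = conv_uniform_bounds[OF f(1)[of n] \<eta> B(2)[unfolded real_norm_def] L(2)]
    show "\<bar>F n x\<bar> \<le> B * D" unfolding F_def
      by (rule order_trans[OF cb(1)]) (use B D in \<open>simp add: mult_left_mono\<close>)
    have "L * norm (x - y) * (LINT x|lborel. \<bar>f n x\<bar>) \<le> L * norm (x - y) * D"
      by (rule mult_left_mono[OF D]) (use L(1) in simp)
    then show "\<bar>F n x - F n y\<bar> \<le> L * D * norm (x - y)" unfolding F_def using cb(2)[of x y] by (simp add: mult_ac)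
  qed
  have Fz: "F n x = 0" if "x \<notin> K" for n x
  proof -
    have "f n y = 0" if "norm (x - y) < \<epsilon>" for y
      using norm_triangle_ineq2[of x y] that \<open>x \<notin> K\<close> by (intro f(2)) (simp add: K_def)
    then show ?thesis unfolding F_def
      by (intro conv_local[OF m]) (use borel_measurable_integrable[OF f(1)] in auto)
  qed
  have Fi: "integrable lborel (F n)" for n
    by (rule continuous_compact_support_integrable[of _ K])
       (use Fz Ck_imp_continuous[OF Ck_conv[OF f(1) \<eta>]] in \<open>auto simp: K_def F_def\<close>)
  obtain g k where gk: "continuous_on K g" "strict_mono (k :: nat \<Rightarrow> nat)"
    "\<And>e. 0 < e \<Longrightarrow> \<exists>N. \<forall>n x. n \<ge> N \<and> x \<in> K \<longrightarrow> norm (F (k n) x - g x) < e"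
  proof (rule Arzela_Ascoli[of K F "B * D"])
    show "compact K" by (simp add: K_def)
    show "norm (F n x) \<le> B * D" for n x using Fb by simp
    fix x :: 'a and e :: real assume e: "0 < e"
    define d where "d = e / (L * D + 1)"
    have LD: "L * D \<ge> 0" using L D0 by simp
    have d0: "d > 0" using e LD by (simp add: d_def)
    have "norm (F n x - F n y) < e" if "norm (x - y) < d" for n y
    proof -
      have "norm (F n x - F n y) \<le> (L * D) * norm (x - y)" using Fl by simp
      also have "\<dots> \<le> (L * D) * d" using that LD by (intro mult_left_mono) auto
      also have "\<dots> < (L * D + 1) * d" using d0 by (simp add: ring_distribs)
      also have "\<dots> = e" using LD by (simp add: d_def)
      finally show ?thesis .
    qed
    with d0 show "\<exists>d>0. \<forall>n y. y \<in> K \<and> norm (x - y) < d \<longrightarrow> norm (F n x - F n y) < e" by blast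
  qed blast
  have Kf: "emeasure lborel K < \<infinity>" unfolding K_def by (rule emeasure_bounded_finite) simp
  define \<mu> where "\<mu> = measure lborel K"
  have "\<exists>N. \<forall>i\<ge>N. \<forall>j\<ge>N. (LINT x|lborel. \<bar>F (k i) x - F (k j) x\<bar>) < e" if e: "e > 0" for e
  proof -
    define d where "d = e / (2 * (\<mu> + 1))"
    have mu: "\<mu> \<ge> 0" by (simp add: \<mu>_def)
    have d: "d > 0" using e mu by (simp add: d_def)
    obtain N where N: "\<And>n x. n \<ge> N \<Longrightarrow> x \<in> K \<Longrightarrow> norm (F (k n) x - g x) < d" using gk(3)[OF d] by blast
    have "(LINT x|lborel. \<bar>F (k i) x - F (k j) x\<bar>) < e" if ij: "i \<ge> N" "j \<ge> N" for i j
    proof -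
      have iK: "integrable lborel (\<lambda>x. indicator K x * (2 * d))" using Kf by (auto simp: K_def)
      have "(LINT x|lborel. \<bar>F (k i) x - F (k j) x\<bar>) \<le> (LINT x|lborel. indicator K x * (2 * d))"
      proof (rule integral_mono[OF _ iK])
        show "integrable lborel (\<lambda>x. \<bar>F (k i) x - F (k j) x\<bar>)" using Fi by auto
        fix x
        show "\<bar>F (k i) x - F (k j) x\<bar> \<le> indicator K x * (2 * d)"
        proof (cases "x \<in> K")
          case True
          then show ?thesis using N[OF ij(1) True] N[OF ij(2) True] by simp
        qed (simp add: Fz)
      qed
      also have "\<dots> = \<mu> * (2 * d)" using Kf by (simp add: \<mu>_def K_def)
      also have "\<dots> < (\<mu> + 1) * (2 * d)" using d by (simp add: ring_distribs)
      also have "\<dots> = e" using mu by (simp add: d_def divide_simps)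
      finally show ?thesis .
    qed
    then show ?thesis by blast
  qed
  then show ?thesis using gk(2) unfolding F_def by blast
qed

text \<open>A form of the Kolmogorov-Riesz theorem. The translation bound puts every
  \<open>f n\<close> within the mollification radius of its mollification, uniformly in
  \<open>n\<close>; a diagonal sequence is Cauchy at all scales, hence Cauchy itself.\<close>

lemma L1_compact_lborel:
  fixes f :: "nat \<Rightarrow> 'a::euclidean_space \<Rightarrow> real"
  assumes f: "\<And>n. integrable lborel (f n)" "\<And>n x. R < norm x \<Longrightarrow> f n x = 0"
    and D: "\<And>n. (LINT x|lborel. \<bar>f n x\<bar>) \<le> D"
    and tr: "\<And>n h. (LINT x|lborel. \<bar>f n (x + h) - f n x\<bar>) \<le> norm h"
  obtains r g where "strict_mono (r::nat\<Rightarrow>nat)" "integrable lborel g" "(\<lambda>n. LINT x|lborel. \<bar>f (r n) x - g x\<bar>) \<longlonglongrightarrow> 0"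
proof -
  define \<epsilon> where "\<epsilon> j = 1 / real (Suc j)" for j
  have \<epsilon>: "\<epsilon> j > 0" for j by (simp add: \<epsilon>_def)
  have "\<forall>j. \<exists>\<eta> :: 'a \<Rightarrow> real. mollifier (\<epsilon> j) \<eta>" using mollifier_exists[OF \<epsilon>] by metis
  then obtain \<eta> :: "nat \<Rightarrow> 'a \<Rightarrow> real" where m: "\<And>j. mollifier (\<epsilon> j) (\<eta> j)" by metis
  define P where "P j s \<longleftrightarrow> (\<forall>e>0. \<exists>N. \<forall>i\<ge>N. \<forall>i'\<ge>N. (LINT x|lborel. \<bar>conv (f (s i)) (\<eta> j) x - conv (f (s i')) (\<eta> j) x\<bar>) < e)" for j and s :: "nat \<Rightarrow> nat"
  interpret subseqs P
  proof
    fix n and s :: "nat \<Rightarrow> nat" assume "strict_mono s"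
    show "\<exists>r'. strict_mono r' \<and> P n (s \<circ> r')"
      using mollified_subsequence_Cauchy[of "\<lambda>i. f (s i)" R D "\<epsilon> n" "\<eta> n", OF f(1) f(2) D m] by (simp add: P_def)
  qed
  have Pd: "P j (diagseq \<circ> ((+) (Suc j)))" for j
  proof (rule diagseq_holds)
    fix r s :: "nat \<Rightarrow> nat" and n assume r: "strict_mono r" and "P n s"
    show "P n (s \<circ> r)" unfolding P_def
    proof (intro allI impI)
      fix e :: real assume "e > 0"
      then obtain N where N: "\<forall>i\<ge>N. \<forall>i'\<ge>N. (LINT x|lborel. \<bar>conv (f (s i)) (\<eta> n) x - conv (f (s i')) (\<eta> n) x\<bar>) < e"
        using \<open>P n s\<close> unfolding P_def by blast
      show "\<exists>N. \<forall>i\<ge>N. \<forall>i'\<ge>N. (LINT x|lborel. \<bar>conv (f ((s \<circ> r) i)) (\<eta> n) x - conv (f ((s \<circ> r) i')) (\<eta> n) x\<bar>) < e"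
        using N seq_suble[OF r] by (intro exI[of _ N]) (auto intro: order_trans)
    qed
  qed
  define d where "d = diagseq"
  have "\<exists>N. \<forall>i\<ge>N. \<forall>i'\<ge>N. (LINT x|lborel. \<bar>f (d i) x - f (d i') x\<bar>) < e" if e: "e > 0" for e
  proof -
    obtain j where j: "\<epsilon> j < e / 4" unfolding \<epsilon>_def using e nat_approx_posE[of "e/4"] by auto
    \<comment> \<open>The diagonal sequence is a subsequence of the one selected for scale
      \<open>j\<close> only beyond index \<open>Suc j\<close>, hence the offset.\<close>
    obtain N where N: "\<forall>i\<ge>N. \<forall>i'\<ge>N. (LINT x|lborel. \<bar>conv (f (d (Suc j + i))) (\<eta> j) x - conv (f (d (Suc j + i'))) (\<eta> j) x\<bar>) < e / 4"
      using Pd[of j] e unfolding P_def d_def by (auto dest!: spec[of _ "e/4"])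
    have ap: "integrable lborel (conv (f n) (\<eta> j))" "(LINT x|lborel. \<bar>conv (f n) (\<eta> j) x - f n x\<bar>) \<le> \<epsilon> j" for n
    proof -
      have t: "(LINT x|lborel. \<bar>f n (x + z) - f n x\<bar>) \<le> \<epsilon> j" if "norm z < \<epsilon> j" for z
        using tr[of n z] that by simp
      show "integrable lborel (conv (f n) (\<eta> j))" "(LINT x|lborel. \<bar>conv (f n) (\<eta> j) x - f n x\<bar>) \<le> \<epsilon> j"
        using conv_sub_norm_le[OF m f(1) t \<epsilon>] by auto
    qed
    have "(LINT x|lborel. \<bar>f (d i) x - f (d i') x\<bar>) < e" if i: "i \<ge> Suc j + N" "i' \<ge> Suc j + N" for i i'
    proof -
      let ?F = "\<lambda>i. conv (f (d i)) (\<eta> j)"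
      have "(LINT x|lborel. \<bar>f (d i) x - f (d i') x\<bar>) \<le> (LINT x|lborel. \<bar>?F i x - f (d i) x\<bar> + \<bar>?F i x - ?F i' x\<bar> + \<bar>?F i' x - f (d i') x\<bar>)"
        by (rule integral_mono) (use f(1) ap(1) in auto)
      also have "\<dots> = (LINT x|lborel. \<bar>?F i x - f (d i) x\<bar>) + (LINT x|lborel. \<bar>?F i x - ?F i' x\<bar>) + (LINT x|lborel. \<bar>?F i' x - f (d i') x\<bar>)"
        using f(1) ap(1) by simp
      also have "\<dots> < e"
      proof -
        have "(LINT x|lborel. \<bar>?F i x - ?F i' x\<bar>) < e / 4"
          using N[rule_format, of "i - Suc j" "i' - Suc j"] i by simp
        then show ?thesis using ap(2)[of "d i"] ap(2)[of "d i'"] j e by linarith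
      qed
      finally show ?thesis .
    qed
    then show ?thesis by blast
  qed
  from L1_Cauchy_convergent[of lborel "\<lambda>i. f (d i)", OF f(1) this]
  obtain g where "integrable lborel g" "(\<lambda>n. LINT x|lborel. \<bar>f (d n) x - g x\<bar>) \<longlonglongrightarrow> 0" by blast
  moreover have "strict_mono d" unfolding d_def by (rule subseq_diagseq)
  ultimately show ?thesis using that by blast
qed

text \<open>Borel representatives vanish off \<open>U\<close> only almost everywhere; cutting them
  off to a ball restores the pointwise support condition of the Borel version.\<close>

lemma L1_compact:
  fixes f :: "nat \<Rightarrow> 'a::euclidean_space \<Rightarrow> real"
  assumes U: "bounded U" and f: "\<And>n. integrable lebesgue (f n)" "\<And>n x. x \<notin> U \<Longrightarrow> f n x = 0"
    and D: "\<And>n. (LINT x|lebesgue. \<bar>f n x\<bar>) \<le> D"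
    and tr: "\<And>n h. (LINT x|lebesgue. \<bar>f n (x + h) - f n x\<bar>) \<le> norm h"
  obtains r g where "strict_mono (r::nat\<Rightarrow>nat)" "integrable lebesgue g" "(\<lambda>n. LINT x|lebesgue. \<bar>f (r n) x - g x\<bar>) \<longlonglongrightarrow> 0"
proof -
  obtain R where R: "\<And>x. x \<in> U \<Longrightarrow> norm x \<le> R" using U unfolding bounded_iff by blast
  have "\<exists>f'. integrable lborel f' \<and> (AE x in lebesgue. f n x = f' x)" for n
    using lebesgue_borel_representative[OF f(1)] by metis
  then obtain f0 where f0: "\<And>n. integrable lborel (f0 n)" "\<And>n. AE x in lebesgue. f n x = f0 n x" by metis
  define f' where "f' n x = indicator (cball 0 R) x * f0 n x" for n x
  have f'i: "integrable lborel (f' n)" for n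
    unfolding f'_def[abs_def] using integrable_mult_indicator[OF _ f0(1), of "cball 0 R" n] by simp
  have f'z: "f' n x = 0" if "R < norm x" for n x using that by (simp add: f'_def)
  have ae: "AE x in lebesgue. f n x = f' n x" for n
    using f0(2)[of n] by eventually_elim (use f(2) R in \<open>force simp: f'_def indicator_def\<close>)
  have m: "f' n \<in> borel_measurable borel" for n using borel_measurable_integrable[OF f'i] by simp
  note [measurable] = m borel_measurable_lebesgueI[OF m] borel_measurable_integrable[OF f(1)]
  have "(LINT x|lborel. \<bar>f' n x\<bar>) \<le> D" for n
  proof -
    have "(LINT x|lborel. \<bar>f' n x\<bar>) = (LINT x|lebesgue. \<bar>f' n x\<bar>)"
      by (rule lebesgue_integral_eq_lborel(2)[symmetric]) measurable
    also have "\<dots> = (LINT x|lebesgue. \<bar>f n x\<bar>)"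
      by (rule integral_cong_AE) (measurable, use ae[of n] in \<open>auto elim: eventually_mono\<close>)
    finally show ?thesis using D by simp
  qed
  moreover have "(LINT x|lborel. \<bar>f' n (x + h) - f' n x\<bar>) \<le> norm h" for n h
  proof -
    have m2: "(\<lambda>x. \<bar>f' n (x + h) - f' n x\<bar>) \<in> borel_measurable borel" by measurable
    have m3: "(\<lambda>x. f n (x + h)) \<in> borel_measurable lebesgue"
      by (rule borel_measurable_integrable[OF lebesgue_integral_translation(1)[OF f(1)]])
    have "(LINT x|lborel. \<bar>f' n (x + h) - f' n x\<bar>) = (LINT x|lebesgue. \<bar>f' n (x + h) - f' n x\<bar>)"
      by (rule lebesgue_integral_eq_lborel(2)[symmetric, OF m2])
    also have "\<dots> = (LINT x|lebesgue. \<bar>f n (x + h) - f n x\<bar>)"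
    proof (rule integral_cong_AE[OF borel_measurable_lebesgueI[OF m2]])
      show "(\<lambda>x. \<bar>f n (x + h) - f n x\<bar>) \<in> borel_measurable lebesgue" using m3 by measurable
      show "AE x in lebesgue. \<bar>f' n (x + h) - f' n x\<bar> = \<bar>f n (x + h) - f n x\<bar>"
        using ae[of n] lebesgue_AE_translation[OF ae[of n], of h] by eventually_elim simp
    qed
    finally show ?thesis using tr by simp
  qed
  ultimately obtain r g where rg: "strict_mono (r::nat\<Rightarrow>nat)" "integrable lborel g" "(\<lambda>n. LINT x|lborel. \<bar>f' (r n) x - g x\<bar>) \<longlonglongrightarrow> 0"
    using L1_compact_lborel[of f' R D] f'i f'z by blast
  have [measurable]: "g \<in> borel_measurable borel" "g \<in> borel_measurable lebesgue"
    using borel_measurable_integrable[OF rg(2)] borel_measurable_lebesgueI by auto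
  have "(LINT x|lborel. \<bar>f' (r n) x - g x\<bar>) = (LINT x|lebesgue. \<bar>f (r n) x - g x\<bar>)" for n
  proof -
    have "(LINT x|lborel. \<bar>f' (r n) x - g x\<bar>) = (LINT x|lebesgue. \<bar>f' (r n) x - g x\<bar>)"
      by (rule lebesgue_integral_eq_lborel(2)[symmetric]) measurable
    also have "\<dots> = (LINT x|lebesgue. \<bar>f (r n) x - g x\<bar>)"
      by (rule integral_cong_AE) (measurable, use ae[of "r n"] in \<open>auto elim: eventually_mono\<close>)
    finally show ?thesis .
  qed
  then show ?thesis using that[OF rg(1) integrable_lebesgueI[OF rg(2)]] rg(3) by simp
qed

subsection \<open>The variational problem\<close>

lemma dist_grad_cmult: "dist_grad (\<lambda>x. c * v x) \<phi> = c * dist_grad v \<phi>"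
  by (simp add: dist_grad_def mult.assoc)

lemma dist_grad_representative:
  fixes u u' :: "'a::euclidean_space \<Rightarrow> real"
  assumes u: "integrable lebesgue u" and u': "integrable lborel u'" and ae: "AE x in lebesgue. u x = u' x"
    and \<phi>: "\<phi> \<in> test_fun V"
  shows "dist_grad u \<phi> = - (LINT x|lborel. u' x * divergence \<phi> x)"
proof -
  have d[measurable]: "divergence \<phi> \<in> borel_measurable borel" by (rule borel_measurable_continuous_onI[OF divergence_continuous(1)[OF \<phi>]])
  have [measurable]: "u' \<in> borel_measurable borel" using borel_measurable_integrable[OF u'] by simp
  have m: "(\<lambda>x. u' x * divergence \<phi> x) \<in> borel_measurable borel" by measurable
  have "(LINT x|lebesgue. u x * divergence \<phi> x) = (LINT x|lebesgue. u' x * divergence \<phi> x)"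
  proof (rule integral_cong_AE[OF _ borel_measurable_lebesgueI[OF m]])
    show "(\<lambda>x. u x * divergence \<phi> x) \<in> borel_measurable lebesgue"
      by (intro borel_measurable_times borel_measurable_integrable[OF u] borel_measurable_lebesgueI[OF d])
    show "AE x in lebesgue. u x * divergence \<phi> x = u' x * divergence \<phi> x" using ae by eventually_elim simp
  qed
  then show ?thesis by (simp add: dist_grad_def lebesgue_integral_eq_lborel(2)[OF m])
qed

lemma divergence_scaleR_Basis:
  fixes \<psi> :: "'a::euclidean_space \<Rightarrow> real"
  assumes \<psi>: "\<psi> \<in> test_fun V" and b: "b \<in> Basis"
  shows "(\<lambda>x. \<psi> x *\<^sub>R b) \<in> test_fun V" "divergence (\<lambda>x. \<psi> x *\<^sub>R b) x = frechet_derivative \<psi> (at x) b"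
proof -
  show "(\<lambda>x. \<psi> x *\<^sub>R b) \<in> test_fun V"
    using \<psi> by (elim test_funE, intro test_funI) (auto intro: Ck_scaleR Ck_const)
  have "((\<lambda>x. \<psi> x *\<^sub>R b) has_derivative (\<lambda>h. frechet_derivative \<psi> (at x) h *\<^sub>R b)) (at x)"
    by (rule has_derivative_scaleR_left[OF test_fun_has_derivative[OF \<psi>]])
  then have fd: "frechet_derivative (\<lambda>x. \<psi> x *\<^sub>R b) (at x) = (\<lambda>h. frechet_derivative \<psi> (at x) h *\<^sub>R b)"
    by (rule frechet_derivative_at[symmetric])
  have "divergence (\<lambda>x. \<psi> x *\<^sub>R b) x = (\<Sum>c\<in>Basis. if c = b then frechet_derivative \<psi> (at x) c else 0)"
    unfolding divergence_def fd by (rule sum.cong) (auto simp: inner_Basis b)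
  then show "divergence (\<lambda>x. \<psi> x *\<^sub>R b) x = frechet_derivative \<psi> (at x) b" using b by simp
qed

lemma TV_leI:
  assumes "\<And>\<phi>. \<phi> \<in> test_fun UNIV \<Longrightarrow> (\<And>x. norm (\<phi> x) \<le> 1) \<Longrightarrow> dist_grad v \<phi> \<le> C"
  shows "TV v \<le> ereal C"
  unfolding TV_def by (rule SUP_least) (use assms in auto)

lemma dist_grad_le_TV:
  assumes "TV v = ereal C" "\<phi> \<in> test_fun UNIV" "\<And>x. norm (\<phi> x) \<le> 1"
  shows "dist_grad v \<phi> \<le> C"
proof -
  have "ereal (dist_grad v \<phi>) \<le> TV v" unfolding TV_def by (rule SUP_upper) (use assms in auto)
  then show ?thesis using assms(1) by simp
qed

lemma TV_nonneg: "0 \<le> TV v"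
proof -
  have z: "(\<lambda>x. 0) \<in> test_fun UNIV" by (rule test_funI[of _ "{}"]) (auto intro: Ck_const)
  have "ereal (dist_grad v (\<lambda>x. 0)) \<le> TV v" unfolding TV_def by (rule SUP_upper) (use z in auto)
  then show ?thesis by (simp add: dist_grad_def divergence_def frechet_derivative_const zero_ereal_def)
qed

lemma closure_solid_subset:
  fixes \<Omega> S :: "'a::euclidean_space set"
  assumes "S \<subseteq> \<Omega>" "frontier S \<inter> frontier \<Omega> = {}" "open \<Omega>"
  shows "closure S \<subseteq> \<Omega>"
  using assms closure_mono[OF assms(1)] closure_Un_frontier[of S] frontier_def[of \<Omega>] interior_open[OF assms(3)]
  by blast

section \<open>The geometric setting and the admissible velocities\<close>

locale flow_geometry =
  fixes \<Omega> S :: "'a::euclidean_space set"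
  assumes bounded: "bounded \<Omega>" and lip: "strongly_lipschitz \<Omega>" "strongly_lipschitz S"
    and sub: "S \<subseteq> \<Omega>" and ne: "S \<noteq> {}" and frontiers: "frontier S \<inter> frontier \<Omega> = {}"
begin

lemma open_domain: "open \<Omega>" and open_solid: "open S"
  using lip by (auto intro: strongly_lipschitz_open)

lemma sets_lebesgue: "\<Omega> \<in> sets lebesgue" "S \<in> sets lebesgue"
  using open_domain open_solid by auto

lemma measure_solid_pos: "measure lebesgue S > 0"
proof -
  obtain x r where r: "r > 0" "ball x r \<subseteq> S" using ne open_solid open_contains_ball by blast
  have "S \<in> lmeasurable" by (rule lmeasurable_open[OF bounded_subset[OF bounded sub] open_solid])
  then have "measure lebesgue (ball x r) \<le> measure lebesgue S"
    by (intro measure_mono_fmeasurable r(2)) auto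
  moreover have "measure lebesgue (ball x r) > 0" using content_ball_pos[OF r(1), of x] by simp
  ultimately show ?thesis by linarith
qed

text \<open>If the closure of the solid filled \<Omega>, it would be a nonempty bounded set that is
  both open and closed. The ball is the place for bump functions that change the mean value without
  touching the solid.\<close>

lemma fluid_ball:
  obtains x r where "r > 0" "cball x r \<subseteq> \<Omega>" "cball x r \<inter> S = {}"
proof -
  have cl: "closure S \<subseteq> \<Omega>" by (rule closure_solid_subset[OF sub frontiers open_domain])
  have "\<Omega> \<noteq> closure S"
  proof
    assume "\<Omega> = closure S"
    then have "open (closure S)" "closed (closure S)" using open_domain by auto
    then have "closure S = {} \<or> closure S = UNIV" using clopen[of "closure S"] by blast
    moreover have "closure S \<noteq> UNIV"
      using bounded_closure[OF bounded_subset[OF bounded sub]] not_bounded_UNIV by auto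
    ultimately show False using ne by simp
  qed
  then obtain x where "x \<in> \<Omega> - closure S" using cl by blast
  moreover have "open (\<Omega> - closure S)" using open_domain by auto
  ultimately obtain r where "r > 0" "cball x r \<subseteq> \<Omega> - closure S" using open_contains_cball by blast
  then show ?thesis using that[of r x] closure_subset[of S] by blast
qed

lemma H_diamondD:
  assumes "v \<in> H_diamond \<Omega> S"
  shows "v \<in> H10 \<Omega>" "\<And>x. x \<notin> \<Omega> \<Longrightarrow> v x = 0" "(LINT x|lebesgue. v x) = 0"
    "AE x in lebesgue. x \<in> S \<longrightarrow> zgrad \<Omega> v x = 0"
    "integrable lebesgue v" "integrable lebesgue (zgrad \<Omega> v)" "integrable lebesgue (\<lambda>x. (norm (zgrad \<Omega> v x))\<^sup>2)"
    "is_weak_gradient \<Omega> v (wgrad \<Omega> v)"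
proof -
  show 1: "v \<in> H10 \<Omega>" and 2: "\<And>x. x \<notin> \<Omega> \<Longrightarrow> v x = 0"
    using assms by (auto simp: H_diamond_def)
  have "(LINT x:\<Omega>|lebesgue. v x) = (LINT x|lebesgue. v x)"
    unfolding set_lebesgue_integral_def
    by (rule Bochner_Integration.integral_cong) (use 2 in \<open>auto simp: indicator_def\<close>)
  then show "(LINT x|lebesgue. v x) = 0" using assms by (simp add: H_diamond_def)
  have "AE x in lebesgue. x \<in> S \<longrightarrow> wgrad \<Omega> v x = 0" using assms by (simp add: H_diamond_def)
  then show "AE x in lebesgue. x \<in> S \<longrightarrow> zgrad \<Omega> v x = 0" by eventually_elim (simp add: zgrad_def)
  show "integrable lebesgue v" "integrable lebesgue (zgrad \<Omega> v)" "integrable lebesgue (\<lambda>x. (norm (zgrad \<Omega> v x))\<^sup>2)"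
    "is_weak_gradient \<Omega> v (wgrad \<Omega> v)"
    by (rule H10_integrable[OF open_domain bounded 1] H10_weak_gradient[OF open_domain bounded 1]; fact 2)+
qed

lemma test_fun_H_diamond:
  assumes \<phi>: "\<phi> \<in> test_fun \<Omega>" "(LINT x|lborel. \<phi> x) = 0" "\<And>x. x \<in> S \<Longrightarrow> grad \<phi> x = 0"
  shows "\<phi> \<in> H_diamond \<Omega> S" "(LINT x|lebesgue. norm (zgrad \<Omega> \<phi> x)) = (LINT x|lborel. norm (grad \<phi> x))"
proof -
  have z: "x \<notin> \<Omega> \<Longrightarrow> \<phi> x = 0" for x by (rule test_fun_zero_outside[OF \<phi>(1)])
  have "(LINT x:\<Omega>|lebesgue. \<phi> x) = (LINT x|lebesgue. \<phi> x)"
    unfolding set_lebesgue_integral_def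
    by (rule Bochner_Integration.integral_cong) (use z in \<open>auto simp: indicator_def\<close>)
  also have "\<dots> = 0" using \<phi>(2) lebesgue_integral_eq_lborel(2)[OF test_fun_measurable[OF \<phi>(1)]] by simp
  finally have "(LINT x:\<Omega>|lebesgue. \<phi> x) = 0" .
  moreover have "AE x in lebesgue. x \<in> S \<longrightarrow> wgrad \<Omega> \<phi> x = 0"
    using wgrad_AE_eq[OF open_domain test_fun_weak_gradient[OF \<phi>(1)]]
    by eventually_elim (use \<phi>(3) sub in auto)
  ultimately show "\<phi> \<in> H_diamond \<Omega> S"
    unfolding H_diamond_def using test_fun_H10[OF open_domain \<phi>(1)] z by simp
  have m: "(\<lambda>x. norm (grad \<phi> x)) \<in> borel_measurable borel" using test_fun_measurable[OF grad_test_fun[OF \<phi>(1)]] by measurable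
  have ae: "AE x in lebesgue. grad \<phi> x = zgrad \<Omega> \<phi> x" using zgrad_test_fun[OF open_domain \<phi>(1)] by (auto elim: eventually_mono)
  have m2: "zgrad \<Omega> \<phi> \<in> borel_measurable lebesgue"
    by (rule borel_measurable_lebesgue_AE[OF borel_measurable_lebesgueI[OF test_fun_measurable[OF grad_test_fun[OF \<phi>(1)]]] ae])
  have "(LINT x|lebesgue. norm (zgrad \<Omega> \<phi> x)) = (LINT x|lebesgue. norm (grad \<phi> x))"
    by (rule integral_cong_AE) (use m2 borel_measurable_lebesgueI[OF m] ae in \<open>auto elim: eventually_mono\<close>)
  also have "\<dots> = (LINT x|lborel. norm (grad \<phi> x))" by (rule lebesgue_integral_eq_lborel(2)[OF m])
  finally show "(LINT x|lebesgue. norm (zgrad \<Omega> \<phi> x)) = (LINT x|lborel. norm (grad \<phi> x))" .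
qed

lemma H_diamond_cmult:
  assumes "v \<in> H_diamond \<Omega> S"
  shows "(\<lambda>x. c * v x) \<in> H_diamond \<Omega> S"
    "AE x in lebesgue. zgrad \<Omega> (\<lambda>x. c * v x) x = c *\<^sub>R zgrad \<Omega> v x"
proof -
  note v = H_diamondD[OF assms]
  show ae: "AE x in lebesgue. zgrad \<Omega> (\<lambda>x. c * v x) x = c *\<^sub>R zgrad \<Omega> v x"
    by (rule zgrad_cmult[OF open_domain v(8)])
  have "AE x in lebesgue. x \<in> S \<longrightarrow> wgrad \<Omega> (\<lambda>x. c * v x) x = 0"
    using ae v(4) by eventually_elim (use sub in \<open>auto simp: zgrad_def\<close>)
  moreover have "(LINT x:\<Omega>|lebesgue. c * v x) = 0" using assms by (simp add: H_diamond_def)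
  ultimately show "(\<lambda>x. c * v x) \<in> H_diamond \<Omega> S"
    unfolding H_diamond_def using H10_cmult[OF open_domain v(1)] v(2) by simp
qed

section \<open>Gradient mass, energy and load of a velocity\<close>

definition grad_L1 :: "('a \<Rightarrow> real) \<Rightarrow> real" where "grad_L1 v = (LINT x|lebesgue. norm (zgrad \<Omega> v x))"
definition grad_energy :: "('a \<Rightarrow> real) \<Rightarrow> real" where "grad_energy v = (LINT x|lebesgue. (norm (zgrad \<Omega> v x))\<^sup>2)"
definition load :: "('a \<Rightarrow> real) \<Rightarrow> real" where "load v = (LINT x:S|lebesgue. v x)"

lemma grad_L1_nonneg: "grad_L1 v \<ge> 0" and grad_energy_nonneg: "grad_energy v \<ge> 0" by (simp_all add: grad_L1_def grad_energy_def)

lemma grad_L1_eq: "(LINT x:\<Omega>|lebesgue. norm (wgrad \<Omega> v x)) = grad_L1 v"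
  and grad_energy_eq: "(LINT x:\<Omega>|lebesgue. (norm (wgrad \<Omega> v x))\<^sup>2) = grad_energy v"
  unfolding grad_L1_def grad_energy_def set_lebesgue_integral_def
  by (rule Bochner_Integration.integral_cong; auto simp: indicator_def zgrad_def)+

lemma fluid_eq:
  assumes "v \<in> H_diamond \<Omega> S"
  shows "(LINT x:\<Omega> - S|lebesgue. norm (wgrad \<Omega> v x)) = grad_L1 v"
    "(LINT x:\<Omega> - S|lebesgue. (norm (wgrad \<Omega> v x))\<^sup>2) = grad_energy v"
proof -
  note v = H_diamondD[OF assms]
  have m: "zgrad \<Omega> v \<in> borel_measurable lebesgue" using v(6) by (rule borel_measurable_integrable)
  have FS: "\<Omega> - S \<in> sets lebesgue" using sets_lebesgue by auto
  have e: "indicator (\<Omega> - S) x *\<^sub>R norm (wgrad \<Omega> v x) = indicator (\<Omega> - S) x * norm (zgrad \<Omega> v x)"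
    "indicator (\<Omega> - S) x *\<^sub>R (norm (wgrad \<Omega> v x))\<^sup>2 = indicator (\<Omega> - S) x * (norm (zgrad \<Omega> v x))\<^sup>2" for x
    by (auto simp: indicator_def zgrad_def)
  have [measurable]: "indicat_real (\<Omega> - S) \<in> borel_measurable lebesgue" using FS by simp
  note [measurable] = m
  show "(LINT x:\<Omega> - S|lebesgue. norm (wgrad \<Omega> v x)) = grad_L1 v" "(LINT x:\<Omega> - S|lebesgue. (norm (wgrad \<Omega> v x))\<^sup>2) = grad_energy v"
    unfolding set_lebesgue_integral_def e grad_L1_def grad_energy_def
  proof -
    have ae: "AE x in lebesgue. x \<notin> \<Omega> - S \<longrightarrow> zgrad \<Omega> v x = 0"
      using v(4) by eventually_elim (auto simp: zgrad_def)
    show "(LINT x|lebesgue. indicator (\<Omega> - S) x * norm (zgrad \<Omega> v x)) = (LINT x|lebesgue. norm (zgrad \<Omega> v x))"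
    proof (rule integral_cong_AE)
      show "AE x in lebesgue. indicator (\<Omega> - S) x * norm (zgrad \<Omega> v x) = norm (zgrad \<Omega> v x)"
        using ae by eventually_elim (auto simp: indicator_def)
    qed measurable
    show "(LINT x|lebesgue. indicator (\<Omega> - S) x * (norm (zgrad \<Omega> v x))\<^sup>2) = (LINT x|lebesgue. (norm (zgrad \<Omega> v x))\<^sup>2)"
    proof (rule integral_cong_AE)
      show "AE x in lebesgue. indicator (\<Omega> - S) x * (norm (zgrad \<Omega> v x))\<^sup>2 = (norm (zgrad \<Omega> v x))\<^sup>2"
        using ae by eventually_elim (auto simp: indicator_def)
    qed measurable
  qed
qed

lemma G_eq: "v \<in> H_diamond \<Omega> S \<Longrightarrow> G_diamond \<Omega> S Y v = 1/2 * grad_energy v + Y * grad_L1 v - load v"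
  by (simp add: G_diamond_def fluid_eq load_def)

lemma functionals_cmult:
  assumes "v \<in> H_diamond \<Omega> S"
  shows "grad_L1 (\<lambda>x. c * v x) = \<bar>c\<bar> * grad_L1 v" "grad_energy (\<lambda>x. c * v x) = c\<^sup>2 * grad_energy v" "load (\<lambda>x. c * v x) = c * load v"
proof -
  note ae = H_diamond_cmult(2)[OF assms, of c]
  have [measurable]: "zgrad \<Omega> v \<in> borel_measurable lebesgue" "zgrad \<Omega> (\<lambda>x. c * v x) \<in> borel_measurable lebesgue"
    using H_diamondD(6)[OF assms] H_diamondD(6)[OF H_diamond_cmult(1)[OF assms, of c]] borel_measurable_integrable by auto
  have "grad_L1 (\<lambda>x. c * v x) = (LINT x|lebesgue. \<bar>c\<bar> * norm (zgrad \<Omega> v x))" unfolding grad_L1_def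
  proof (rule integral_cong_AE)
    show "AE x in lebesgue. norm (zgrad \<Omega> (\<lambda>x. c * v x) x) = \<bar>c\<bar> * norm (zgrad \<Omega> v x)"
      using ae by eventually_elim simp
  qed measurable
  then show "grad_L1 (\<lambda>x. c * v x) = \<bar>c\<bar> * grad_L1 v" by (simp add: grad_L1_def)
  have "grad_energy (\<lambda>x. c * v x) = (LINT x|lebesgue. c\<^sup>2 * (norm (zgrad \<Omega> v x))\<^sup>2)" unfolding grad_energy_def
  proof (rule integral_cong_AE)
    show "AE x in lebesgue. (norm (zgrad \<Omega> (\<lambda>x. c * v x) x))\<^sup>2 = c\<^sup>2 * (norm (zgrad \<Omega> v x))\<^sup>2"
      using ae by eventually_elim (simp add: power_mult_distrib)
  qed measurable
  then show "grad_energy (\<lambda>x. c * v x) = c\<^sup>2 * grad_energy v" by (simp add: grad_energy_def)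
  show "load (\<lambda>x. c * v x) = c * load v" by (simp add: load_def)
qed

lemma load_le_L1:
  assumes "integrable lebesgue v" shows "\<bar>load v\<bar> \<le> (LINT x|lebesgue. \<bar>v x\<bar>)"
proof -
  have i: "integrable lebesgue (\<lambda>x. indicator S x * v x)"
    by (rule integrable_mult_indicator_lebesgue[OF sets_lebesgue(2) assms])
  have "\<bar>load v\<bar> \<le> (LINT x|lebesgue. \<bar>indicator S x * v x\<bar>)"
    unfolding load_def set_lebesgue_integral_def real_scaleR_def by (rule integral_abs_bound)
  also have "\<dots> \<le> (LINT x|lebesgue. \<bar>v x\<bar>)"
    by (rule integral_mono[OF integrable_abs[OF i] integrable_abs[OF assms]]) (auto simp: indicator_def)
  finally show ?thesis .
qed

lemma load_diff:
  assumes "integrable lebesgue v" "integrable lebesgue w" shows "load (\<lambda>x. v x - w x) = load v - load w"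
  using integrable_mult_indicator_lebesgue[OF sets_lebesgue(2) assms(1)] integrable_mult_indicator_lebesgue[OF sets_lebesgue(2) assms(2)]
  by (simp add: load_def set_lebesgue_integral_def right_diff_distrib)

lemma poincare:
  obtains D where "D > 0" "\<And>v. v \<in> H_diamond \<Omega> S \<Longrightarrow> (LINT x|lebesgue. \<bar>v x\<bar>) \<le> D * grad_L1 v"
proof -
  obtain D where D: "D > 0" "\<And>v. v \<in> H10 \<Omega> \<Longrightarrow> (\<And>x. x \<notin> \<Omega> \<Longrightarrow> v x = 0) \<Longrightarrow>
    (LINT x|lebesgue. \<bar>v x\<bar>) \<le> D * (LINT x|lebesgue. norm (zgrad \<Omega> v x))"
    using H10_poincare[OF open_domain bounded] by metis
  have "(LINT x|lebesgue. \<bar>v x\<bar>) \<le> D * grad_L1 v" if "v \<in> H_diamond \<Omega> S" for v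
    unfolding grad_L1_def by (rule D(2)[OF H_diamondD(1,2)[OF that]])
  with D(1) that show ?thesis by blast
qed

abbreviation Yc :: real where "Yc \<equiv> critical_yield \<Omega> S"

lemma Yc_eq: "Yc = (SUP w\<in>{w \<in> H_diamond \<Omega> S. grad_L1 w \<noteq> 0}. load w / grad_L1 w)"
  unfolding critical_yield_def grad_L1_eq load_def ..

text \<open>The Poincare inequality bounds the quotients, so the real supremum is a true upper
  bound. It also settles functions of zero gradient mass, which the supremum leaves out: their load
  is 0.\<close>

lemma load_le_Yc:
  assumes w: "w \<in> H_diamond \<Omega> S" shows "load w \<le> Yc * grad_L1 w"
proof -
  obtain D where D: "D > 0" "\<And>v. v \<in> H_diamond \<Omega> S \<Longrightarrow> (LINT x|lebesgue. \<bar>v x\<bar>) \<le> D * grad_L1 v"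
    using poincare by metis
  have le: "\<bar>load v\<bar> \<le> D * grad_L1 v" if "v \<in> H_diamond \<Omega> S" for v
    using load_le_L1[OF H_diamondD(5)[OF that]] D(2)[OF that] by linarith
  show ?thesis
  proof (cases "grad_L1 w = 0")
    case True
    then show ?thesis using le[OF w] by simp
  next
    case False
    then have pos: "grad_L1 w > 0" using grad_L1_nonneg[of w] by simp
    have "load w / grad_L1 w \<le> Yc" unfolding Yc_eq
    proof (rule cSUP_upper)
      show "bdd_above ((\<lambda>w. load w / grad_L1 w) ` {w \<in> H_diamond \<Omega> S. grad_L1 w \<noteq> 0})"
      proof (rule bdd_aboveI2)
        fix v assume v: "v \<in> {w \<in> H_diamond \<Omega> S. grad_L1 w \<noteq> 0}"
        then have "grad_L1 v > 0" using grad_L1_nonneg[of v] by (simp add: less_le)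
        then show "load v / grad_L1 v \<le> D" using le[of v] v by (simp add: divide_le_eq)
      qed
    qed (use w False in auto)
    then show ?thesis using pos by (simp add: divide_le_eq)
  qed
qed

text \<open>The real supremum defining \<open>Yc\<close> is informative only over a nonempty set.
  The witness is the difference of two bumps inside the fluid: it has mean 0 and does not meet the
  solid.\<close>

lemma admissible_nonempty: "{w \<in> H_diamond \<Omega> S. grad_L1 w \<noteq> 0} \<noteq> {}"
proof -
  obtain x r where r: "r > 0" "cball x r \<subseteq> \<Omega>" "cball x r \<inter> S = {}" by (rule fluid_ball)
  obtain b :: 'a where b: "b \<in> Basis" using nonempty_Basis by blast
  \<comment> \<open>Centres at distance \<open>r\<close> from each other with kernels of radius r/4
    give disjoint supports within \<open>cball x r\<close>.\<close>
  define y where "y = x + (r / 2) *\<^sub>R b"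
  define z where "z = x - (r / 2) *\<^sub>R b"
  have nyz: "norm (y - z) = r" "norm (y - x) = r / 2" "norm (z - x) = r / 2"
    using b r by (simp_all add: y_def z_def norm_Basis scaleR_left_distrib[symmetric])
  obtain \<eta> :: "'a \<Rightarrow> real" where m: "mollifier (r / 4) \<eta>" using mollifier_exists[of "r/4"] r by auto
  have cy: "cball y (r/4) \<subseteq> cball x r" "cball z (r/4) \<subseteq> cball x r"
    using nyz r by (auto simp: cball_subset_cball_iff dist_norm)
  define w where "w p = \<eta> (y - p) - \<eta> (z - p)" for p
  have wT: "w \<in> test_fun (cball x r)"
    unfolding w_def[abs_def] by (intro test_fun_diff mollifier_diff_test_fun[OF m] cy)
  have w\<Omega>: "w \<in> test_fun \<Omega>" using wT test_fun_mono[OF r(2)] by blast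
  have wi: "(LINT p|lborel. w p) = 0"
    using mollifier_integrable_diff[OF m] mollifier_integral_diff[OF m] by (simp add: w_def)
  have wS: "grad w p = 0" if "p \<in> S" for p
    by (rule test_fun_grad_zero_outside[OF wT]) (use that r(3) in auto)
  have H: "w \<in> H_diamond \<Omega> S" by (rule test_fun_H_diamond(1)[OF w\<Omega> wi wS])
  have "grad_L1 w \<noteq> 0"
  proof
    assume "grad_L1 w = 0"
    obtain D where D: "D > 0" "\<And>v. v \<in> H_diamond \<Omega> S \<Longrightarrow> (LINT x|lebesgue. \<bar>v x\<bar>) \<le> D * grad_L1 v"
      using poincare by metis
    have "(LINT x|lebesgue. \<bar>w x\<bar>) \<le> 0" using D(2)[OF H] \<open>grad_L1 w = 0\<close> by simp
    moreover have "(LINT p|lebesgue. \<bar>w p\<bar>) \<ge> 1"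
    proof -
      have "1 = (LINT p|lborel. \<eta> (y - p))" by (rule mollifier_integral_diff[OF m, symmetric])
      also have "\<dots> \<le> (LINT p|lborel. \<bar>w p\<bar>)"
      proof (rule integral_mono[OF mollifier_integrable_diff[OF m] integrable_abs[OF test_fun_integrable[OF wT]]])
        fix p
        have "\<eta> (y - p) = 0 \<or> \<eta> (z - p) = 0"
        proof (cases "norm (y - p) < r / 4")
          case True
          then have "norm (z - p) \<ge> r / 4" using nyz(1) norm_triangle_ineq4[of "y - p" "z - p"] r(1) by simp
          then show ?thesis using mollifier_zero[OF m] by blast
        qed (use mollifier_zero[OF m] in \<open>simp add: not_less\<close>)
        then show "\<eta> (y - p) \<le> \<bar>w p\<bar>" by (auto simp: w_def)
      qed
      also have "\<dots> = (LINT p|lebesgue. \<bar>w p\<bar>)"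
        by (rule lebesgue_integral_eq_lborel(2)[symmetric]) (use test_fun_measurable[OF wT] in measurable)
      finally show ?thesis .
    qed
    ultimately show False by simp
  qed
  with H show ?thesis by blast
qed

section \<open>Estimates for minimizers below the critical yield number\<close>

lemma minimizer_estimates:
  assumes "is_arg_min (G_diamond \<Omega> S Y) (\<lambda>w. w \<in> H_diamond \<Omega> S) w"
  shows "w \<in> H_diamond \<Omega> S" "grad_energy w \<le> load w - Y * grad_L1 w"
proof -
  show w: "w \<in> H_diamond \<Omega> S" using assms by (simp add: is_arg_min_def)
  have min: "G_diamond \<Omega> S Y w \<le> G_diamond \<Omega> S Y v" if "v \<in> H_diamond \<Omega> S" for v
    using assms that by (auto simp: is_arg_min_def not_less)
  define d where "d = grad_energy w - (load w - Y * grad_L1 w)"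
  \<comment> \<open>Comparison with \<open>(1 - s) * w\<close>: for s at most 1 the factor is
    nonnegative, so \<open>grad_L1\<close> scales linearly. Division by \<open>s\<close> leaves the
    first-order condition with an error linear in \<open>s\<close>.\<close>
  have "d \<le> grad_energy w / 2 * s" if s: "0 < s" "s \<le> 1" for s
  proof -
    have "G_diamond \<Omega> S Y w \<le> G_diamond \<Omega> S Y (\<lambda>x. (1 - s) * w x)" by (rule min[OF H_diamond_cmult(1)[OF w]])
    then have "1/2 * grad_energy w + Y * grad_L1 w - load w \<le> 1/2 * ((1 - s)\<^sup>2 * grad_energy w) + Y * ((1 - s) * grad_L1 w) - (1 - s) * load w"
      using s by (simp add: G_eq w H_diamond_cmult(1)[OF w] functionals_cmult[OF w])
    then have "s * d \<le> s * (grad_energy w / 2 * s)"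
      by (simp add: d_def power2_eq_square algebra_simps)
    then show ?thesis using s by (simp add: mult_le_cancel_left)
  qed
  then have "d \<le> 0" by (rule le_all_multiples_imp_nonpos)
  then show "grad_energy w \<le> load w - Y * grad_L1 w" by (simp add: d_def)
qed

text \<open>This keeps the rescaling of profiles from dividing by 0. Below \<open>Yc\<close> some
  competitor has a quotient above \<open>Y\<close>, and a small multiple of it has negative energy,
  whereas zero gradient mass would force a nonnegative value.\<close>

lemma minimizer_grad_L1_pos:
  assumes w: "is_arg_min (G_diamond \<Omega> S Y) (\<lambda>w. w \<in> H_diamond \<Omega> S) w" and Y: "Y < Yc"
  shows "grad_L1 w > 0"
proof -
  obtain v where v: "v \<in> H_diamond \<Omega> S" "grad_L1 v \<noteq> 0" "Y < load v / grad_L1 v"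
  proof -
    have "\<exists>v\<in>{w \<in> H_diamond \<Omega> S. grad_L1 w \<noteq> 0}. Y < load v / grad_L1 v"
    proof (rule ccontr)
      assume "\<not> ?thesis"
      then have "Yc \<le> Y" unfolding Yc_eq by (intro cSUP_least[OF admissible_nonempty]) (auto simp: not_less)
      then show False using Y by simp
    qed
    then show ?thesis using that by blast
  qed
  have pos: "grad_L1 v > 0" using v(2) grad_L1_nonneg[of v] by simp
  define k where "k = load v - Y * grad_L1 v"
  have k: "k > 0" using v(3) pos by (simp add: k_def less_divide_eq)
  \<comment> \<open>Up to the summand 1, which covers zero energy, this is the minimizer of the
    quadratic s^2 \<open>grad_energy v\<close> / 2 - s k along the ray.\<close>
  define s where "s = k / (grad_energy v + 1)"
  have s: "s > 0" using k grad_energy_nonneg[of v] by (simp add: s_def add_nonneg_pos)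
  have neg: "G_diamond \<Omega> S Y (\<lambda>x. s * v x) < 0"
  proof -
    have "s * (grad_energy v + 1) = k" using grad_energy_nonneg[of v] by (simp add: s_def)
    then have sA: "s * grad_energy v = k - s" by (simp add: algebra_simps)
    have "G_diamond \<Omega> S Y (\<lambda>x. s * v x) = s * (1/2 * (s * grad_energy v) - k)"
      using s by (simp add: G_eq[OF H_diamond_cmult(1)[OF v(1)]] functionals_cmult[OF v(1)] k_def power2_eq_square algebra_simps)
    also have "\<dots> < 0" unfolding sA using s k by (intro mult_pos_neg) auto
    finally show ?thesis .
  qed
  have "G_diamond \<Omega> S Y w \<le> G_diamond \<Omega> S Y (\<lambda>x. s * v x)"
    using w H_diamond_cmult(1)[OF v(1)] by (auto simp: is_arg_min_def not_less)
  then have Gneg: "G_diamond \<Omega> S Y w < 0" using neg by simp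
  note e = minimizer_estimates[OF w]
  show ?thesis
  proof (rule ccontr)
    assume "\<not> grad_L1 w > 0"
    then have z: "grad_L1 w = 0" using grad_L1_nonneg[of w] by simp
    then have "load w \<le> 0" using load_le_Yc[OF e(1)] by simp
    then show False using Gneg G_eq[OF e(1), of Y] z grad_energy_nonneg[of w] by simp
  qed
qed

text \<open>Young's inequality, integrated over the fluid part, where the whole gradient lives. For
  \<open>d = Yc - Y\<close> the left side dominates the energy of a minimizer, half of which is then
  absorbed, so the constant in the final estimate is exactly the area of the fluid.\<close>

lemma grad_L1_le_grad_energy:
  assumes w: "w \<in> H_diamond \<Omega> S" and d: "d > 0"
  shows "d * grad_L1 w \<le> (d\<^sup>2 * measure lebesgue (\<Omega> - S) + grad_energy w) / 2"
proof -
  note v = H_diamondD[OF w]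
  have "\<Omega> \<in> lmeasurable" by (rule lmeasurable_open[OF bounded open_domain])
  then have F: "\<Omega> - S \<in> lmeasurable" by (rule fmeasurable_Diff) (rule sets_lebesgue(2))
  then have iF: "integrable lebesgue (indicat_real (\<Omega> - S))"
    by (auto simp: fmeasurable_def integrable_indicator_iff)
  have "d * grad_L1 w = (LINT x|lebesgue. d * norm (zgrad \<Omega> w x))" by (simp add: grad_L1_def)
  also have "\<dots> \<le> (LINT x|lebesgue. (d\<^sup>2 * indicator (\<Omega> - S) x + (norm (zgrad \<Omega> w x))\<^sup>2) / 2)"
  proof (rule integral_mono_AE)
    show "AE x in lebesgue. d * norm (zgrad \<Omega> w x) \<le> (d\<^sup>2 * indicator (\<Omega> - S) x + (norm (zgrad \<Omega> w x))\<^sup>2) / 2"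
      using v(4)
    proof eventually_elim
      fix x assume S: "x \<in> S \<longrightarrow> zgrad \<Omega> w x = 0"
      show "d * norm (zgrad \<Omega> w x) \<le> (d\<^sup>2 * indicator (\<Omega> - S) x + (norm (zgrad \<Omega> w x))\<^sup>2) / 2"
      proof (cases "x \<in> \<Omega> - S")
        case True
        have "0 \<le> (d - norm (zgrad \<Omega> w x))\<^sup>2" by simp
        then show ?thesis using True by (simp add: power2_diff)
      next
        case False
        then have "zgrad \<Omega> w x = 0" using S by (auto simp: zgrad_def)
        then show ?thesis by simp
      qed
    qed
  qed (use v(6,7) iF in auto)
  also have "\<dots> = (d\<^sup>2 * measure lebesgue (\<Omega> - S) + grad_energy w) / 2"
    using v(7) iF by (simp add: grad_energy_def)
  finally show ?thesis .
qed

lemma minimizer_grad_energy_le: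
  assumes w: "is_arg_min (G_diamond \<Omega> S Y) (\<lambda>w. w \<in> H_diamond \<Omega> S) w" and Y: "Y < Yc"
  shows "grad_energy w \<le> measure lebesgue (\<Omega> - S) * (Yc - Y)\<^sup>2"
proof -
  note e = minimizer_estimates[OF w]
  have "grad_energy w \<le> (Yc - Y) * grad_L1 w" using e(2) load_le_Yc[OF e(1)] by (simp add: left_diff_distrib)
  also have "\<dots> \<le> ((Yc - Y)\<^sup>2 * measure lebesgue (\<Omega> - S) + grad_energy w) / 2"
    by (rule grad_L1_le_grad_energy[OF e(1)]) (use Y in simp)
  finally show ?thesis by (simp add: mult.commute)
qed

text \<open>There is no gap between the two classes: the supremum \<open>Yc\<close> over Sobolev
  functions still bounds the load by the total variation. Smooth approximants of \<open>u\<close>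
  miss only the mean value condition, and by an amount that tends to 0.\<close>

lemma TV_lower_bound:
  assumes u: "u \<in> BV_diamond \<Omega> S" and Yc: "Yc > 0"
  shows "ereal (measure lebesgue S / Yc) \<le> TV u"
proof -
  have ui: "integrable lebesgue u" and fin: "TV u < \<infinity>" and mean: "(LINT x:\<Omega>|lebesgue. u x) = 0"
    and l: "1 / measure lebesgue S * load u = 1" and g0: "\<And>\<phi>. \<phi> \<in> test_fun S \<Longrightarrow> dist_grad u \<phi> = 0"
    and z: "AE x in lebesgue. x \<notin> \<Omega> \<longrightarrow> u x = 0"
    using u by (auto simp: BV_diamond_def BV_def load_def)
  have l: "load u = measure lebesgue S" using l measure_solid_pos by (simp add: field_simps)
  obtain C where C: "TV u = ereal C" using fin TV_nonneg[of u] by (cases "TV u") auto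
  obtain u0 where u0: "integrable lborel u0" "AE x in lebesgue. u x = u0 x"
    using lebesgue_borel_representative[OF ui] by blast
  \<comment> \<open>The approximation asks for a Borel function that vanishes at every point outside
    \<Omega>; the membership of \<open>u\<close> gives this only almost everywhere.\<close>
  define u' where "u' x = indicator \<Omega> x * u0 x" for x
  have u'i: "integrable lborel u'" unfolding u'_def[abs_def]
    using integrable_mult_indicator[OF _ u0(1), of \<Omega>] open_domain by simp
  have u'z: "x \<notin> \<Omega> \<Longrightarrow> u' x = 0" for x by (simp add: u'_def)
  have ae: "AE x in lebesgue. u x = u' x"
    using u0(2) z by eventually_elim (auto simp: u'_def indicator_def)
  note u'L = integrable_lebesgueI[OF u'i]
  have m: "u \<in> borel_measurable lebesgue" "u' \<in> borel_measurable lebesgue"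
    using ui u'L by (auto dest: borel_measurable_integrable)
  have mean': "(LINT x|lebesgue. u' x) = 0"
  proof -
    have "(LINT x:\<Omega>|lebesgue. u x) = (LINT x|lebesgue. u' x)"
      unfolding set_lebesgue_integral_def
    proof (rule integral_cong_AE)
      show "(\<lambda>x. indicator \<Omega> x *\<^sub>R u x) \<in> borel_measurable lebesgue"
        using integrable_mult_indicator[OF sets_lebesgue(1) ui] by (rule borel_measurable_integrable)
      show "AE x in lebesgue. indicator \<Omega> x *\<^sub>R u x = u' x"
        using ae by eventually_elim (auto simp: u'_def indicator_def)
    qed (rule m)
    then show ?thesis using mean by simp
  qed
  have load': "load u' = measure lebesgue S"
  proof -
    have "load u = load u'" unfolding load_def set_lebesgue_integral_def
    proof (rule integral_cong_AE)
      show "(\<lambda>x. indicator S x *\<^sub>R u x) \<in> borel_measurable lebesgue" "(\<lambda>x. indicator S x *\<^sub>R u' x) \<in> borel_measurable lebesgue"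
        using integrable_mult_indicator[OF sets_lebesgue(2) ui] integrable_mult_indicator[OF sets_lebesgue(2) u'L]
        by (auto dest: borel_measurable_integrable)
      show "AE x in lebesgue. indicator S x *\<^sub>R u x = indicator S x *\<^sub>R u' x" using ae by eventually_elim simp
    qed
    with l show ?thesis by simp
  qed
  have TVC: "- (LINT x|lborel. u' x * divergence \<phi> x) \<le> C" if "\<phi> \<in> test_fun UNIV" "\<And>x. norm (\<phi> x) \<le> 1" for \<phi>
    using dist_grad_le_TV[OF C that] dist_grad_representative[OF ui u'i ae that(1)] by simp
  have grad0: "(LINT x|lborel. u' x * frechet_derivative \<psi> (at x) b) = 0" if "\<psi> \<in> test_fun S" "b \<in> Basis" for \<psi> b
    using g0[OF divergence_scaleR_Basis(1)[OF that]] dist_grad_representative[OF ui u'i ae divergence_scaleR_Basis(1)[OF that]]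
    by (simp add: divergence_scaleR_Basis(2)[OF that])

  obtain x r where r: "r > 0" "cball x r \<subseteq> \<Omega>" "cball x r \<inter> S = {}" by (rule fluid_ball)
  obtain \<eta> :: "'a \<Rightarrow> real" where h: "mollifier r \<eta>" using mollifier_exists[OF r(1)] by auto
  \<comment> \<open>A bump of mass 1 in the fluid. Subtracting \<open>k * \<psi>\<close> restores
    mean 0, changes neither the load nor the gradient on the solid, and adds at most
    \<open>e * P\<close> of gradient mass.\<close>
  define \<psi> where "\<psi> p = \<eta> (x - p)" for p
  have \<psi>T: "\<psi> \<in> test_fun (cball x r)" unfolding \<psi>_def[abs_def] by (rule mollifier_diff_test_fun[OF h order_refl])
  have \<psi>\<Omega>: "\<psi> \<in> test_fun \<Omega>" using \<psi>T test_fun_mono[OF r(2)] by blast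
  have \<psi>1: "(LINT p|lborel. \<psi> p) = 1" unfolding \<psi>_def by (rule mollifier_integral_diff[OF h])
  have \<psi>S: "\<psi> p = 0" "grad \<psi> p = 0" if "p \<in> S" for p
  proof -
    have "p \<notin> cball x r" using that r(3) by blast
    then show "\<psi> p = 0" "grad \<psi> p = 0"
      using test_fun_zero_outside[OF \<psi>T] test_fun_grad_zero_outside[OF \<psi>T] by blast+
  qed
  define P where "P = (LINT p|lborel. norm (grad \<psi> p))"
  have P0: "P \<ge> 0" by (simp add: P_def)

  have est: "measure lebesgue S - Yc * C \<le> (1 + Yc * (1 + P)) * e" if e: "0 < e" "e \<le> 1" for e
  proof -
    obtain w where w: "w \<in> test_fun \<Omega>" "\<And>x. x \<in> S \<Longrightarrow> grad w x = 0"
        "(LINT x|lborel. \<bar>w x - u' x\<bar>) \<le> e" "(LINT x|lborel. norm (grad w x)) \<le> C + e"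
      using smooth_approximation[OF bounded open_domain open_solid sub
          common_inward_cone[OF lip frontiers] u'i u'z TVC grad0 e(1)] by blast
    note wi = test_fun_integrable[OF w(1)] and \<psi>i = test_fun_integrable[OF \<psi>T]
    have me: "u' \<in> borel_measurable borel" "w \<in> borel_measurable borel"
      using borel_measurable_integrable[OF u'i] test_fun_measurable[OF w(1)] by auto
    define k where "k = (LINT x|lborel. w x)"
    have k: "\<bar>k\<bar> \<le> e"
    proof -
      have "(LINT x|lborel. u' x) = 0" using mean' lebesgue_integral_eq_lborel(2)[OF me(1)] by simp
      then have "\<bar>k\<bar> \<le> (LINT x|lborel. \<bar>w x - u' x\<bar>)"
        using abs_integral_diff_le[OF wi u'i, of "\<lambda>x. \<bar>w x - u' x\<bar>"] wi u'i by (simp add: k_def)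
      then show ?thesis using w(3) by simp
    qed
    define w2 where "w2 x = w x - k * \<psi> x" for x
    have w2T: "w2 \<in> test_fun \<Omega>" unfolding w2_def[abs_def] by (intro test_fun_diff test_fun_cmult w(1) \<psi>\<Omega>)
    have gw2: "grad w2 p = grad w p - k *\<^sub>R grad \<psi> p" for p
      unfolding w2_def[abs_def]
      by (subst grad_diff[OF test_fun_Ck[OF w(1)] test_fun_Ck[OF test_fun_cmult[OF \<psi>\<Omega>]]])
         (simp only: grad_cmult[OF test_fun_Ck[OF \<psi>\<Omega>]])
    have "(LINT x|lborel. w2 x) = 0" using wi \<psi>i \<psi>1 by (simp add: w2_def k_def)
    note H = test_fun_H_diamond[OF w2T this]
    have gS: "grad w2 p = 0" if "p \<in> S" for p using gw2 w(2) \<psi>S(2) that by simp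
    note H = H[OF gS]
    have "grad_L1 w2 \<le> C + e + e * P"
    proof -
      note gi = test_fun_integrable[OF grad_test_fun[OF w(1)]] test_fun_integrable[OF grad_test_fun[OF \<psi>T]]
      have "grad_L1 w2 = (LINT p|lborel. norm (grad w2 p))" unfolding grad_L1_def using H(2) by simp
      also have "\<dots> \<le> (LINT p|lborel. norm (grad w p) + \<bar>k\<bar> * norm (grad \<psi> p))"
      proof (rule integral_mono)
        show "norm (grad w2 p) \<le> norm (grad w p) + \<bar>k\<bar> * norm (grad \<psi> p)" for p
          unfolding gw2 using norm_triangle_ineq4[of "grad w p" "k *\<^sub>R grad \<psi> p"] by simp
      qed (use gi test_fun_integrable[OF grad_test_fun[OF w2T]] in auto)
      also have "\<dots> = (LINT p|lborel. norm (grad w p)) + \<bar>k\<bar> * P" using gi by (simp add: P_def)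
      also have "\<dots> \<le> C + e + e * P" using w(4) mult_right_mono[OF k P0] by simp
      finally show ?thesis .
    qed
    moreover have "load w2 \<ge> measure lebesgue S - e"
    proof -
      have "load w2 = load w" unfolding load_def set_lebesgue_integral_def
        by (rule Bochner_Integration.integral_cong) (use \<psi>S(1) in \<open>auto simp: w2_def indicator_def\<close>)
      moreover have "\<bar>load w - load u'\<bar> \<le> e"
      proof -
        have "\<bar>load (\<lambda>x. w x - u' x)\<bar> \<le> (LINT x|lebesgue. \<bar>w x - u' x\<bar>)"
          by (rule load_le_L1) (use integrable_lebesgueI[OF wi] u'L in auto)
        also have "\<dots> = (LINT x|lborel. \<bar>w x - u' x\<bar>)"
          by (rule lebesgue_integral_eq_lborel(2)) (use me in measurable)
        finally show ?thesis using load_diff[OF integrable_lebesgueI[OF wi] u'L] w(3) by simp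
      qed
      ultimately show ?thesis using load' by simp
    qed
    moreover have "load w2 \<le> Yc * grad_L1 w2" by (rule load_le_Yc[OF H(1)])
    ultimately have "measure lebesgue S - e \<le> Yc * (C + e + e * P)"
      using mult_left_mono[of "grad_L1 w2" "C + e + e * P" Yc] Yc by linarith
    then show ?thesis by (simp add: algebra_simps)
  qed
  have "measure lebesgue S - Yc * C \<le> 0" by (rule le_all_multiples_imp_nonpos[OF est])
  then show ?thesis unfolding C using Yc by (simp add: divide_le_eq mult.commute)
qed

lemma profiles_converge:
  assumes w: "\<And>n. is_arg_min (G_diamond \<Omega> S (Y n)) (\<lambda>w. w \<in> H_diamond \<Omega> S) (w n)"
    and Y: "\<And>n::nat. 0 \<le> Y n" "\<And>n. Y n < Yc" "Y \<longlonglongrightarrow> Yc"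
  shows "\<exists>r v. strict_mono r \<and> integrable lebesgue v \<and>
    (\<lambda>k. LINT x|lebesgue. \<bar>rescaled_profile \<Omega> (w (r k)) x - v x\<bar>) \<longlonglongrightarrow> 0 \<and>
    0 < (LINT x:S|lebesgue. v x) \<and> problem1_solution \<Omega> S (unit_mean S v)"
proof -
  have Ycpos: "Yc > 0" using Y(1)[of 0] Y(2)[of 0] by simp
  define v where "v n = rescaled_profile \<Omega> (w n)" for n
  have v_eq: "v n = (\<lambda>x. (1 / grad_L1 (w n)) * w n x)" for n
    by (rule ext) (simp add: v_def rescaled_profile_def grad_L1_eq)
  note wH = minimizer_estimates(1)[OF w] and Apos = minimizer_grad_L1_pos[OF w Y(2)]
  have vH: "v n \<in> H_diamond \<Omega> S" for n unfolding v_eq by (rule H_diamond_cmult(1)[OF wH])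
  have grad_L1_v: "grad_L1 (v n) = 1" for n unfolding v_eq functionals_cmult(1)[OF wH] using Apos[of n] by simp
  \<comment> \<open>The lower bound drops the nonnegative energy from the minimizer estimate;
    together with the definition of \<open>Yc\<close> it squeezes the load of the profiles towards
    \<open>Yc\<close>.\<close>
  have loadv: "Y n \<le> load (v n)" "load (v n) \<le> Yc" for n
  proof -
    have "Y n * grad_L1 (w n) \<le> load (w n)" using minimizer_estimates(2)[OF w, of n] grad_energy_nonneg[of "w n"] by simp
    then show "Y n \<le> load (v n)" unfolding v_eq functionals_cmult(3)[OF wH] using Apos[of n] by (simp add: le_divide_eq)
    show "load (v n) \<le> Yc" using load_le_Yc[OF vH, of n] by (simp add: grad_L1_v)
  qed
  note vi = H_diamondD(5)[OF vH] and vz = H_diamondD(2)[OF vH]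
  obtain D where D: "D > 0" "\<And>v. v \<in> H_diamond \<Omega> S \<Longrightarrow> (LINT x|lebesgue. \<bar>v x\<bar>) \<le> D * grad_L1 v"
    using poincare by metis
  have vD: "(LINT x|lebesgue. \<bar>v n x\<bar>) \<le> D" for n using D(2)[OF vH, of n] by (simp add: grad_L1_v)
  have vt: "(LINT x|lebesgue. \<bar>v n (x + h) - v n x\<bar>) \<le> norm h" for n h
    using H10_translation[OF open_domain bounded H_diamondD(1)[OF vH] vz, of n h] grad_L1_v[of n] by (simp add: grad_L1_def)
  obtain r g where r: "strict_mono (r::nat\<Rightarrow>nat)" and g: "integrable lebesgue g"
    and lim: "(\<lambda>n. LINT x|lebesgue. \<bar>v (r n) x - g x\<bar>) \<longlonglongrightarrow> 0"
    using L1_compact[OF bounded, of v D, OF vi vz vD vt] by blast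
  have di: "integrable lebesgue (\<lambda>x. v n x - g x)" for n using vi g by simp

  have lg: "load g = Yc"
  proof -
    have "(\<lambda>n. load (v (r n))) \<longlonglongrightarrow> load g"
    proof (rule tendsto_of_abs_diff_le[OF _ lim])
      show "\<bar>load (v (r n)) - load g\<bar> \<le> (LINT x|lebesgue. \<bar>v (r n) x - g x\<bar>)" for n
        using load_le_L1[OF di] load_diff[OF vi g] by simp
    qed
    moreover have "(\<lambda>n. load (v (r n))) \<longlonglongrightarrow> Yc"
    proof (rule tendsto_sandwich[OF _ _ _ tendsto_const])
      show "(\<lambda>n. Y (r n)) \<longlonglongrightarrow> Yc" using LIMSEQ_subseq_LIMSEQ[OF Y(3) r] by (simp add: o_def)
    qed (auto intro!: always_eventually loadv)
    ultimately show ?thesis by (rule LIMSEQ_unique)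
  qed
  have mg: "(LINT x:\<Omega>|lebesgue. g x) = 0"
  proof -
    have i: "integrable lebesgue (\<lambda>x. indicator \<Omega> x * f x)" if "integrable lebesgue f" for f :: "'a \<Rightarrow> real"
      by (rule integrable_mult_indicator_lebesgue[OF sets_lebesgue(1) that])
    have "(\<lambda>n. LINT x:\<Omega>|lebesgue. v (r n) x) \<longlonglongrightarrow> (LINT x:\<Omega>|lebesgue. g x)"
    proof (rule tendsto_of_abs_diff_le[OF _ lim])
      show "\<bar>(LINT x:\<Omega>|lebesgue. v (r n) x) - (LINT x:\<Omega>|lebesgue. g x)\<bar> \<le> (LINT x|lebesgue. \<bar>v (r n) x - g x\<bar>)" for n
        unfolding set_lebesgue_integral_def real_scaleR_def
        by (rule abs_integral_diff_le[OF i[OF vi] i[OF g] integrable_abs[OF di]]) (auto simp: indicator_def)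
    qed
    moreover have "(LINT x:\<Omega>|lebesgue. v n x) = 0" for n using vH[of n] by (simp add: H_diamond_def)
    ultimately show ?thesis by (simp add: LIMSEQ_const_iff)
  qed
  have zg: "AE x in lebesgue. x \<notin> \<Omega> \<longrightarrow> g x = 0"
  proof -
    have cO: "- \<Omega> \<in> sets lebesgue" using sets_lebesgue(1) by (simp add: Compl_in_sets_lebesgue)
    have i: "integrable lebesgue (\<lambda>x. indicator (- \<Omega>) x * \<bar>g x\<bar>)"
      by (rule integrable_mult_indicator_lebesgue[OF cO integrable_abs[OF g]])
    have "(LINT x|lebesgue. indicator (- \<Omega>) x * \<bar>g x\<bar>) \<le> (LINT x|lebesgue. \<bar>v (r n) x - g x\<bar>)" for n
      by (rule integral_mono[OF i integrable_abs[OF di]]) (use vz in \<open>auto simp: indicator_def\<close>)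
    then have "(LINT x|lebesgue. indicator (- \<Omega>) x * \<bar>g x\<bar>) \<le> 0"
      using LIMSEQ_le_const[OF lim] by blast
    moreover have "(LINT x|lebesgue. indicator (- \<Omega>) x * \<bar>g x\<bar>) \<ge> 0" by simp
    ultimately have "AE x in lebesgue. indicator (- \<Omega>) x * \<bar>g x\<bar> = 0"
      using integral_nonneg_eq_0_iff_AE[OF i] by simp
    then show ?thesis by eventually_elim (auto simp: indicator_def split: if_splits)
  qed
  have dv: "dist_grad (v n) \<phi> = (LINT x|lebesgue. zgrad \<Omega> (v n) x \<bullet> \<phi> x)" if "\<phi> \<in> test_fun V" for n \<phi> V
    by (rule H10_dist_grad[OF open_domain bounded H_diamondD(1)[OF vH] vz that])
  have dlim: "(\<lambda>n. dist_grad (v (r n)) \<phi>) \<longlonglongrightarrow> dist_grad g \<phi>" if "\<phi> \<in> test_fun V" for \<phi> V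
    by (rule dist_grad_tendsto[OF that g vi lim])
  \<comment> \<open>Lower semicontinuity: each profile has gradient mass 1, so each test field
    bounded by 1 gives at most 1, and the bound passes to the limit.\<close>
  have dg1: "dist_grad g \<phi> \<le> 1" if \<phi>: "\<phi> \<in> test_fun UNIV" "\<And>x. norm (\<phi> x) \<le> 1" for \<phi>
  proof (rule LIMSEQ_le_const2[OF dlim[OF \<phi>(1)]])
    have "dist_grad (v n) \<phi> \<le> 1" for n
    proof -
      note zi = H_diamondD(6)[OF vH, of n]
      have "dist_grad (v n) \<phi> \<le> grad_L1 (v n)" unfolding dv[OF \<phi>(1)] grad_L1_def
      proof (rule integral_mono[OF integrable_inner_test_fun[OF zi \<phi>] integrable_norm[OF zi]])
        fix x
        have "zgrad \<Omega> (v n) x \<bullet> \<phi> x \<le> norm (zgrad \<Omega> (v n) x) * norm (\<phi> x)" by (rule norm_cauchy_schwarz)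
        also have "\<dots> \<le> norm (zgrad \<Omega> (v n) x) * 1" by (rule mult_left_mono[OF \<phi>(2)]) simp
        finally show "zgrad \<Omega> (v n) x \<bullet> \<phi> x \<le> norm (zgrad \<Omega> (v n) x)" by simp
      qed
      then show ?thesis by (simp add: grad_L1_v)
    qed
    then show "\<exists>N. \<forall>n\<ge>N. dist_grad (v (r n)) \<phi> \<le> 1" by blast
  qed
  have dg0: "dist_grad g \<phi> = 0" if \<phi>: "\<phi> \<in> test_fun S" for \<phi>
  proof -
    have "dist_grad (v n) \<phi> = 0" for n
    proof -
      have "AE x in lebesgue. zgrad \<Omega> (v n) x \<bullet> \<phi> x = 0"
        using H_diamondD(4)[OF vH, of n] by eventually_elim (use test_fun_zero_outside[OF \<phi>] in auto)
      then show ?thesis unfolding dv[OF \<phi>] by (rule integral_eq_zero_AE)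
    qed
    then show ?thesis using dlim[OF \<phi>] by (simp add: LIMSEQ_const_iff)
  qed

  \<comment> \<open>The limit has load \<open>Yc\<close> and variation at most 1, while
    \<open>BV_diamond\<close> prescribes load |S|. The factor |S| / Yc turns the variation bound
    into precisely the value of \<open>TV_lower_bound\<close>.\<close>
  define u where "u = unit_mean S g"
  have u_eq: "u = (\<lambda>x. (measure lebesgue S / Yc) * g x)"
    unfolding u_def by (rule ext) (simp add: unit_mean_def lg[unfolded load_def])
  have TVu: "TV u \<le> ereal (measure lebesgue S / Yc)"
  proof (rule TV_leI)
    fix \<phi> :: "'a \<Rightarrow> 'a" assume "\<phi> \<in> test_fun UNIV" "\<And>x. norm (\<phi> x) \<le> 1"
    from mult_left_mono[OF dg1[OF this], of "measure lebesgue S / Yc"]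
    show "dist_grad u \<phi> \<le> measure lebesgue S / Yc"
      unfolding u_eq dist_grad_cmult using Ycpos by simp
  qed
  have "u \<in> BV_diamond \<Omega> S"
    unfolding BV_diamond_def
  proof (intro CollectI conjI ballI)
    have "TV u < \<infinity>" using TVu by (rule order.strict_trans1) simp
    moreover have "integrable lebesgue u" unfolding u_eq using g by simp
    ultimately show "u \<in> BV" by (simp add: BV_def)
    show "(LINT x:\<Omega>|lebesgue. u x) = 0" unfolding u_eq using mg by simp
    show "1 / measure lebesgue S * (LINT x:S|lebesgue. u x) = 1"
      unfolding u_eq using lg[unfolded load_def] Ycpos measure_solid_pos by simp
    show "dist_grad u \<phi> = 0" if "\<phi> \<in> test_fun S" for \<phi> unfolding u_eq dist_grad_cmult using dg0[OF that] by simp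
    show "AE x in lebesgue. x \<notin> \<Omega> \<longrightarrow> u x = 0" using zg by eventually_elim (simp add: u_eq)
  qed
  moreover have "\<not> TV y < TV u" if "y \<in> BV_diamond \<Omega> S" for y
    using order_trans[OF TVu TV_lower_bound[OF that Ycpos]] by (simp add: not_less)
  ultimately have "problem1_solution \<Omega> S (unit_mean S g)"
    unfolding problem1_solution_def is_arg_min_def u_def[symmetric] by blast
  moreover have "0 < (LINT x:S|lebesgue. g x)" using lg Ycpos by (simp add: load_def)
  ultimately show ?thesis using r g lim unfolding v_def by blast
qed

end

theorem theorem4:
  fixes \<Omega> \<Omega>\<^sub>s :: "(real^2) set" and \<omega> :: "real \<Rightarrow> real^2 \<Rightarrow> real"
  assumes "bounded \<Omega>" and "strongly_lipschitz \<Omega>"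
    and "bounded \<Omega>\<^sub>s" and "strongly_lipschitz \<Omega>\<^sub>s"
    and "\<Omega>\<^sub>s \<subseteq> \<Omega>" and "\<Omega>\<^sub>s \<noteq> {}"
    and "frontier \<Omega>\<^sub>s \<inter> frontier \<Omega> = {}"
    and "finite (components \<Omega>\<^sub>s)"
    and "\<And>Y. 0 \<le> Y \<Longrightarrow>
           is_arg_min (G_diamond \<Omega> \<Omega>\<^sub>s Y) (\<lambda>w. w \<in> H_diamond \<Omega> \<Omega>\<^sub>s) (\<omega> Y)"
  shows "(\<forall>Y. 0 \<le> Y \<and> Y < critical_yield \<Omega> \<Omega>\<^sub>s \<longrightarrow>
            (LINT x:\<Omega>|lebesgue. (norm (wgrad \<Omega> (\<omega> Y) x))\<^sup>2)
              \<le> measure lebesgue (\<Omega> - \<Omega>\<^sub>s) * (critical_yield \<Omega> \<Omega>\<^sub>s - Y)\<^sup>2) \<and>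
         (\<forall>Y :: nat \<Rightarrow> real.
            (\<forall>n. 0 \<le> Y n \<and> Y n < critical_yield \<Omega> \<Omega>\<^sub>s) \<and> Y \<longlonglongrightarrow> critical_yield \<Omega> \<Omega>\<^sub>s \<longrightarrow>
            (\<exists>r v. strict_mono r \<and> integrable lebesgue v \<and>
               (\<lambda>k. LINT x|lebesgue. \<bar>rescaled_profile \<Omega> (\<omega> (Y (r k))) x - v x\<bar>) \<longlonglongrightarrow> 0 \<and>
               0 < (LINT x:\<Omega>\<^sub>s|lebesgue. v x) \<and>
               problem1_solution \<Omega> \<Omega>\<^sub>s (unit_mean \<Omega>\<^sub>s v)))"
proof -
  interpret flow_geometry \<Omega> \<Omega>\<^sub>s by unfold_locales fact+
  show ?thesis
  proof (intro conjI allI impI)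
    fix Y assume "0 \<le> Y \<and> Y < critical_yield \<Omega> \<Omega>\<^sub>s"
    then show "(LINT x:\<Omega>|lebesgue. (norm (wgrad \<Omega> (\<omega> Y) x))\<^sup>2)
              \<le> measure lebesgue (\<Omega> - \<Omega>\<^sub>s) * (critical_yield \<Omega> \<Omega>\<^sub>s - Y)\<^sup>2"
      unfolding grad_energy_eq using minimizer_grad_energy_le[OF assms(9)] by simp
  next
    fix Y :: "nat \<Rightarrow> real"
    assume Y: "(\<forall>n. 0 \<le> Y n \<and> Y n < critical_yield \<Omega> \<Omega>\<^sub>s) \<and> Y \<longlonglongrightarrow> critical_yield \<Omega> \<Omega>\<^sub>s"
    show "\<exists>r v. strict_mono r \<and> integrable lebesgue v \<and>
               (\<lambda>k. LINT x|lebesgue. \<bar>rescaled_profile \<Omega> (\<omega> (Y (r k))) x - v x\<bar>) \<longlonglongrightarrow> 0 \<and>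
               0 < (LINT x:\<Omega>\<^sub>s|lebesgue. v x) \<and>
               problem1_solution \<Omega> \<Omega>\<^sub>s (unit_mean \<Omega>\<^sub>s v)"
      by (rule profiles_converge[of Y "\<lambda>n. \<omega> (Y n)"]) (use Y assms(9) in auto)
  qed
qed

end
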